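(* Let $A$ be a symmetric positive definite $n\times n$ matrix, and let $\{u^{\varepsilon}\}_{\varepsilon>0}$ be a family of smooth solutions on $\mathbb{R}\times[0,T]$ of $$\partial_t u+\partial_x F(u)=G(u)+\varepsilon(Au_{xx}-u_{tt}),\qquad u\in\mathbb{R}^n,$$ emanating from smooth initial data. The family $\{u^{\varepsilon}\}$ is assumed to decay fast at infinity. Assume: (1) (Entropy) there are $\eta,q:\mathbb{R}^n\to\mathbb{R}$ and $\alpha,\beta>0$ with $\eta$ strictly convex, $\mathrm{D}\eta(u)\,\mathrm{D}F(u)=\mathrm{D}q(u)$, $\beta I\le \mathrm{D}^2\eta(u)\le\tfrac12\alpha I$ for all $u\in\mathbb{R}^n$, $\eta(u)\ge\eta(0)=0$ and $\mathrm{D}\eta(0)=0$; (2) (Subcharacteristic condition) for this $\alpha$ there is $\nu>0$ with $\tfrac12\big(A\,\mathrm{D}^2\eta(u)+\mathrm{D}^2\eta(u)A\big)-\alpha\,\mathrm{D}F(u)^{\top}\mathrm{D}F(u)\ge\nu I$ for all $u\in\mathbb{R}^n$; (3) (Weak dissipation) $-\big(\mathrm{D}\eta(u)-\mathrm{D}\eta(\bar u)\big)\big(G(u)-G(\bar u)\big)\ge0$ for all $u,\bar u\in\mathbb{R}^n$; (4) (Source potential) there are $R:\mathbb{R}^n\to\mathbb{R}$ and a constant $C_R$ with $G(u)=-\mathrm{D}R(u)^{\top}$, $R(u)\ge R(0)=0$, $\mathrm{D}R(0)^{\top}=0$, and $|\mathrm{D}R(u)|=|G(u)|\le C_R(1+R(u))$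 for all $u\in\mathbb{R}^n$; so that the following stability estimate holds for all $t\in[0,T]$, with a constant $C_1=C_1(A,\alpha,\beta)>0$ independent of $\varepsilon$ and $T$: $$\varphi(t)+\varepsilon\int_{\mathbb{R}}R(u^{\varepsilon}(x,t))\,dx+\int_0^t\!\int_{\mathbb{R}}|\mathrm{D}\eta(u^{\varepsilon})G(u^{\varepsilon})|\,dx\,dt\le C_1\Big(\varphi(0)+\varepsilon\int_{\mathbb{R}}R(u^{\varepsilon}(x,0))\,dx\Big),$$ where $\varphi(t)=\int_{\mathbb{R}}|u^{\varepsilon}|^2+\varepsilon^2|u^{\varepsilon}_x|^2+\varepsilon^2|u^{\varepsilon}_t|^2\,dx$. Then, for entropy-entropy flux pairs $(\bar\eta,\bar q)$ (i.e. $\mathrm{D}\bar\eta\,\mathrm{D}F=\mathrm{D}\bar q$) satisfying, for some constants $C,M$, $$\|\bar\eta\|_{L^\infty},\ \|\bar q\|_{L^\infty},\ \|\mathrm{D}\bar\eta\|_{L^\infty},\ \|\mathrm{D}^2\bar\eta\|_{L^\infty}\le C$$ and $$|\mathrm{D}\bar\eta(v)G(v)|\le C\big(M-\mathrm{D}\eta(v)G(v)\big)\qquad\text{for all }v\in\mathbb{R}^n,$$ the family $\{\partial_t\bar\eta(u^{\varepsilon})+\partial_x\bar q(u^{\varepsilon})\}_{\varepsilon}$ lies in a compact set of $H^{-1}_{loc}(\mathbb{R}\times[0,T])$.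
   Context: The space dimension is one. $F,G:\mathbb{R}^n\to\mathbb{R}^n$ are column-vector valued, and $G$ is continuous with $G(0)=0$. $\mathrm{D}$ is the differential with respect to the state vector $u\in\mathbb{R}^n$, acting as a row operation; so $\mathrm{D}\eta$, $\mathrm{D}R$ are row vectors, $\mathrm{D}F$ is the Jacobian and $\mathrm{D}^2\eta$ the Hessian. $I$ is the $n\times n$ identity matrix, and matrix inequalities are in the sense of quadratic forms.
   Formalization: For the compactness claim the initial data are assumed to satisfy φ(0)+ε∫R(u^ε(x,0))dx ≤ K(1+ε²) for all ε>0 with one constant K (automatic for data independent of ε); with arbitrary ε-dependent smooth data the claim fails. *)

theory Defs
  imports "HOL-Analysis.Analysis"
begin

subsection \<open>Differential calculus\<close>

text \<open>\<open>C\<^sup>k\<close> on a set, with derivatives taken within the set. It is used on the whole space and on the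
  strip \<open>\<real> \<times> [0, T]\<close> with \<open>T > 0\<close>; there the derivative within the set is unique, and it is
  one-sided in time at \<open>t = 0\<close> and \<open>t = T\<close>.\<close>

primrec Ck_on :: "nat \<Rightarrow> 'a::euclidean_space set \<Rightarrow> ('a \<Rightarrow> 'b::real_normed_vector) \<Rightarrow> bool" where
  "Ck_on 0 S f \<longleftrightarrow> continuous_on S f"
| "Ck_on (Suc k) S f \<longleftrightarrow>
     (\<exists>f'. (\<forall>x\<in>S. (f has_derivative f' x) (at x within S)) \<and> (\<forall>v. Ck_on k S (\<lambda>x. f' x v)))"

definition Cinf_on :: "'a::euclidean_space set \<Rightarrow> ('a \<Rightarrow> 'b::real_normed_vector) \<Rightarrow> bool" where
  "Cinf_on S f \<longleftrightarrow> (\<forall>k. Ck_on k S f)"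

text \<open>The row vector \<open>Df(u)\<close>. For vector fields the Jacobian matrix is the library's
  \<open>jacobian\<close>; the Hessian is the Jacobian of the gradient.\<close>

definition grad :: "(real^'n \<Rightarrow> real) \<Rightarrow> real^'n \<Rightarrow> real^'n" where
  "grad f u = (\<chi> i. frechet_derivative f (at u) (axis i 1))"

definition hessian :: "(real^'n \<Rightarrow> real) \<Rightarrow> real^'n \<Rightarrow> real^'n^'n" where
  "hessian f u = jacobian (grad f) (at u)"

definition strictly_convex :: "('a::real_vector \<Rightarrow> real) \<Rightarrow> bool" where
  "strictly_convex f \<longleftrightarrow>
     (\<forall>x y. x \<noteq> y \<longrightarrow> (\<forall>s\<in>{0<..<1}. f ((1 - s) *\<^sub>R x + s *\<^sub>R y) < (1 - s) * f x + s * f y))"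

definition sym_pos_def :: "real^'n^'n \<Rightarrow> bool" where
  "sym_pos_def A \<longleftrightarrow> transpose A = A \<and> (\<forall>\<xi>. \<xi> \<noteq> 0 \<longrightarrow> \<xi> \<bullet> (A *v \<xi>) > 0)"

definition form_le :: "real^'n^'n \<Rightarrow> real^'n^'n \<Rightarrow> bool" where
  "form_le P Q \<longleftrightarrow> (\<forall>\<xi>. \<xi> \<bullet> (P *v \<xi>) \<le> \<xi> \<bullet> (Q *v \<xi>))"

text \<open>Functions on space-time take the pair \<open>(x, t)\<close>.\<close>

definition dx :: "(real \<times> real \<Rightarrow> 'b::real_normed_vector) \<Rightarrow> real \<times> real \<Rightarrow> 'b" where
  "dx w = (\<lambda>(x, t). vector_derivative (\<lambda>y. w (y, t)) (at x))"

definition dt :: "real \<Rightarrow> (real \<times> real \<Rightarrow> 'b::real_normed_vector) \<Rightarrow> real \<times> real \<Rightarrow> 'b" where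
  "dt T w = (\<lambda>(x, t). vector_derivative (\<lambda>s. w (x, s)) (at t within {0..T}))"


subsection \<open>The relaxation system and its structural hypotheses\<close>

definition smooth_solution ::
    "real^'n^'n \<Rightarrow> (real^'n \<Rightarrow> real^'n) \<Rightarrow> (real^'n \<Rightarrow> real^'n) \<Rightarrow> real \<Rightarrow> real
      \<Rightarrow> (real \<times> real \<Rightarrow> real^'n) \<Rightarrow> bool" where
  "smooth_solution A F G T \<epsilon> w \<longleftrightarrow>
     Cinf_on (UNIV \<times> {0..T}) w \<and>
     (\<forall>p \<in> UNIV \<times> {0..T}.
        dt T w p + dx (F \<circ> w) p = G (w p) + \<epsilon> *\<^sub>R (A *v dx (dx w) p - dt T (dt T w) p))"

text \<open>Decay faster than every power of \<open>x\<close>, uniformly in \<open>t \<in> [0, T]\<close>, of the solution and its first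
  derivatives. Nothing is required of higher derivatives.\<close>

definition fast_decay :: "real \<Rightarrow> (real \<times> real \<Rightarrow> 'b::real_normed_vector) \<Rightarrow> bool" where
  "fast_decay T w \<longleftrightarrow>
     (\<forall>N::nat. \<exists>B. \<forall>x. \<forall>t\<in>{0..T}.
        (1 + \<bar>x\<bar>) ^ N * (norm (w (x, t)) + norm (dx w (x, t)) + norm (dt T w (x, t))) \<le> B)"

definition entropy_pair ::
    "(real^'n \<Rightarrow> real^'n) \<Rightarrow> (real^'n \<Rightarrow> real) \<Rightarrow> (real^'n \<Rightarrow> real) \<Rightarrow> bool" where
  "entropy_pair F \<eta> q \<longleftrightarrow>
     Ck_on 2 UNIV \<eta> \<and> q differentiable_on UNIV \<and>
     (\<forall>u. grad \<eta> u v* jacobian F (at u) = grad q u)"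

definition entropy_condition ::
    "(real^'n \<Rightarrow> real^'n) \<Rightarrow> (real^'n \<Rightarrow> real) \<Rightarrow> (real^'n \<Rightarrow> real) \<Rightarrow> real \<Rightarrow> real \<Rightarrow> bool" where
  "entropy_condition F \<eta> q \<alpha> \<beta> \<longleftrightarrow>
     entropy_pair F \<eta> q \<and> strictly_convex \<eta> \<and>
     (\<forall>u. form_le (mat \<beta>) (hessian \<eta> u) \<and> form_le (hessian \<eta> u) (mat (\<alpha> / 2))) \<and>
     (\<forall>u. \<eta> u \<ge> \<eta> 0) \<and> \<eta> 0 = 0 \<and> grad \<eta> 0 = 0"

definition subcharacteristic ::
    "real^'n^'n \<Rightarrow> (real^'n \<Rightarrow> real^'n) \<Rightarrow> (real^'n \<Rightarrow> real) \<Rightarrow> real \<Rightarrow> bool" where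
  "subcharacteristic A F \<eta> \<alpha> \<longleftrightarrow>
     (\<exists>\<nu>>0. \<forall>u.
        form_le (mat \<nu>)
          ((1 / 2) *\<^sub>R (A ** hessian \<eta> u + hessian \<eta> u ** A)
           - \<alpha> *\<^sub>R (transpose (jacobian F (at u)) ** jacobian F (at u))))"

definition weak_dissipation :: "(real^'n \<Rightarrow> real) \<Rightarrow> (real^'n \<Rightarrow> real^'n) \<Rightarrow> bool" where
  "weak_dissipation \<eta> G \<longleftrightarrow> (\<forall>u v. - ((grad \<eta> u - grad \<eta> v) \<bullet> (G u - G v)) \<ge> 0)"

definition source_potential :: "(real^'n \<Rightarrow> real^'n) \<Rightarrow> (real^'n \<Rightarrow> real) \<Rightarrow> bool" where
  "source_potential G R \<longleftrightarrow>
     R differentiable_on UNIV \<and> (\<forall>u. G u = - grad R u) \<and>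
     (\<forall>u. R u \<ge> R 0) \<and> R 0 = 0 \<and> grad R 0 = 0 \<and>
     (\<exists>C\<^sub>R. \<forall>u. norm (grad R u) \<le> C\<^sub>R * (1 + R u))"


subsection \<open>The energy\<close>

definition energy :: "real \<Rightarrow> real \<Rightarrow> (real \<times> real \<Rightarrow> real^'n) \<Rightarrow> real \<Rightarrow> real" where
  "energy T \<epsilon> w t =
     (LINT x|lborel. (norm (w (x, t)))\<^sup>2 + \<epsilon>\<^sup>2 * (norm (dx w (x, t)))\<^sup>2
                     + \<epsilon>\<^sup>2 * (norm (dt T w (x, t)))\<^sup>2)"

definition potential_energy ::
    "(real^'n \<Rightarrow> real) \<Rightarrow> (real \<times> real \<Rightarrow> real^'n) \<Rightarrow> real \<Rightarrow> real" where
  "potential_energy R w t = (LINT x|lborel. R (w (x, t)))"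

definition stability_estimate ::
    "real \<Rightarrow> (real^'n \<Rightarrow> real^'n) \<Rightarrow> (real^'n \<Rightarrow> real) \<Rightarrow> (real^'n \<Rightarrow> real) \<Rightarrow> real \<Rightarrow> real
      \<Rightarrow> (real \<times> real \<Rightarrow> real^'n) \<Rightarrow> bool" where
  "stability_estimate C\<^sub>1 G \<eta> R T \<epsilon> w \<longleftrightarrow>
     (\<forall>t\<in>{0..T}.
        energy T \<epsilon> w t + \<epsilon> * potential_energy R w t
          + (LINT s:{0..t}|lborel. (LINT x|lborel. \<bar>grad \<eta> (w (x, s)) \<bullet> G (w (x, s))\<bar>))
        \<le> C\<^sub>1 * (energy T \<epsilon> w 0 + \<epsilon> * potential_energy R w 0))"


subsection \<open>Negative Sobolev spaces\<close>

definition test_functions :: "(real \<times> real) set \<Rightarrow> (real \<times> real \<Rightarrow> real) set" where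
  "test_functions \<Omega> =
     {\<phi>. Cinf_on UNIV \<phi> \<and> compact (closure {p. \<phi> p \<noteq> 0}) \<and> closure {p. \<phi> p \<noteq> 0} \<subseteq> \<Omega>}"

definition H1_norm :: "(real \<times> real \<Rightarrow> real) \<Rightarrow> real" where
  "H1_norm \<phi> =
     sqrt (LINT p|lborel. (\<phi> p)\<^sup>2 + (frechet_derivative \<phi> (at p) (1, 0))\<^sup>2
                          + (frechet_derivative \<phi> (at p) (0, 1))\<^sup>2)"

text \<open>\<open>H\<^sup>-\<^sup>1(\<Omega>)\<close> is the dual of \<open>H\<^sup>1\<^sub>0(\<Omega>)\<close>, the \<open>H\<^sup>1\<close>-closure of the test functions on \<open>\<Omega>\<close>. A bounded
  functional on \<open>H\<^sup>1\<^sub>0(\<Omega>)\<close> is determined by its values on test functions, so elements are given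
  as distributions, and the dual norm is the supremum over test functions.\<close>

definition Hm1_norm ::
    "(real \<times> real) set \<Rightarrow> ((real \<times> real \<Rightarrow> real) \<Rightarrow> real) \<Rightarrow> real" where
  "Hm1_norm \<Omega> L = (SUP \<phi> \<in> {\<phi> \<in> test_functions \<Omega>. H1_norm \<phi> \<le> 1}. \<bar>L \<phi>\<bar>)"

definition Hm1_bounded ::
    "(real \<times> real) set \<Rightarrow> ((real \<times> real \<Rightarrow> real) \<Rightarrow> real) \<Rightarrow> bool" where
  "Hm1_bounded \<Omega> L \<longleftrightarrow> (\<exists>B. \<forall>\<phi> \<in> test_functions \<Omega>. \<bar>L \<phi>\<bar> \<le> B * H1_norm \<phi>)"

text \<open>\<open>H\<^sup>-\<^sup>1\<^sub>l\<^sub>o\<^sub>c(\<real> \<times> [0, T])\<close>: distributions on \<open>\<real> \<times> (0, T)\<close> that lie in \<open>H\<^sup>-\<^sup>1(\<Omega>)\<close> for every bounded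
  open \<open>\<Omega> \<subseteq> \<real> \<times> (0, T)\<close>. Such \<open>\<Omega>\<close> is relatively compact in \<open>\<real> \<times> [0, T]\<close> and may touch the lines
  \<open>t = 0\<close> and \<open>t = T\<close>. The topology is the one generated by the seminorms of the \<open>H\<^sup>-\<^sup>1(\<Omega>)\<close>.
  Being extensional makes functionals that agree on all test functions equal.\<close>

definition local_domains :: "real \<Rightarrow> (real \<times> real) set set" where
  "local_domains T = {\<Omega>. open \<Omega> \<and> bounded \<Omega> \<and> \<Omega> \<subseteq> UNIV \<times> {0<..<T}}"

definition Hm1_loc :: "real \<Rightarrow> ((real \<times> real \<Rightarrow> real) \<Rightarrow> real) set" where
  "Hm1_loc T =
     {L \<in> extensional (test_functions (UNIV \<times> {0<..<T})).
        (\<forall>\<phi> \<in> test_functions (UNIV \<times> {0<..<T}). \<forall>\<psi> \<in> test_functions (UNIV \<times> {0<..<T}). \<forall>a b.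
           L (\<lambda>p. a * \<phi> p + b * \<psi> p) = a * L \<phi> + b * L \<psi>) \<and>
        (\<forall>\<Omega> \<in> local_domains T. Hm1_bounded \<Omega> L)}"

definition Hm1_loc_topology :: "real \<Rightarrow> ((real \<times> real \<Rightarrow> real) \<Rightarrow> real) topology" where
  "Hm1_loc_topology T =
     topology_generated_by
       {{L' \<in> Hm1_loc T. Hm1_norm \<Omega> (\<lambda>\<phi>. L' \<phi> - L \<phi>) < r} | \<Omega> L r.
          \<Omega> \<in> local_domains T \<and> L \<in> Hm1_loc T \<and> r > 0}"

definition regular_distribution ::
    "real \<Rightarrow> (real \<times> real \<Rightarrow> real) \<Rightarrow> (real \<times> real \<Rightarrow> real) \<Rightarrow> real" where
  "regular_distribution T f =
     restrict (\<lambda>\<phi>. LINT p:(UNIV \<times> {0<..<T})|lborel. f p * \<phi> p) (test_functions (UNIV \<times> {0<..<T}))"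

text \<open>For smooth \<open>w\<close> the distributional derivatives are the classical ones.\<close>

definition entropy_production ::
    "real \<Rightarrow> (real^'n \<Rightarrow> real) \<Rightarrow> (real^'n \<Rightarrow> real) \<Rightarrow> (real \<times> real \<Rightarrow> real^'n)
      \<Rightarrow> (real \<times> real \<Rightarrow> real) \<Rightarrow> real" where
  "entropy_production T \<eta> q w = regular_distribution T (\<lambda>p. dt T (\<eta> \<circ> w) p + dx (q \<circ> w) p)"

end

theory Submission
  imports Defs
begin

text \<open>Stability: testing the system with \<open>D\<eta>(u)\<close> and with \<open>\<alpha>\<epsilon> u\<^sub>t\<close> and adding gives \<open>e\<^sub>t + Q\<^sub>x \<le> - D\<close> with
  \<open>e = \<eta> + \<epsilon> D\<eta> u\<^sub>t + \<alpha>\<epsilon>\<^sup>2 (|u\<^sub>t|\<^sup>2 + u\<^sub>x \<bullet> A u\<^sub>x) / 2 + \<alpha>\<epsilon> R\<close>. Since \<open>|D\<eta>|\<^sup>2 \<le> \<alpha>\<eta>\<close>, the density \<open>e\<close> is comparable to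
  that of the energy, and the subcharacteristic condition makes
  \<open>D = |D\<eta> G| + \<epsilon> (\<nu> |u\<^sub>x|\<^sup>2 + \<alpha> |u\<^sub>t|\<^sup>2 / 4)\<close> a lower bound for the dissipation.

  Compactness is Murat's lemma, proved directly. Let \<open>\<phi>\<close> be bounded in \<open>H\<^sup>1\<close> and small in \<open>L\<^sup>2\<close>, and split
  \<open>\<phi> = \<delta> sin(\<phi>/\<delta>) + \<rho>\<close>. The gradient of \<open>\<rho>\<close> is at most \<open>|\<phi>| |\<nabla>\<phi>| / \<delta>\<close>, hence small in \<open>L\<^sup>1\<close>, and is paired
  with the bounded functions \<open>\<eta>b(u)\<close>, \<open>qb(u)\<close>. The truncation \<open>\<delta> sin(\<phi>/\<delta>)\<close> is small in \<open>L\<^sup>\<infinity>\<close>, and is paired with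
  the production as a sum of a term bounded in \<open>L\<^sup>1\<close> and one of order \<open>\<surd>\<epsilon>\<close> in \<open>H\<^sup>-\<^sup>1\<close>. If \<open>\<epsilon>\<close> stays away
  from \<open>0\<close>, the production is bounded in \<open>L\<^sup>2\<close> because the subcharacteristic condition bounds \<open>DF\<close>. So the
  productions are uniformly small on such \<open>\<phi>\<close>, and Rellich's theorem turns this into compactness.\<close>

subsection \<open>Differential calculus\<close>

text \<open>In two space-time dimensions the H^1 norm does not control the supremum, so a production
  bounded in L^1 cannot be paired directly with \<phi>; this obstacle forces the truncation. Its
  price is a factor 1/\<delta> in front of the remainder, which is why the L^2 size of \<phi> may
  depend on \<delta>. Uniformity in \<epsilon> has two sides. For small \<epsilon> the dissipation
  controls \<epsilon> times the Dirichlet integral of u. For large \<epsilon> the energy, with its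
  weight \<epsilon>^2, controls the Dirichlet integral itself, because the energy of the data grows
  at most like 1 + \<epsilon>^2. The decay hypothesis speaks of u and its first derivatives, and
  these are exactly what the lateral flux Q contains; second derivatives occur only inside bounded
  boxes. Estimates are therefore made for continuous functions on compact boxes, where Fubini and
  the fundamental theorem of calculus apply to gauge integrals, and reach the line by monotone or
  dominated convergence.\<close>

lemma Ck_on_cong:
  assumes "\<And>x. x \<in> S \<Longrightarrow> f x = g x" and "Ck_on k S f"
  shows "Ck_on k S g"
proof (cases k)
  case 0
  then show ?thesis using assms by (metis Ck_on.simps(1) continuous_on_cong)
next
  case (Suc m)
  then obtain f' where "\<And>x. x \<in> S \<Longrightarrow> (f has_derivative f' x) (at x within S)" "\<And>v. Ck_on m S (\<lambda>x. f' x v)"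
    using assms(2) by auto
  then show ?thesis using Suc assms(1)
    by (auto intro!: exI[of _ f'] intro: has_derivative_transform[of _ S g f])
qed

lemma Ck_on_imp_continuous_on: "Ck_on k S f \<Longrightarrow> continuous_on S f"
  by (cases k) (auto intro: has_derivative_continuous_on)

lemma Ck_on_bounded_linear:
  assumes "bounded_linear L" "Ck_on k S f"
  shows "Ck_on k S (\<lambda>x. L (f x))"
  using assms(2)
proof (induction k arbitrary: f)
  case 0
  then show ?case using assms(1) by (simp add: bounded_linear.continuous_on)
next
  case (Suc k)
  then obtain f' where "\<forall>x\<in>S. (f has_derivative f' x) (at x within S)" "\<forall>v. Ck_on k S (\<lambda>x. f' x v)"
    by auto
  with Suc.IH show ?case
    by (auto intro!: exI[of _ "\<lambda>x v. L (f' x v)"] bounded_linear.has_derivative[OF assms(1)])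
qed

lemma Ck_on_add:
  assumes "Ck_on k S f" "Ck_on k S g"
  shows "Ck_on k S (\<lambda>x. f x + g x)"
  using assms
proof (induction k arbitrary: f g)
  case 0
  then show ?case by (simp add: continuous_on_add)
next
  case (Suc k)
  obtain f' where "\<forall>x\<in>S. (f has_derivative f' x) (at x within S)" "\<forall>v. Ck_on k S (\<lambda>x. f' x v)"
    using Suc.prems(1) by auto
  moreover obtain g' where "\<forall>x\<in>S. (g has_derivative g' x) (at x within S)" "\<forall>v. Ck_on k S (\<lambda>x. g' x v)"
    using Suc.prems(2) by auto
  ultimately show ?case
    using Suc.IH by (auto intro!: exI[of _ "\<lambda>x v. f' x v + g' x v"] has_derivative_add)
qed

lemma Ck_on_zero: "Ck_on k S (\<lambda>x. 0)"
  by (induction k) (auto intro!: exI[of _ "\<lambda>_ _. 0"] has_derivative_const)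

lemma Ck_on_sum:
  assumes "\<And>i. i \<in> I \<Longrightarrow> Ck_on k S (f i)"
  shows "Ck_on k S (\<lambda>x. \<Sum>i\<in>I. f i x)"
  using assms by (induction I rule: infinite_finite_induct) (auto intro: Ck_on_zero Ck_on_add)

lemma has_derivative_grad:
  assumes "f differentiable (at u)"
  shows "(f has_derivative (\<lambda>h. grad f u \<bullet> h)) (at u)"
proof -
  let ?f' = "frechet_derivative f (at u)"
  have D: "(f has_derivative ?f') (at u)" using assms by (simp add: frechet_derivative_works)
  then interpret linear ?f' by (rule has_derivative_linear)
  have "grad f u \<bullet> h = ?f' h" for h
  proof -
    have "?f' h = ?f' (\<Sum>i\<in>UNIV. h$i *\<^sub>R axis i 1)"
      using basis_expansion[of h] by (simp add: scalar_mult_eq_scaleR)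
    also have "\<dots> = (\<Sum>i\<in>UNIV. h$i * ?f' (axis i 1))" by (simp add: sum scale)
    finally show ?thesis by (simp add: grad_def inner_vec_def mult.commute)
  qed
  with D show ?thesis by presburger
qed

lemma Ck_on_differentiable:
  assumes "Ck_on (Suc k) UNIV f" shows "f differentiable (at u)"
  using assms by (auto simp: differentiable_def)

lemma Ck_on_grad:
  assumes "Ck_on (Suc k) UNIV f" shows "Ck_on k UNIV (grad f)"
proof -
  obtain f' where f': "\<And>x. (f has_derivative f' x) (at x)" and C: "\<And>v. Ck_on k UNIV (\<lambda>x. f' x v)"
    using assms by auto
  have eq: "frechet_derivative f (at x) = f' x" for x
    using frechet_derivative_at[OF f'] by simp
  have "grad f = (\<lambda>u. \<Sum>i\<in>UNIV. f' u (axis i 1) *\<^sub>R axis i 1)"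
    by (rule ext, simp add: grad_def eq vec_eq_iff axis_def if_distrib sum.delta cong: if_cong)
  moreover have "Ck_on k UNIV (\<lambda>u. \<Sum>i\<in>UNIV. f' u (axis i 1) *\<^sub>R axis i (1::real))"
    by (intro Ck_on_sum Ck_on_bounded_linear[OF bounded_linear_scaleR_left] C)
  ultimately show ?thesis by simp
qed

lemma continuous_on_jacobian:
  fixes F :: "real^'n \<Rightarrow> real^'m"
  assumes "Ck_on 1 UNIV F"
  shows "continuous_on UNIV (\<lambda>u. jacobian F (at u))"
proof -
  obtain F' where F': "\<And>x. (F has_derivative F' x) (at x)" and C: "\<And>v. continuous_on UNIV (\<lambda>x. F' x v)"
    using assms by (auto simp: numeral_1_eq_Suc_0)
  have "jacobian F (at u) $ i $ j = F' u (axis j 1) $ i" for u i j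
    using frechet_derivative_at[OF F', of u] by (simp add: jacobian_def matrix_def)
  then have "(\<lambda>u. jacobian F (at u)) = (\<lambda>u. \<chi> i j. F' u (axis j 1) $ i)"
    by (simp add: vec_eq_iff fun_eq_iff)
  moreover have "continuous_on UNIV (\<lambda>u. \<chi> i j. F' u (axis j 1) $ i)"
    by (intro continuous_on_vec_lambda continuous_on_component C)
  ultimately show ?thesis by (rule ssubst[where P = "continuous_on UNIV"])
qed

lemma jacobian_has_derivative:
  fixes F :: "real^'n \<Rightarrow> real^'m"
  assumes "Ck_on 1 UNIV F"
  shows "(F has_derivative (\<lambda>h. jacobian F (at u) *v h)) (at u)"
  using Ck_on_differentiable[of 0 F u] assms jacobian_works by auto

lemma bounded_bilinear_matrix_vector_mult:
  "bounded_bilinear ((*v) :: real^'n^'m \<Rightarrow> real^'n \<Rightarrow> real^'m)"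
proof -
  have "bilinear ((*v) :: real^'n^'m \<Rightarrow> real^'n \<Rightarrow> real^'m)"
    unfolding bilinear_def
    by (intro conjI allI linearI)
      (auto simp: matrix_vector_mult_add_rdistrib matrix_vector_right_distrib matrix_vector_mult_scaleR
        scaleR_matrix_vector_assoc)
  then show ?thesis by (simp add: bilinear_conv_bounded_bilinear)
qed

lemmas continuous_on_matrix_vector_mult' =
  bounded_bilinear.continuous_on[OF bounded_bilinear_matrix_vector_mult]

lemma norm_matrix_vector_mult_le:
  fixes H :: "real^'n^'m"
  shows "norm (H *v \<xi>) \<le> norm H * norm \<xi>"
proof -
  have "norm (H *v \<xi>) \<le> L2_set (\<lambda>i. norm (H $ i) * norm \<xi>) UNIV"
    unfolding norm_vec_def[of "H *v \<xi>"]
    by (intro L2_set_mono) (auto simp: matrix_vector_mul_component Cauchy_Schwarz_ineq2)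
  also have "\<dots> = norm H * norm \<xi>"
    by (simp add: L2_set_left_distrib norm_vec_def[of H])
  finally show ?thesis .
qed

text \<open>The second difference of \<open>f\<close> over a small rectangle is its area times
  \<open>fxt\<close> at one point and, with the two mean value steps taken in the other order, its
  area times \<open>ftx\<close> at another point; continuity then excludes a gap between the two.
  One-sided derivatives on a closed rectangle are allowed because the result is needed up to the
  edges of the strip.\<close>

lemma mixed_partials_real:
  fixes f :: "real \<times> real \<Rightarrow> real"
  assumes "a < b" "c < d" and p: "(x0, t0) \<in> {a..b} \<times> {c..d}"
    and fx: "\<And>x t. x \<in> {a..b} \<Longrightarrow> t \<in> {c..d} \<Longrightarrow>
        ((\<lambda>y. f (y, t)) has_vector_derivative fx (x, t)) (at x within {a..b})"
    and ft: "\<And>x t. x \<in> {a..b} \<Longrightarrow> t \<in> {c..d} \<Longrightarrow>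
        ((\<lambda>s. f (x, s)) has_vector_derivative ft (x, t)) (at t within {c..d})"
    and fxt: "\<And>x t. x \<in> {a..b} \<Longrightarrow> t \<in> {c..d} \<Longrightarrow>
        ((\<lambda>s. fx (x, s)) has_vector_derivative fxt (x, t)) (at t within {c..d})"
    and ftx: "\<And>x t. x \<in> {a..b} \<Longrightarrow> t \<in> {c..d} \<Longrightarrow>
        ((\<lambda>y. ft (y, t)) has_vector_derivative ftx (x, t)) (at x within {a..b})"
    and C: "continuous_on ({a..b} \<times> {c..d}) fxt" "continuous_on ({a..b} \<times> {c..d}) ftx"
  shows "fxt (x0, t0) = ftx (x0, t0)"
proof (rule ccontr)
  assume ne: "\<not> ?thesis"
  define e where "e = \<bar>fxt (x0, t0) - ftx (x0, t0)\<bar> / 2"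
  have epos: "e > 0" using ne by (simp add: e_def)
  obtain d1 where d1: "d1 > 0" "\<And>q. q \<in> {a..b} \<times> {c..d} \<Longrightarrow> dist q (x0, t0) < d1 \<Longrightarrow> dist (fxt q) (fxt (x0, t0)) < e"
    using C(1) p epos unfolding continuous_on_iff by metis
  obtain d2 where d2: "d2 > 0" "\<And>q. q \<in> {a..b} \<times> {c..d} \<Longrightarrow> dist q (x0, t0) < d2 \<Longrightarrow> dist (ftx q) (ftx (x0, t0)) < e"
    using C(2) p epos unfolding continuous_on_iff by metis
  define h where "h = min d1 d2 / 4"
  have h: "h > 0" "4 * h \<le> d1" "4 * h \<le> d2" using d1 d2 by (auto simp: h_def)
  \<comment> \<open>Clipping the square around the point to the given rectangle keeps it
    nondegenerate even when the point lies on an edge or at a corner.\<close>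
  define a' b' c' d' where defs: "a' = max a (x0 - h)" "b' = min b (x0 + h)"
    "c' = max c (t0 - h)" "d' = min d (t0 + h)"
  have o: "a' < b'" "c' < d'" "{a'..b'} \<subseteq> {a..b}" "{c'..d'} \<subseteq> {c..d}"
    using p assms(1,2) h by (auto simp: defs)
  have near: "dist (x, t) (x0, t0) < 4 * h" if "x \<in> {a'..b'}" "t \<in> {c'..d'}" for x t
  proof -
    have "dist x x0 \<le> h" "dist t t0 \<le> h" using that by (auto simp: defs dist_real_def)
    then have "dist (x, t) (x0, t0) \<le> h + h"
      unfolding dist_Pair_Pair using sqrt_sum_squares_le_sum[of "dist x x0" "dist t t0"] by simp
    with h show ?thesis by simp
  qed
  define \<Delta> where "\<Delta> = f (b', d') - f (b', c') - f (a', d') + f (a', c')"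
  have "\<exists>x\<in>{a'<..<b'}. (f (b', d') - f (b', c')) - (f (a', d') - f (a', c')) = (b' - a') *\<^sub>R (fx (x, d') - fx (x, c'))"
    using o by (intro mvt_simple[of a' b' "\<lambda>x. f (x, d') - f (x, c')" "\<lambda>x h. h *\<^sub>R (fx (x, d') - fx (x, c'))"])
      (auto intro!: has_vector_derivative_diff
        simp: has_vector_derivative_def[symmetric] simp del: real_scaleR_def intro: has_vector_derivative_within_subset[OF fx])
  then obtain x1 where x1: "x1 \<in> {a'<..<b'}" "\<Delta> = (b' - a') * (fx (x1, d') - fx (x1, c'))"
    by (auto simp: \<Delta>_def algebra_simps)
  have "\<exists>t\<in>{c'<..<d'}. fx (x1, d') - fx (x1, c') = (d' - c') *\<^sub>R fxt (x1, t)"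
    using o x1(1) by (intro mvt_simple[of c' d' "\<lambda>t. fx (x1, t)" "\<lambda>t h. h *\<^sub>R fxt (x1, t)"])
      (auto simp: has_vector_derivative_def[symmetric] subset_iff simp del: real_scaleR_def intro!: has_vector_derivative_within_subset[OF fxt, of _ _ "{c'..d'}"])
  then obtain t1 where t1: "t1 \<in> {c'<..<d'}" "\<Delta> = (b' - a') * ((d' - c') * fxt (x1, t1))"
    using x1 by auto
  have "\<exists>t\<in>{c'<..<d'}. (f (b', d') - f (a', d')) - (f (b', c') - f (a', c')) = (d' - c') *\<^sub>R (ft (b', t) - ft (a', t))"
    using o by (intro mvt_simple[of c' d' "\<lambda>t. f (b', t) - f (a', t)" "\<lambda>t h. h *\<^sub>R (ft (b', t) - ft (a', t))"])
      (auto intro!: has_vector_derivative_diff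
        simp: has_vector_derivative_def[symmetric] simp del: real_scaleR_def intro: has_vector_derivative_within_subset[OF ft])
  then obtain t2 where t2: "t2 \<in> {c'<..<d'}" "\<Delta> = (d' - c') * (ft (b', t2) - ft (a', t2))"
    by (auto simp: \<Delta>_def algebra_simps)
  have "\<exists>x\<in>{a'<..<b'}. ft (b', t2) - ft (a', t2) = (b' - a') *\<^sub>R ftx (x, t2)"
    using o t2(1) by (intro mvt_simple[of a' b' "\<lambda>x. ft (x, t2)" "\<lambda>x h. h *\<^sub>R ftx (x, t2)"])
      (auto simp: has_vector_derivative_def[symmetric] subset_iff simp del: real_scaleR_def intro!: has_vector_derivative_within_subset[OF ftx, of _ _ "{a'..b'}"])
  then obtain x2 where x2: "x2 \<in> {a'<..<b'}" "\<Delta> = (d' - c') * ((b' - a') * ftx (x2, t2))"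
    using t2 by auto
  have "fxt (x1, t1) = ftx (x2, t2)" using t1(2) x2(2) o(1,2) by simp
  moreover have "dist (fxt (x1, t1)) (fxt (x0, t0)) < e"
    using x1 t1 o h near[of x1 t1] by (intro d1(2)) (auto simp: subset_iff)
  moreover have "dist (ftx (x2, t2)) (ftx (x0, t0)) < e"
    using x2 t2 o h near[of x2 t2] by (intro d2(2)) (auto simp: subset_iff)
  ultimately show False unfolding e_def dist_real_def by argo
qed

lemma mixed_partials:
  fixes f :: "real \<times> real \<Rightarrow> 'a::euclidean_space"
  assumes "a < b" "c < d" and p: "(x0, t0) \<in> {a..b} \<times> {c..d}"
    and fx: "\<And>x t. x \<in> {a..b} \<Longrightarrow> t \<in> {c..d} \<Longrightarrow>
        ((\<lambda>y. f (y, t)) has_vector_derivative fx (x, t)) (at x within {a..b})"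
    and ft: "\<And>x t. x \<in> {a..b} \<Longrightarrow> t \<in> {c..d} \<Longrightarrow>
        ((\<lambda>s. f (x, s)) has_vector_derivative ft (x, t)) (at t within {c..d})"
    and fxt: "\<And>x t. x \<in> {a..b} \<Longrightarrow> t \<in> {c..d} \<Longrightarrow>
        ((\<lambda>s. fx (x, s)) has_vector_derivative fxt (x, t)) (at t within {c..d})"
    and ftx: "\<And>x t. x \<in> {a..b} \<Longrightarrow> t \<in> {c..d} \<Longrightarrow>
        ((\<lambda>y. ft (y, t)) has_vector_derivative ftx (x, t)) (at x within {a..b})"
    and C: "continuous_on ({a..b} \<times> {c..d}) fxt" "continuous_on ({a..b} \<times> {c..d}) ftx"
  shows "fxt (x0, t0) = ftx (x0, t0)"
proof (rule euclidean_eqI)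
  fix i :: 'a
  note BL = bounded_linear.has_vector_derivative[OF bounded_linear_inner_left]
  show "fxt (x0, t0) \<bullet> i = ftx (x0, t0) \<bullet> i"
    by (rule mixed_partials_real[where f = "\<lambda>p. f p \<bullet> i" and fx = "\<lambda>p. fx p \<bullet> i" and ft = "\<lambda>p. ft p \<bullet> i" and fxt = "\<lambda>p. fxt p \<bullet> i" and ftx = "\<lambda>p. ftx p \<bullet> i", OF assms(1-3)])
     (auto intro!: BL fx ft fxt ftx continuous_intros C)
qed

lemma hessian_has_derivative:
  fixes f :: "real^'n \<Rightarrow> real"
  assumes "Ck_on 2 UNIV f"
  shows "(grad f has_derivative (\<lambda>h. hessian f u *v h)) (at u)"
  using jacobian_has_derivative[of "grad f"] Ck_on_grad[of 1 f] assms
  by (simp add: hessian_def numeral_2_eq_2)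

lemma continuous_on_hessian:
  fixes f :: "real^'n \<Rightarrow> real"
  assumes "Ck_on 2 UNIV f"
  shows "continuous_on UNIV (hessian f)"
  using continuous_on_jacobian[of "grad f"] Ck_on_grad[of 1 f] assms
  by (simp add: hessian_def[abs_def] numeral_2_eq_2)

text \<open>The Hessian is encoded as the Jacobian of the gradient, so its symmetry has to be
  proved. Pulling \<open>f\<close> back along the affine map that sends (x, t) to u + x \<zeta> + t
  \<xi> reduces it to equality of mixed partials in two real variables.\<close>

lemma hessian_symmetric:
  fixes f :: "real^'n \<Rightarrow> real"
  assumes "Ck_on 2 UNIV f"
  shows "(hessian f u *v \<xi>) \<bullet> \<zeta> = (hessian f u *v \<zeta>) \<bullet> \<xi>"
proof -
  define l where "l = (\<lambda>p. u + fst p *\<^sub>R \<zeta> + snd p *\<^sub>R \<xi>)"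
  have lx: "((\<lambda>y. l (y, t)) has_vector_derivative \<zeta>) (at x within A)"
    and lt: "((\<lambda>s. l (x, s)) has_vector_derivative \<xi>) (at t within A)" for x t A
    unfolding l_def by (auto intro!: derivative_eq_intros)
  have D: "f differentiable at v" for v using assms Ck_on_differentiable by (metis numeral_2_eq_2)
  have g: "((\<lambda>y. f (k y)) has_vector_derivative grad f (k x) \<bullet> k') (at x within A)"
    if "(k has_vector_derivative k') (at x within A)" for k k' x A
    using vector_derivative_diff_chain_within[OF that has_derivative_at_withinI[OF has_derivative_grad[OF D]]]
    by (simp add: o_def)
  have h: "((\<lambda>y. grad f (k y) \<bullet> z) has_vector_derivative (hessian f (k x) *v k') \<bullet> z) (at x within A)"
    if "(k has_vector_derivative k') (at x within A)" for k k' x A z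
    using bounded_linear.has_vector_derivative[OF bounded_linear_inner_left,
        OF vector_derivative_diff_chain_within[OF that has_derivative_at_withinI[OF hessian_has_derivative[OF assms]]]]
    by (simp add: o_def)
  have cl: "continuous_on A l" for A unfolding l_def by (intro continuous_intros)
  have cH: "continuous_on A (\<lambda>p. (hessian f (l p) *v z) \<bullet> z')" for A z z'
    by (intro continuous_intros continuous_on_matrix_vector_mult'
          continuous_on_compose2[OF continuous_on_hessian[OF assms] cl]) auto
  have "(hessian f (l (0, 0)) *v \<xi>) \<bullet> \<zeta> = (hessian f (l (0, 0)) *v \<zeta>) \<bullet> \<xi>"
    by (rule mixed_partials[where a = 0 and b = 1 and c = 0 and d = 1 and f = "\<lambda>p. f (l p)"
          and fx = "\<lambda>p. grad f (l p) \<bullet> \<zeta>" and ft = "\<lambda>p. grad f (l p) \<bullet> \<xi>"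
          and fxt = "\<lambda>p. (hessian f (l p) *v \<xi>) \<bullet> \<zeta>" and ftx = "\<lambda>p. (hessian f (l p) *v \<zeta>) \<bullet> \<xi>"])
      (auto intro!: g h lx lt cH)
  then show ?thesis by (simp add: l_def)
qed

text \<open>Horizontal and vertical lines through a point of the strip stay in the strip, so the
  partial derivatives are the derivative within the strip applied to \<open>(1, 0)\<close> and
  \<open>(0, 1)\<close>. They have one order of smoothness less, and the statement can be iterated
  to reach second derivatives.\<close>

lemma Ck_on_strip_partials:
  fixes w :: "real \<times> real \<Rightarrow> 'a::real_normed_vector"
  assumes "Ck_on (Suc k) (UNIV \<times> {0..T}) w" "T > 0"
  shows "t \<in> {0..T} \<Longrightarrow> ((\<lambda>y. w (y, t)) has_vector_derivative dx w (x, t)) (at x)"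
    and "t \<in> {0..T} \<Longrightarrow> ((\<lambda>s. w (x, s)) has_vector_derivative dt T w (x, t)) (at t within {0..T})"
    and "Ck_on k (UNIV \<times> {0..T}) (dx w)"
    and "Ck_on k (UNIV \<times> {0..T}) (dt T w)"
proof -
  let ?S = "UNIV \<times> {0..T} :: (real \<times> real) set"
  obtain w' where w': "\<And>p. p \<in> ?S \<Longrightarrow> (w has_derivative w' p) (at p within ?S)"
    and C: "\<And>v. Ck_on k ?S (\<lambda>p. w' p v)"
    using assms(1) by auto
  have 1: "((\<lambda>y. w (y, t)) has_vector_derivative w' (x, t) (1, 0)) (at x)" if "t \<in> {0..T}" for x t
  proof -
    have "((\<lambda>y. (y, t)) has_vector_derivative (1, 0)) (at x)"
      unfolding has_vector_derivative_def by (auto intro!: derivative_eq_intros simp: zero_prod_def)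
    moreover have "(w has_derivative w' (x, t)) (at (x, t) within range (\<lambda>y. (y, t)))"
      by (rule has_derivative_subset[OF w']) (use that in auto)
    ultimately show ?thesis using vector_derivative_diff_chain_within[of "\<lambda>y. (y, t)"] by (fastforce simp: o_def)
  qed
  have 2: "((\<lambda>s. w (x, s)) has_vector_derivative w' (x, t) (0, 1)) (at t within {0..T})" if "t \<in> {0..T}" for x t
  proof -
    have "((\<lambda>y. (x, y)) has_vector_derivative (0, 1)) (at t within {0..T})"
      unfolding has_vector_derivative_def by (auto intro!: derivative_eq_intros simp: zero_prod_def)
    moreover have "(w has_derivative w' (x, t)) (at (x, t) within Pair x ` {0..T})"
      by (rule has_derivative_subset[OF w']) (use that in auto)
    ultimately show ?thesis using vector_derivative_diff_chain_within[of "Pair x"] by (fastforce simp: o_def)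
  qed
  have e1: "dx w (x, t) = w' (x, t) (1, 0)" if "t \<in> {0..T}" for x t
    using 1[OF that] by (simp add: dx_def vector_derivative_at)
  have e2: "dt T w (x, t) = w' (x, t) (0, 1)" if "t \<in> {0..T}" for x t
    unfolding dt_def using vector_derivative_within_cbox[of 0 T t, OF _ _ 2[of t x, unfolded cbox_interval[symmetric]]] that assms(2) by simp
  show "t \<in> {0..T} \<Longrightarrow> ((\<lambda>y. w (y, t)) has_vector_derivative dx w (x, t)) (at x)"
    using 1 e1 by simp
  show "t \<in> {0..T} \<Longrightarrow> ((\<lambda>s. w (x, s)) has_vector_derivative dt T w (x, t)) (at t within {0..T})"
    using 2 e2 by simp
  \<comment> \<open>The identification of \<open>dx w\<close> with a value of \<open>w'\<close>
    holds on the strip only, so smoothness is transferred through agreement there.\<close>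
  show "Ck_on k ?S (dx w)" by (rule Ck_on_cong[OF _ C[of "(1, 0)"]]) (use e1 in auto)
  show "Ck_on k ?S (dt T w)" by (rule Ck_on_cong[OF _ C[of "(0, 1)"]]) (use e2 in auto)
qed

text \<open>Fubini, followed by the fundamental theorem of calculus in one variable at a time; each
  component is differentiated only in its own direction.\<close>

lemma divergence_box:
  fixes P Q :: "real \<times> real \<Rightarrow> real"
  assumes "a \<le> b" "c \<le> d"
    and P: "\<And>x t. x \<in> {a..b} \<Longrightarrow> t \<in> {c..d} \<Longrightarrow>
        ((\<lambda>s. P (x, s)) has_vector_derivative Pt (x, t)) (at t within {c..d})"
    and Q: "\<And>x t. x \<in> {a..b} \<Longrightarrow> t \<in> {c..d} \<Longrightarrow>
        ((\<lambda>y. Q (y, t)) has_vector_derivative Qx (x, t)) (at x within {a..b})"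
    and C: "continuous_on (cbox (a, c) (b, d)) Pt" "continuous_on (cbox (a, c) (b, d)) Qx"
  shows "integral (cbox (a, c) (b, d)) (\<lambda>p. Pt p + Qx p) =
    integral {a..b} (\<lambda>x. P (x, d) - P (x, c)) + integral {c..d} (\<lambda>s. Q (b, s) - Q (a, s))"
proof -
  have "integral (cbox (a, c) (b, d)) (\<lambda>p. Pt p + Qx p) =
      integral (cbox (a, c) (b, d)) Pt + integral (cbox (a, c) (b, d)) Qx"
    by (intro integral_add integrable_continuous C)
  also have "integral (cbox (a, c) (b, d)) Pt = integral {a..b} (\<lambda>x. integral {c..d} (\<lambda>s. Pt (x, s)))"
    using integral_prod_continuous[OF C(1)] by simp
  also have "\<dots> = integral {a..b} (\<lambda>x. P (x, d) - P (x, c))"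
    by (rule integral_cong, rule integral_unique, rule fundamental_theorem_of_calculus) (use assms(2) P in auto)
  also have "integral (cbox (a, c) (b, d)) Qx = integral {c..d} (\<lambda>s. integral {a..b} (\<lambda>x. Qx (x, s)))"
    using integral_prod_continuous[OF C(2)] integral_swap_continuous[of a c b d "\<lambda>x s. Qx (x, s)"] C(2) by simp
  also have "\<dots> = integral {c..d} (\<lambda>s. Q (b, s) - Q (a, s))"
    by (rule integral_cong, rule integral_unique, rule fundamental_theorem_of_calculus) (use assms(1) Q in auto)
  finally show ?thesis .
qed

subsection \<open>Integrals over the real line\<close>

text \<open>Monotone convergence along the intervals from -n to n. This is the passage from gauge
  integrals on compact intervals, in which the estimates are made, to the Lebesgue integrals over
  the line that define the energy.\<close>

lemma nonneg_continuous_integral_limit: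
  fixes f :: "real \<Rightarrow> real"
  assumes C: "continuous_on UNIV f" and nn: "\<And>x. f x \<ge> 0"
    and bd: "\<And>n::nat. integral {-real n..real n} f \<le> K"
  shows "integrable lborel f"
    and "(\<lambda>n. integral {-real n..real n} f) \<longlonglongrightarrow> (LINT x|lborel. f x)"
    and "(LINT x|lborel. f x) \<le> K"
    and "integral {-real n..real n} f \<le> (LINT x|lborel. f x)"
proof -
  define g where "g = (\<lambda>n x. indicator {-real n..real n} x *\<^sub>R f x)"
  have Cn: "continuous_on {-real n..real n} f" for n using C continuous_on_subset by blast
  have ig: "integrable lborel (g n)" for n
    unfolding g_def using borel_integrable_compact[of "{-real n..real n}" f] Cn
    by (simp add: indicator_scaleR_eq_if)
  have eq: "(LINT x|lborel. g n x) = integral {-real n..real n} f" for n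
    using set_borel_integral_eq_integral(2)[of "{-real n..real n}" f] ig[of n]
    by (simp add: set_integrable_def set_lebesgue_integral_def g_def)
  have mono: "mono (\<lambda>n. g n x)" for x
    by (intro monoI) (auto simp: g_def indicator_def nn)
  have ev: "eventually (\<lambda>n. g n x = f x) sequentially" for x
  proof -
    obtain N :: nat where "\<bar>x\<bar> \<le> real N" using real_arch_simple by blast
    then have "g n x = f x" if "n \<ge> N" for n using that by (auto simp: g_def indicator_def)
    then show ?thesis by (auto simp: eventually_sequentially)
  qed
  then have lim: "(\<lambda>n. g n x) \<longlonglongrightarrow> f x" for x by (rule tendsto_eventually)
  have inc: "incseq (\<lambda>n. integral {-real n..real n} f)"
    unfolding eq[symmetric] using mono ig by (intro incseq_SucI integral_mono) (auto simp: mono_def)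
  obtain l where l: "(\<lambda>n. integral {-real n..real n} f) \<longlonglongrightarrow> l"
    using incseq_convergent[OF inc, of K] bd by blast
  have m: "f \<in> borel_measurable lborel" using C borel_measurable_continuous_onI by simp
  show int: "integrable lborel f"
    by (rule integrable_monotone_convergence[of lborel g f l]) (use ig mono lim l m eq in auto)
  show L: "(\<lambda>n. integral {-real n..real n} f) \<longlonglongrightarrow> (LINT x|lborel. f x)"
  proof -
    have "(LINT x|lborel. f x) = l"
      by (rule integral_monotone_convergence[of lborel g f l]) (use ig mono lim l m eq in auto)
    then show ?thesis using l by simp
  qed
  show "(LINT x|lborel. f x) \<le> K" by (rule LIMSEQ_le_const2[OF L]) (use bd in auto)
  show "integral {-real n..real n} f \<le> (LINT x|lborel. f x)" using incseq_le[OF inc L] .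
qed

text \<open>The weight \<open>1 / (1 + x\<^sup>2)\<close> has the primitive arctan, hence mass at
  most pi on each of these intervals; the absolute value covers a constant \<open>C\<close> of
  unknown sign.\<close>

lemma integral_cauchy_weight_le: "integral {-real n..real n} (\<lambda>x. C / (1 + x\<^sup>2)) \<le> \<bar>C\<bar> * pi"
proof -
  have "((\<lambda>x. C / (1 + x\<^sup>2)) has_integral (C * arctan (real n) - C * arctan (- real n))) {-real n..real n}"
    by (rule fundamental_theorem_of_calculus)
      (auto simp: has_real_derivative_iff_has_vector_derivative[symmetric] divide_inverse intro!: derivative_eq_intros)
  then have "integral {-real n..real n} (\<lambda>x. C / (1 + x\<^sup>2)) = C * (2 * arctan (real n))"
    by (simp add: integral_unique arctan_minus)
  also have "\<dots> \<le> \<bar>C\<bar> * (2 * arctan (real n))" by (intro mult_right_mono) auto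
  also have "\<dots> \<le> \<bar>C\<bar> * pi" using arctan_ubound[of "real n"] by (intro mult_left_mono) auto
  finally show ?thesis .
qed

lemma integral_le_cauchy_weight:
  fixes f :: "real \<Rightarrow> real"
  assumes "continuous_on UNIV f" "\<And>x. f x \<le> C / (1 + x\<^sup>2)"
  shows "integral {-real n..real n} f \<le> \<bar>C\<bar> * pi"
proof -
  have "integral {-real n..real n} f \<le> integral {-real n..real n} (\<lambda>x. C / (1 + x\<^sup>2))"
    using assms(2) by (intro integral_le integrable_continuous_real continuous_intros
        continuous_on_subset[OF assms(1)]) (auto simp: add_nonneg_eq_0_iff)
  also note integral_cauchy_weight_le
  finally show ?thesis .
qed

subsection \<open>Convex entropies\<close>

lemma mat_matrix_vector_mult: "mat c *v x = c *\<^sub>R x" for x :: "real^'n"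
  by (simp add: vec_eq_iff matrix_vector_mult_def mat_def if_distrib if_distribR sum.delta cong: if_cong)

lemma form_le_mat_left: "form_le (mat \<beta>) H \<longleftrightarrow> (\<forall>\<xi>. \<beta> * (norm \<xi>)\<^sup>2 \<le> \<xi> \<bullet> (H *v \<xi>))"
  by (simp add: form_le_def mat_matrix_vector_mult power2_norm_eq_inner)

lemma form_le_mat_right: "form_le H (mat \<beta>) \<longleftrightarrow> (\<forall>\<xi>. \<xi> \<bullet> (H *v \<xi>) \<le> \<beta> * (norm \<xi>)\<^sup>2)"
  by (simp add: form_le_def mat_matrix_vector_mult power2_norm_eq_inner)

text \<open>Along the segment from \<open>u\<close> to \<open>u + v\<close>, the function minus its
  linear part minus the quadratic is convex with slope zero at the start, hence nondecreasing. The
  sign of \<open>b\<close> is free: the upper bound arises by applying this to -f with the negated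
  constant.\<close>

lemma taylor_second_order_bounds:
  fixes f :: "real^'n \<Rightarrow> real"
  assumes C2: "Ck_on 2 UNIV f" and lo: "\<And>u \<xi>. b * (norm \<xi>)\<^sup>2 \<le> \<xi> \<bullet> (hessian f u *v \<xi>)"
  shows "b / 2 * (norm v)\<^sup>2 \<le> f (u + v) - f u - grad f u \<bullet> v"
proof -
  define h where "h = (\<lambda>s. f (u + s *\<^sub>R v) - s * (grad f u \<bullet> v) - b / 2 * s\<^sup>2 * (norm v)\<^sup>2)"
  define h' where "h' = (\<lambda>s. grad f (u + s *\<^sub>R v) \<bullet> v - grad f u \<bullet> v - b * s * (norm v)\<^sup>2)"
  define h'' where "h'' = (\<lambda>s. (hessian f (u + s *\<^sub>R v) *v v) \<bullet> v - b * (norm v)\<^sup>2)"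
  have l: "((\<lambda>s. u + s *\<^sub>R v) has_vector_derivative v) (at s)" for s
    by (auto intro!: derivative_eq_intros)
  have D: "f differentiable (at y)" for y using Ck_on_differentiable[of 1 f] C2 by (simp only: Suc_1)
  have f1: "((\<lambda>s. f (u + s *\<^sub>R v)) has_real_derivative grad f (u + s *\<^sub>R v) \<bullet> v) (at s)" for s
    using vector_derivative_diff_chain_within[OF l[of s] has_derivative_at_withinI[OF has_derivative_grad[OF D]]]
    by (simp add: o_def has_real_derivative_iff_has_vector_derivative)
  have f2: "((\<lambda>s. grad f (u + s *\<^sub>R v) \<bullet> v) has_real_derivative (hessian f (u + s *\<^sub>R v) *v v) \<bullet> v) (at s)" for s
    using bounded_linear.has_vector_derivative[OF bounded_linear_inner_left,
        OF vector_derivative_diff_chain_within[OF l[of s] has_derivative_at_withinI[OF hessian_has_derivative[OF C2]]], of v]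
    by (simp add: o_def has_real_derivative_iff_has_vector_derivative)
  have d1: "(h has_real_derivative h' s) (at s)" for s
    unfolding h_def h'_def by (auto intro!: derivative_eq_intros f1)
  have d2: "(h' has_real_derivative h'' s) (at s)" for s
    unfolding h''_def h'_def by (auto intro!: derivative_eq_intros f2)
  have "h'' s \<ge> 0" for s using lo[of v "u + s *\<^sub>R v"] by (simp add: h''_def inner_commute)
  then have "\<exists>y. DERIV h' x :> y \<and> 0 \<le> y" for x using d2[of x] by blast
  then have "h' 0 \<le> h' s" if "s \<ge> 0" for s by (rule DERIV_nonneg_imp_nondecreasing[OF that])
  then have h'_nonneg: "h' s \<ge> 0" if "s \<ge> 0" for s using that by (simp add: h'_def)
  have "\<exists>y. DERIV h x :> y \<and> 0 \<le> y" if "0 \<le> x" for x using d1[of x] h'_nonneg[OF that] by blast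
  then have "h 0 \<le> h 1" by (intro DERIV_nonneg_imp_nondecreasing[of 0 1 h]) auto
  then show ?thesis by (simp add: h_def)
qed

lemma grad_uminus:
  assumes "f differentiable (at u)"
  shows "grad (\<lambda>u. - f u) u = - grad f u"
proof -
  have "((\<lambda>u. - f u) has_derivative (\<lambda>h. - (grad f u \<bullet> h))) (at u)"
    by (rule has_derivative_minus[OF has_derivative_grad[OF assms]])
  from frechet_derivative_at[OF this, symmetric] show ?thesis
    by (simp add: grad_def vec_eq_iff inner_axis)
qed

lemma taylor_second_order_upper:
  fixes f :: "real^'n \<Rightarrow> real"
  assumes C2: "Ck_on 2 UNIV f" and up: "\<And>u \<xi>. \<xi> \<bullet> (hessian f u *v \<xi>) \<le> b * (norm \<xi>)\<^sup>2"
  shows "f (u + v) - f u - grad f u \<bullet> v \<le> b / 2 * (norm v)\<^sup>2"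
proof -
  let ?g = "\<lambda>u. - f u"
  have g2: "Ck_on 2 UNIV ?g" using Ck_on_bounded_linear[OF bounded_linear_minus[OF bounded_linear_ident] C2] by simp
  have D: "f differentiable (at y)" for y using Ck_on_differentiable[of 1 f] C2 by (simp only: Suc_1)
  have gg: "grad ?g = (\<lambda>u. - grad f u)" using grad_uminus[OF D] by auto
  have "hessian ?g u *v \<xi> = - (hessian f u *v \<xi>)" for u \<xi>
    using has_derivative_unique[OF hessian_has_derivative[OF g2, of u, unfolded gg]
        has_derivative_minus[OF hessian_has_derivative[OF C2, of u]]]
    by (simp add: fun_eq_iff)
  then have "- b / 2 * (norm v)\<^sup>2 \<le> ?g (u + v) - ?g u - grad ?g u \<bullet> v"
    using up by (intro taylor_second_order_bounds[OF g2]) auto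
  then show ?thesis by (simp add: gg)
qed

text \<open>Taylor expansion at 0, where \<eta> and its gradient vanish, gives the two-sided bound.
  For the gradient: a nonnegative function whose second derivative is at most \<alpha>/2 cannot be
  steep where its value is low.\<close>

lemma entropy_bounds:
  fixes \<eta> :: "real^'n \<Rightarrow> real"
  assumes ec: "entropy_condition F \<eta> q \<alpha> \<beta>" and "\<alpha> > 0"
  shows "\<beta> / 2 * (norm u)\<^sup>2 \<le> \<eta> u" and "\<eta> u \<le> \<alpha> / 4 * (norm u)\<^sup>2"
    and "(norm (grad \<eta> u))\<^sup>2 \<le> \<alpha> * \<eta> u"
proof -
  have C2: "Ck_on 2 UNIV \<eta>" using ec by (simp add: entropy_condition_def entropy_pair_def)
  have z: "\<eta> 0 = 0" "grad \<eta> 0 = 0" "\<And>u. \<eta> u \<ge> 0" using ec by (auto simp: entropy_condition_def)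
  have lo: "\<beta> * (norm \<xi>)\<^sup>2 \<le> \<xi> \<bullet> (hessian \<eta> u *v \<xi>)" and up: "\<xi> \<bullet> (hessian \<eta> u *v \<xi>) \<le> \<alpha> / 2 * (norm \<xi>)\<^sup>2" for u \<xi>
    using ec by (auto simp: entropy_condition_def form_le_mat_left form_le_mat_right)
  show "\<beta> / 2 * (norm u)\<^sup>2 \<le> \<eta> u" using taylor_second_order_bounds[OF C2 lo, of u 0] z by simp
  show "\<eta> u \<le> \<alpha> / 4 * (norm u)\<^sup>2" using taylor_second_order_upper[OF C2 up, of 0 u] z by simp
  \<comment> \<open>The minimizer of the quadratic majorant
    \<open>grad \<eta> u \<bullet> v + \<alpha> / 4 * (norm v)\<^sup>2\<close>; the minimum is minus
    the squared gradient divided by \<alpha>.\<close>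
  define v where "v = - (2 / \<alpha>) *\<^sub>R grad \<eta> u"
  have "0 \<le> \<eta> (u + v)" by (rule z)
  also have "\<dots> \<le> \<eta> u + grad \<eta> u \<bullet> v + \<alpha> / 4 * (norm v)\<^sup>2" using taylor_second_order_upper[OF C2 up, of u v] by simp
  also have "grad \<eta> u \<bullet> v = - (2 / \<alpha>) * (norm (grad \<eta> u))\<^sup>2" by (simp add: v_def power2_norm_eq_inner)
  also have "(norm v)\<^sup>2 = (2 / \<alpha>)\<^sup>2 * (norm (grad \<eta> u))\<^sup>2" by (simp add: v_def power_mult_distrib power_divide)
  finally have "0 \<le> \<eta> u - (norm (grad \<eta> u))\<^sup>2 / \<alpha>"
    using assms(2) by (simp add: field_simps power2_eq_square)
  then show "(norm (grad \<eta> u))\<^sup>2 \<le> \<alpha> * \<eta> u" using assms(2) by (simp add: field_simps)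
qed

text \<open>The quadratic form attains a positive minimum on the unit sphere, and homogeneity
  extends the bound to all vectors. Since \<mu> comes from \<open>A\<close> alone, the stability
  constant can be built from \<open>A\<close>, \<alpha> and \<beta>.\<close>

lemma pos_def_lower_bound:
  fixes A :: "real^'n^'n"
  assumes "sym_pos_def A"
  obtains \<mu> where "\<mu> > 0" "\<And>\<xi>. \<mu> * (norm \<xi>)\<^sup>2 \<le> \<xi> \<bullet> (A *v \<xi>)"
proof -
  let ?S = "sphere 0 1 :: (real^'n) set"
  have "continuous_on ?S (\<lambda>\<xi>. \<xi> \<bullet> (A *v \<xi>))"
    by (intro continuous_intros continuous_on_matrix_vector_mult')
  moreover have "?S \<noteq> {}" by simp
  ultimately obtain z where z: "z \<in> ?S" "\<And>y. y \<in> ?S \<Longrightarrow> z \<bullet> (A *v z) \<le> y \<bullet> (A *v y)"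
    using continuous_attains_inf[OF compact_sphere] by blast
  show ?thesis
  proof
    show "z \<bullet> (A *v z) > 0"
    proof -
      have "z \<noteq> 0" using z(1) by auto
      then show ?thesis using assms by (simp add: sym_pos_def_def)
    qed
    fix \<xi> :: "real^'n"
    show "z \<bullet> (A *v z) * (norm \<xi>)\<^sup>2 \<le> \<xi> \<bullet> (A *v \<xi>)"
    proof (cases "\<xi> = 0")
      case False
      define e where "e = (1 / norm \<xi>) *\<^sub>R \<xi>"
      have "e \<in> ?S" and xi: "\<xi> = norm \<xi> *\<^sub>R e" using False by (auto simp: e_def)
      have "\<xi> \<bullet> (A *v \<xi>) = (norm \<xi>)\<^sup>2 * (e \<bullet> (A *v e))"
        by (subst (1 2) xi) (simp add: matrix_vector_mult_scaleR power2_eq_square)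
      then show ?thesis using z(2)[OF \<open>e \<in> ?S\<close>] by (simp add: mult.commute mult_right_mono)
    qed simp
  qed
qed

lemma symmetric_matrix_inner:
  fixes A :: "real^'n^'n"
  assumes "transpose A = A"
  shows "x \<bullet> (A *v y) = (A *v x) \<bullet> y"
  by (simp add: dot_lmul_matrix[symmetric] transpose_matrix_vector[symmetric] assms)

text \<open>\<open>A\<close> and the Hessian are both symmetric, so the symmetrized product has the
  quadratic form on the right. This is the term that the viscosity produces when the system is
  tested with the gradient of \<eta>.\<close>

lemma subcharacteristic_lower_bound:
  fixes A :: "real^'n^'n"
  assumes "transpose A = A" and C2: "Ck_on 2 UNIV \<eta>" and "subcharacteristic A F \<eta> \<alpha>"
  obtains \<nu> where "\<nu> > 0" "\<And>u \<xi>. \<nu> * (norm \<xi>)\<^sup>2 + \<alpha> * (norm (jacobian F (at u) *v \<xi>))\<^sup>2 \<le> (hessian \<eta> u *v \<xi>) \<bullet> (A *v \<xi>)"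
proof -
  obtain \<nu> where \<nu>: "\<nu> > 0" and f: "\<And>u. form_le (mat \<nu>)
          ((1 / 2) *\<^sub>R (A ** hessian \<eta> u + hessian \<eta> u ** A)
           - \<alpha> *\<^sub>R (transpose (jacobian F (at u)) ** jacobian F (at u)))"
    using assms(3) unfolding subcharacteristic_def by blast
  have "\<nu> * (norm \<xi>)\<^sup>2 + \<alpha> * (norm (jacobian F (at u) *v \<xi>))\<^sup>2 \<le> (hessian \<eta> u *v \<xi>) \<bullet> (A *v \<xi>)" for u \<xi>
  proof -
    let ?H = "hessian \<eta> u" and ?J = "jacobian F (at u)"
    have 1: "\<xi> \<bullet> ((A ** ?H) *v \<xi>) = (?H *v \<xi>) \<bullet> (A *v \<xi>)"
      using symmetric_matrix_inner[OF assms(1), of \<xi> "?H *v \<xi>"] by (simp add: matrix_vector_mul_assoc[symmetric] inner_commute)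
    have 2: "\<xi> \<bullet> ((?H ** A) *v \<xi>) = (?H *v \<xi>) \<bullet> (A *v \<xi>)"
      using hessian_symmetric[OF C2, of u \<xi> "A *v \<xi>"] by (simp add: matrix_vector_mul_assoc[symmetric] inner_commute)
    have 3: "\<xi> \<bullet> ((transpose ?J ** ?J) *v \<xi>) = (norm (?J *v \<xi>))\<^sup>2"
      using dot_lmul_matrix[of \<xi> "transpose ?J" "?J *v \<xi>"]
      by (simp add: matrix_vector_mul_assoc[symmetric] power2_norm_eq_inner)
    have "\<nu> * (norm \<xi>)\<^sup>2 \<le> \<xi> \<bullet> (((1 / 2) *\<^sub>R (A ** ?H + ?H ** A) - \<alpha> *\<^sub>R (transpose ?J ** ?J)) *v \<xi>)"
      using f[of u] by (auto simp: form_le_mat_left)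
    also have "\<dots> = (?H *v \<xi>) \<bullet> (A *v \<xi>) - \<alpha> * (norm (?J *v \<xi>))\<^sup>2"
      by (simp add: matrix_vector_mult_diff_rdistrib matrix_vector_mult_add_rdistrib
          scaleR_matrix_vector_assoc[symmetric] inner_diff_right inner_add_right 1 2 3)
    finally show ?thesis by simp
  qed
  with \<nu> that show ?thesis by blast
qed

text \<open>Polarization: four times the mixed term is the form at \<open>x + y\<close> minus the
  form at \<open>x - y\<close>, and the latter is nonnegative. With \<open>y = A *v x\<close> this
  bounds the right side of the subcharacteristic inequality.\<close>

lemma inner_hessian_le:
  fixes \<eta> :: "real^'n \<Rightarrow> real"
  assumes C2: "Ck_on 2 UNIV \<eta>" and lo: "\<And>\<xi>. 0 \<le> \<xi> \<bullet> (hessian \<eta> u *v \<xi>)"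
    and up: "\<And>\<xi>. \<xi> \<bullet> (hessian \<eta> u *v \<xi>) \<le> b * (norm \<xi>)\<^sup>2"
  shows "(hessian \<eta> u *v x) \<bullet> y \<le> b / 4 * (norm x + norm y)\<^sup>2"
proof -
  let ?H = "hessian \<eta> u"
  \<comment> \<open>Testing with a unit vector, whose index is arbitrary, shows that the upper
    constant is nonnegative.\<close>
  have b: "0 \<le> b" using order_trans[OF lo up, of "axis undefined 1"] by simp
  have "4 * ((?H *v x) \<bullet> y) = (x + y) \<bullet> (?H *v (x + y)) - (x - y) \<bullet> (?H *v (x - y))"
    using hessian_symmetric[OF C2, of u x y]
    by (simp add: matrix_vector_right_distrib matrix_vector_mult_diff_distrib inner_add_left inner_add_right
        inner_diff_left inner_diff_right inner_commute)
  also have "\<dots> \<le> b * (norm (x + y))\<^sup>2" using up[of "x + y"] lo[of "x - y"] by linarith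
  also have "\<dots> \<le> b * (norm x + norm y)\<^sup>2" using b by (intro mult_left_mono power_mono norm_triangle_ineq) auto
  finally show ?thesis by simp
qed

subsection \<open>Test functions\<close>

abbreviation partial_x :: "(real \<times> real \<Rightarrow> real) \<Rightarrow> real \<times> real \<Rightarrow> real" where
  "partial_x \<phi> p \<equiv> frechet_derivative \<phi> (at p) (1, 0)"

abbreviation partial_t :: "(real \<times> real \<Rightarrow> real) \<Rightarrow> real \<times> real \<Rightarrow> real" where
  "partial_t \<phi> p \<equiv> frechet_derivative \<phi> (at p) (0, 1)"

lemma test_functions_mono: "\<Omega> \<subseteq> \<Omega>' \<Longrightarrow> test_functions \<Omega> \<subseteq> test_functions \<Omega>'"
  by (auto simp: test_functions_def)

lemma zero_in_test_functions: "(\<lambda>p. 0) \<in> test_functions \<Omega>"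
  by (simp add: test_functions_def Cinf_on_def Ck_on_zero)

lemma test_functions_combination:
  assumes "\<phi> \<in> test_functions \<Omega>" "\<psi> \<in> test_functions \<Omega>"
  shows "(\<lambda>p. a * \<phi> p + b * \<psi> p) \<in> test_functions \<Omega>"
proof -
  let ?s = "\<lambda>\<phi>. closure {p. \<phi> p \<noteq> (0::real)}"
  have "Cinf_on UNIV (\<lambda>p. a * \<phi> p + b * \<psi> p)"
    using assms unfolding test_functions_def Cinf_on_def
    by (auto intro!: Ck_on_add Ck_on_bounded_linear[OF bounded_linear_mult_right])
  moreover have sub: "?s (\<lambda>p. a * \<phi> p + b * \<psi> p) \<subseteq> ?s \<phi> \<union> ?s \<psi>"
    unfolding closure_Un[symmetric] by (rule closure_mono) auto
  moreover have "compact (?s \<phi> \<union> ?s \<psi>)" "?s \<phi> \<union> ?s \<psi> \<subseteq> \<Omega>"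
    using assms by (auto simp: test_functions_def)
  moreover have "compact (?s (\<lambda>p. a * \<phi> p + b * \<psi> p))"
    by (rule compact_Int_closed[OF \<open>compact (?s \<phi> \<union> ?s \<psi>)\<close> closed_closure, THEN back_subst[of compact]])
      (rule inf.absorb2[OF sub])
  ultimately show ?thesis by (auto simp: test_functions_def)
qed

lemma test_functions_diff:
  assumes "\<phi> \<in> test_functions \<Omega>" "\<psi> \<in> test_functions \<Omega>"
  shows "(\<lambda>p. \<phi> p - \<psi> p) \<in> test_functions \<Omega>"
  using test_functions_combination[OF assms, of 1 "-1"] by simp

lemma test_function_has_derivative:
  assumes "\<phi> \<in> test_functions \<Omega>"
  shows "(\<phi> has_derivative frechet_derivative \<phi> (at p)) (at p)"
proof -
  have "Ck_on (Suc 0) UNIV \<phi>" using assms by (simp only: test_functions_def Cinf_on_def mem_Collect_eq)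
  from Ck_on_differentiable[OF this] show ?thesis by (rule frechet_derivative_works[THEN iffD1])
qed

lemma test_function_derivative_continuous:
  assumes "\<phi> \<in> test_functions \<Omega>"
  shows "continuous_on A (\<lambda>p. frechet_derivative \<phi> (at p) v)"
proof -
  have "Ck_on (Suc 0) UNIV \<phi>" using assms by (simp only: test_functions_def Cinf_on_def mem_Collect_eq)
  then obtain f' where f': "\<And>p. (\<phi> has_derivative f' p) (at p)" and C: "\<And>v. continuous_on UNIV (\<lambda>p. f' p v)"
    by auto
  have "frechet_derivative \<phi> (at p) = f' p" for p using frechet_derivative_at[OF f'] by (rule sym)
  then show ?thesis using continuous_on_subset[OF C] by simp
qed

lemma test_function_continuous:
  assumes "\<phi> \<in> test_functions \<Omega>" shows "continuous_on A \<phi>"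
  by (rule has_derivative_continuous_on[OF has_derivative_at_withinI[OF test_function_has_derivative[OF assms]]])

lemma test_function_partial_x:
  assumes "\<phi> \<in> test_functions \<Omega>"
  shows "((\<lambda>y. \<phi> (y, t)) has_vector_derivative partial_x \<phi> (x, t)) (at x within A)"
proof -
  have "((\<lambda>y. (y, t)) has_vector_derivative (1, 0)) (at x within A)"
    unfolding has_vector_derivative_def by (auto intro!: derivative_eq_intros simp: zero_prod_def)
  from vector_derivative_diff_chain_within[OF this
      has_derivative_at_withinI[OF test_function_has_derivative[OF assms]]]
  show ?thesis by (simp add: o_def)
qed

lemma test_function_partial_t:
  assumes "\<phi> \<in> test_functions \<Omega>"
  shows "((\<lambda>s. \<phi> (x, s)) has_vector_derivative partial_t \<phi> (x, t)) (at t within A)"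
proof -
  have "(Pair x has_vector_derivative (0, 1)) (at t within A)"
    unfolding has_vector_derivative_def by (auto intro!: derivative_eq_intros simp: zero_prod_def)
  from vector_derivative_diff_chain_within[OF this
      has_derivative_at_withinI[OF test_function_has_derivative[OF assms]]]
  show ?thesis by (simp add: o_def)
qed

text \<open>The support is closed, so a point outside it has a neighbourhood on which the function
  is zero; hence the derivative vanishes along with the value.\<close>

lemma test_function_outside:
  assumes "\<phi> \<in> test_functions \<Omega>" "p \<notin> \<Omega>"
  shows "\<phi> p = 0" "frechet_derivative \<phi> (at p) v = 0"
proof -
  let ?C = "closure {p. \<phi> p \<noteq> 0}"
  have "p \<notin> ?C" using assms by (auto simp: test_functions_def)
  then show "\<phi> p = 0" using closure_subset[of "{p. \<phi> p \<noteq> 0}"] by auto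
  have "(\<phi> has_derivative (\<lambda>_. 0)) (at p)"
  proof (rule has_derivative_transform_within_open[OF has_derivative_const[of 0]])
    show "open (- ?C)" "p \<in> - ?C" using \<open>p \<notin> ?C\<close> by auto
    show "0 = \<phi> q" if "q \<in> - ?C" for q using that closure_subset[of "{p. \<phi> p \<noteq> 0}"] by auto
  qed
  from frechet_derivative_at[OF this] show "frechet_derivative \<phi> (at p) v = 0" by (rule fun_cong[symmetric])
qed

lemma integral_lborel_eq_box:
  fixes f :: "'a::euclidean_space \<Rightarrow> real"
  assumes "continuous_on (cbox a b) f"
  shows "(LINT p|lborel. indicator (cbox a b) p *\<^sub>R f p) = integral (cbox a b) f"
proof -
  have "set_integrable lborel (cbox a b) f"
    unfolding set_integrable_def using borel_integrable_compact[of "cbox a b" f] assms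
    by (simp add: indicator_scaleR_eq_if)
  from set_borel_integral_eq_integral(2)[OF this] show ?thesis by (simp add: set_lebesgue_integral_def)
qed

text \<open>The integrand vanishes off \<open>\<Omega>\<close>, so the Lebesgue integral over the
  plane becomes the gauge integral over any box that contains \<open>\<Omega>\<close>.\<close>

lemma H1_norm_square:
  assumes "\<phi> \<in> test_functions \<Omega>" "\<Omega> \<subseteq> cbox a b"
  shows "(H1_norm \<phi>)\<^sup>2 = integral (cbox a b) (\<lambda>p. (\<phi> p)\<^sup>2 + (partial_x \<phi> p)\<^sup>2 + (partial_t \<phi> p)\<^sup>2)"
proof -
  let ?f = "\<lambda>p. (\<phi> p)\<^sup>2 + (partial_x \<phi> p)\<^sup>2 + (partial_t \<phi> p)\<^sup>2"
  have z: "?f p = 0" if "p \<notin> cbox a b" for p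
  proof -
    have p: "p \<notin> \<Omega>" using that assms(2) by blast
    show ?thesis
      using test_function_outside(1)[OF assms(1) p] test_function_outside(2)[OF assms(1) p, of "(1, 0)"]
        test_function_outside(2)[OF assms(1) p, of "(0, 1)"] by simp
  qed
  have "(LINT p|lborel. ?f p) = (LINT p|lborel. indicator (cbox a b) p *\<^sub>R ?f p)"
    by (rule Bochner_Integration.integral_cong) (use z in \<open>auto simp: indicator_def\<close>)
  also have "\<dots> = integral (cbox a b) ?f"
    by (intro integral_lborel_eq_box continuous_intros test_function_continuous[OF assms(1)]
        test_function_derivative_continuous[OF assms(1)])
  finally have *: "(LINT p|lborel. ?f p) = integral (cbox a b) ?f" .
  have "(LINT p|lborel. ?f p) \<ge> 0" by (rule Bochner_Integration.integral_nonneg) auto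
  then show ?thesis unfolding H1_norm_def using * by simp
qed

lemma H1_norm_nonneg: "H1_norm \<phi> \<ge> 0"
  unfolding H1_norm_def by (intro real_sqrt_ge_zero Bochner_Integration.integral_nonneg) auto

text \<open>Pointwise, \<open>(u - v)\<^sup>2 \<le> 2 * u\<^sup>2 + 2 * v\<^sup>2\<close> already
  bounds the squared norm by 4. The value 2 returns as the bound on test functions in the smallness
  condition for compactness, which is applied to differences of members of the unit ball.\<close>

lemma H1_norm_diff_le:
  assumes "\<phi> \<in> test_functions \<Omega>" "\<psi> \<in> test_functions \<Omega>" "\<Omega> \<subseteq> cbox a b"
    and "H1_norm \<phi> \<le> 1" "H1_norm \<psi> \<le> 1"
  shows "H1_norm (\<lambda>p. \<phi> p - \<psi> p) \<le> 2"
proof -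
  let ?\<chi> = "\<lambda>p. \<phi> p - \<psi> p"
  let ?N = "\<lambda>\<phi> p. (\<phi> p)\<^sup>2 + (partial_x \<phi> p)\<^sup>2 + (partial_t \<phi> p)\<^sup>2"
  note tf = assms(1,2) test_functions_diff[OF assms(1,2)]
  have fd: "frechet_derivative ?\<chi> (at p) = (\<lambda>v. frechet_derivative \<phi> (at p) v - frechet_derivative \<psi> (at p) v)" for p
  proof -
    have "(?\<chi> has_derivative (\<lambda>v. frechet_derivative \<phi> (at p) v - frechet_derivative \<psi> (at p) v)) (at p)"
      by (rule has_derivative_diff[OF test_function_has_derivative[OF assms(1)] test_function_has_derivative[OF assms(2)]])
    from frechet_derivative_at[OF this] show ?thesis by (rule sym)
  qed
  have int: "?N f integrable_on cbox a b" if "f \<in> test_functions \<Omega>" for f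
    by (intro integrable_continuous continuous_intros test_function_continuous[OF that]
        test_function_derivative_continuous[OF that])
  have sq: "(u - v)\<^sup>2 \<le> 2 * u\<^sup>2 + 2 * v\<^sup>2" for u v :: real
    using zero_le_power2[of "u + v"] by (simp add: power2_eq_square algebra_simps)
  have "(H1_norm ?\<chi>)\<^sup>2 = integral (cbox a b) (?N ?\<chi>)" by (rule H1_norm_square[OF tf(3) assms(3)])
  also have "\<dots> \<le> integral (cbox a b) (\<lambda>p. 2 * ?N \<phi> p + 2 * ?N \<psi> p)"
  proof (rule integral_le[OF int[OF tf(3)]])
    show "(\<lambda>p. 2 * ?N \<phi> p + 2 * ?N \<psi> p) integrable_on cbox a b"
      by (intro integrable_add integrable_on_mult_right int tf)
    show "?N ?\<chi> p \<le> 2 * ?N \<phi> p + 2 * ?N \<psi> p" for p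
      unfolding fd using sq[of "\<phi> p" "\<psi> p"] sq[of "partial_x \<phi> p" "partial_x \<psi> p"] sq[of "partial_t \<phi> p" "partial_t \<psi> p"]
      by argo
  qed
  also have "\<dots> = 2 * integral (cbox a b) (?N \<phi>) + 2 * integral (cbox a b) (?N \<psi>)"
    unfolding integral_add[OF integrable_on_mult_right[OF int[OF tf(1)]] integrable_on_mult_right[OF int[OF tf(2)]]]
      integral_mult_right ..
  also have "\<dots> = 2 * (H1_norm \<phi>)\<^sup>2 + 2 * (H1_norm \<psi>)\<^sup>2"
    unfolding H1_norm_square[OF tf(1) assms(3)] H1_norm_square[OF tf(2) assms(3)] ..
  finally have "(H1_norm ?\<chi>)\<^sup>2 \<le> 2 * (H1_norm \<phi>)\<^sup>2 + 2 * (H1_norm \<psi>)\<^sup>2" .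
  moreover have "(H1_norm \<phi>)\<^sup>2 \<le> 1" "(H1_norm \<psi>)\<^sup>2 \<le> 1"
    by (rule power_le_one[OF H1_norm_nonneg assms(4)], rule power_le_one[OF H1_norm_nonneg assms(5)])
  ultimately have "(H1_norm ?\<chi>)\<^sup>2 \<le> 2\<^sup>2" by simp
  then show ?thesis by (rule power2_le_imp_le) simp
qed

subsection \<open>Poincare inequality and compactness in the L2 norm\<close>

text \<open>The integral of the squared deviation from the mean is nonnegative; on a box of zero
  volume both sides vanish.\<close>

lemma integral_square_le:
  fixes f :: "'a::euclidean_space \<Rightarrow> real"
  assumes "continuous_on (cbox a b) f"
  shows "(integral (cbox a b) f)\<^sup>2 \<le> measure lborel (cbox a b) * integral (cbox a b) (\<lambda>x. (f x)\<^sup>2)"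
proof (cases "measure lborel (cbox a b) = 0")
  case True
  then have "integral (cbox a b) f = 0" using integral_null by blast
  with True show ?thesis by simp
next
  case False
  define V where "V = measure lborel (cbox a b)"
  have V: "V > 0" using False by (simp add: V_def content_nonneg zero_less_measure_iff)
  define m where "m = integral (cbox a b) f / V"
  have i: "f integrable_on cbox a b" "(\<lambda>x. (f x)\<^sup>2) integrable_on cbox a b"
    by (intro integrable_continuous continuous_intros assms)+
  have "0 \<le> integral (cbox a b) (\<lambda>x. (f x - m)\<^sup>2)" by (rule Henstock_Kurzweil_Integration.integral_nonneg)
      (auto intro!: integrable_continuous continuous_intros assms)
  also have "(\<lambda>x. (f x - m)\<^sup>2) = (\<lambda>x. (f x)\<^sup>2 - 2 * m * f x + m\<^sup>2)"
    by (auto simp: power2_eq_square algebra_simps)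
  also have "integral (cbox a b) \<dots> = integral (cbox a b) (\<lambda>x. (f x)\<^sup>2) - 2 * m * integral (cbox a b) f + m\<^sup>2 * V"
    unfolding integral_add[OF integrable_diff[OF i(2) integrable_on_mult_right[OF i(1)]] integrable_const]
      integral_diff[OF i(2) integrable_on_mult_right[OF i(1)]] integral_mult_right by (simp add: V_def)
  also have "integral (cbox a b) f = m * V" using V by (simp add: m_def)
  finally have "m\<^sup>2 * V \<le> integral (cbox a b) (\<lambda>x. (f x)\<^sup>2)" by (simp add: power2_eq_square algebra_simps)
  then have "V * (m\<^sup>2 * V) \<le> V * integral (cbox a b) (\<lambda>x. (f x)\<^sup>2)" using V by simp
  moreover have "V * (m\<^sup>2 * V) = (integral (cbox a b) f)\<^sup>2"
    using V by (simp add: m_def power2_eq_square)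
  ultimately show ?thesis by (simp add: V_def)
qed

text \<open>A continuous function takes its mean at some point \<xi>, and by Cauchy-Schwarz its
  squared deviation from that value is at most L times the integral of the squared derivative.
  Expanding the square leaves the mean term, which is kept because cell averages of test functions
  need not vanish.\<close>

lemma poincare_interval:
  fixes g :: "real \<Rightarrow> real"
  assumes "a < b"
    and g': "\<And>x. x \<in> {a..b} \<Longrightarrow> (g has_vector_derivative g' x) (at x within {a..b})"
    and cg': "continuous_on {a..b} g'"
  shows "integral {a..b} (\<lambda>x. (g x)\<^sup>2) \<le>
    (b - a)\<^sup>2 * integral {a..b} (\<lambda>x. (g' x)\<^sup>2) + (integral {a..b} g)\<^sup>2 / (b - a)"
proof -
  define L where "L = b - a"
  define D where "D = integral {a..b} (\<lambda>x. (g' x)\<^sup>2)"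
  have L: "L > 0" using assms by (simp add: L_def)
  have cg: "continuous_on {a..b} g" unfolding continuous_on_eq_continuous_within using g' has_vector_derivative_continuous by blast
  have "\<exists>x\<in>{a<..<b}. integral {a..b} g - integral {a..a} g = (b - a) *\<^sub>R g x"
    using assms(1) integral_has_vector_derivative[OF cg]
    by (intro mvt_simple[of a b "\<lambda>x. integral {a..x} g" "\<lambda>x h. h *\<^sub>R g x"])
      (auto simp: has_vector_derivative_def[symmetric] simp del: real_scaleR_def)
  then obtain \<xi> where \<xi>: "\<xi> \<in> {a<..<b}" "integral {a..b} g = L * g \<xi>" by (auto simp: L_def)
  have iD: "(\<lambda>x. (g' x)\<^sup>2) integrable_on {a..b}"
    by (intro integrable_continuous_real continuous_intros cg')
  have inc: "(g v - g u)\<^sup>2 \<le> L * D" if "u \<le> v" "u \<in> {a..b}" "v \<in> {a..b}" for u v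
  proof -
    have sub: "{u..v} \<subseteq> {a..b}" using that by auto
    have c: "continuous_on (cbox u v) g'" using continuous_on_subset[OF cg' sub] by simp
    have "(g' has_integral (g v - g u)) {u..v}"
      by (rule fundamental_theorem_of_calculus[OF that(1)])
        (use g' sub in \<open>blast intro: has_vector_derivative_within_subset\<close>)
    then have "(g v - g u)\<^sup>2 = (integral (cbox u v) g')\<^sup>2" by (simp add: integral_unique)
    also have "\<dots> \<le> (v - u) * integral {u..v} (\<lambda>x. (g' x)\<^sup>2)"
      using integral_square_le[OF c] that(1) by simp
    also have "\<dots> \<le> L * D"
      unfolding D_def L_def
      using that sub c by (intro mult_mono integral_subset_le iD integrable_continuous_real continuous_intros
          Henstock_Kurzweil_Integration.integral_nonneg) auto
    finally show ?thesis .
  qed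
  have pt: "(g x - g \<xi>)\<^sup>2 \<le> L * D" if "x \<in> {a..b}" for x
    using inc[of x \<xi>] inc[of \<xi> x] \<xi> that by (cases "x \<le> \<xi>") (auto simp: power2_commute)
  have i: "g integrable_on {a..b}" "(\<lambda>x. (g x)\<^sup>2) integrable_on {a..b}"
    by (intro integrable_continuous_real continuous_intros cg)+
  have "integral {a..b} (\<lambda>x. (g x)\<^sup>2 - 2 * g \<xi> * g x + (g \<xi>)\<^sup>2) \<le> integral {a..b} (\<lambda>x. L * D)"
    using pt i by (intro integral_le integrable_add integrable_diff integrable_on_mult_right)
      (auto simp: power2_eq_square algebra_simps)
  also have "\<dots> = L\<^sup>2 * D" using assms by (simp add: L_def power2_eq_square)
  also have "integral {a..b} (\<lambda>x. (g x)\<^sup>2 - 2 * g \<xi> * g x + (g \<xi>)\<^sup>2)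
      = integral {a..b} (\<lambda>x. (g x)\<^sup>2) - 2 * g \<xi> * (L * g \<xi>) + (g \<xi>)\<^sup>2 * L"
    unfolding integral_add[OF integrable_diff[OF i(2) integrable_on_mult_right[OF i(1)]] integrable_const_ivl]
      integral_diff[OF i(2) integrable_on_mult_right[OF i(1)]] integral_mult_right \<xi>(2)
    using assms by (simp add: L_def)
  finally have "integral {a..b} (\<lambda>x. (g x)\<^sup>2) \<le> L\<^sup>2 * D + L * (g \<xi>)\<^sup>2"
    by (simp add: power2_eq_square algebra_simps)
  also have "L * (g \<xi>)\<^sup>2 = (integral {a..b} g)\<^sup>2 / L" using \<xi>(2) L by (simp add: power2_eq_square)
  finally show ?thesis by (simp add: L_def D_def)
qed

lemma integral_box_swap:
  fixes f :: "real \<times> real \<Rightarrow> real"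
  assumes "continuous_on (cbox (a, c) (b, d)) f"
  shows "integral (cbox (a, c) (b, d)) f = integral {c..d} (\<lambda>t. integral {a..b} (\<lambda>x. f (x, t)))"
  using integral_prod_continuous[OF assms] integral_swap_continuous[of a c b d "\<lambda>x t. f (x, t)"] assms by simp

lemma continuous_on_box_slice:
  fixes f :: "real \<times> real \<Rightarrow> real"
  assumes "continuous_on (cbox (a, c) (b, d)) f" "t \<in> {c..d}"
  shows "continuous_on {a..b} (\<lambda>x. f (x, t))"
  by (rule continuous_on_compose2[OF assms(1)]) (use assms(2) in \<open>auto intro!: continuous_intros\<close>)

lemma continuous_on_box_integral:
  fixes f :: "real \<times> real \<Rightarrow> real"
  assumes "continuous_on (cbox (a, c) (b, d)) f"
  shows "continuous_on {c..d} (\<lambda>t. integral {a..b} (\<lambda>x. f (x, t)))"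
proof -
  have "continuous_on ({c..d} \<times> cbox a b) (\<lambda>(t, x). f (x, t))"
    unfolding split_beta by (rule continuous_on_compose2[OF assms]) (auto intro!: continuous_intros)
  then show ?thesis using integral_continuous_on_param[of "{c..d}" a b "\<lambda>t x. f (x, t)"] by simp
qed

text \<open>The interval inequality is used in x for each t; the averages left over form a function
  \<open>M\<close> of t, to which it is applied again. The squared derivative of \<open>M\<close> is
  at most \<open>b - a\<close> times the integral of \<open>\<phi>t\<close> squared in x, and this
  factor cancels against the division by \<open>b - a\<close>.\<close>

lemma poincare_box:
  fixes \<phi> :: "real \<times> real \<Rightarrow> real"
  assumes "a < b" "c < d"
    and dx: "\<And>x t. x \<in> {a..b} \<Longrightarrow> t \<in> {c..d} \<Longrightarrow>
        ((\<lambda>y. \<phi> (y, t)) has_vector_derivative \<phi>x (x, t)) (at x within {a..b})"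
    and dt: "\<And>x t. x \<in> {a..b} \<Longrightarrow> t \<in> {c..d} \<Longrightarrow>
        ((\<lambda>s. \<phi> (x, s)) has_vector_derivative \<phi>t (x, t)) (at t within {c..d})"
    and C: "continuous_on (cbox (a, c) (b, d)) \<phi>" "continuous_on (cbox (a, c) (b, d)) \<phi>x"
      "continuous_on (cbox (a, c) (b, d)) \<phi>t"
  shows "integral (cbox (a, c) (b, d)) (\<lambda>p. (\<phi> p)\<^sup>2) \<le>
     (b - a)\<^sup>2 * integral (cbox (a, c) (b, d)) (\<lambda>p. (\<phi>x p)\<^sup>2)
     + (d - c)\<^sup>2 * integral (cbox (a, c) (b, d)) (\<lambda>p. (\<phi>t p)\<^sup>2)
     + (integral (cbox (a, c) (b, d)) \<phi>)\<^sup>2 / ((b - a) * (d - c))"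
proof -
  let ?B = "cbox (a, c) (b, d)"
  define M where "M = (\<lambda>t. integral {a..b} (\<lambda>x. \<phi> (x, t)))"
  define M' where "M' = (\<lambda>t. integral {a..b} (\<lambda>x. \<phi>t (x, t)))"
  have M': "(M has_vector_derivative M' t) (at t within {c..d})" if "t \<in> {c..d}" for t
  proof -
    have "((\<lambda>t. integral (cbox a b) (\<lambda>x. \<phi> (x, t))) has_vector_derivative integral (cbox a b) (\<lambda>x. \<phi>t (x, t))) (at t within {c..d})"
    proof (rule leibniz_rule_vector_derivative[where f = "\<lambda>t x. \<phi> (x, t)" and fx = "\<lambda>t x. \<phi>t (x, t)"])
      show "continuous_on ({c..d} \<times> cbox a b) (\<lambda>(t, x). \<phi>t (x, t))"
        unfolding split_beta by (rule continuous_on_compose2[OF C(3)]) (auto intro!: continuous_intros)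
      show "(\<lambda>x. \<phi> (x, t)) integrable_on cbox a b" if "t \<in> {c..d}" for t
        using continuous_on_box_slice[OF C(1) that] by (auto intro: integrable_continuous_real)
    qed (use that dt in auto)
    then show ?thesis by (simp add: M_def M'_def)
  qed
  have cM': "continuous_on {c..d} M'" unfolding M'_def by (rule continuous_on_box_integral[OF C(3)])
  have cM: "continuous_on {c..d} M" unfolding M_def by (rule continuous_on_box_integral[OF C(1)])
  have Csq: "continuous_on ?B (\<lambda>p. (\<phi> p)\<^sup>2)" "continuous_on ?B (\<lambda>p. (\<phi>x p)\<^sup>2)" "continuous_on ?B (\<lambda>p. (\<phi>t p)\<^sup>2)"
    by (intro continuous_intros C)+
  note ci = continuous_on_box_integral[OF Csq(1)] continuous_on_box_integral[OF Csq(2)] continuous_on_box_integral[OF Csq(3)]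
  have "integral ?B (\<lambda>p. (\<phi> p)\<^sup>2) = integral {c..d} (\<lambda>t. integral {a..b} (\<lambda>x. (\<phi> (x, t))\<^sup>2))"
    by (rule integral_box_swap[OF Csq(1)])
  also have "\<dots> \<le> integral {c..d} (\<lambda>t. (b - a)\<^sup>2 * integral {a..b} (\<lambda>x. (\<phi>x (x, t))\<^sup>2) + (M t)\<^sup>2 / (b - a))"
  proof (rule integral_le)
    show "integral {a..b} (\<lambda>x. (\<phi> (x, t))\<^sup>2) \<le> (b - a)\<^sup>2 * integral {a..b} (\<lambda>x. (\<phi>x (x, t))\<^sup>2) + (M t)\<^sup>2 / (b - a)"
      if "t \<in> {c..d}" for t
      unfolding M_def using that dx continuous_on_box_slice[OF C(2) that] by (intro poincare_interval assms(1)) auto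
  qed (intro integrable_continuous_real continuous_intros ci cM; use assms in simp)+
  also have "\<dots> = (b - a)\<^sup>2 * integral ?B (\<lambda>p. (\<phi>x p)\<^sup>2) + integral {c..d} (\<lambda>t. (M t)\<^sup>2) / (b - a)"
  proof -
    have "(\<lambda>t. (b - a)\<^sup>2 * integral {a..b} (\<lambda>x. (\<phi>x (x, t))\<^sup>2)) integrable_on {c..d}"
      by (intro integrable_continuous_real continuous_intros ci)
    moreover have "(\<lambda>t. (M t)\<^sup>2 / (b - a)) integrable_on {c..d}"
      by (intro integrable_continuous_real continuous_intros cM) (use assms in simp)
    ultimately show ?thesis by (simp add: integral_add integral_box_swap[OF Csq(2)])
  qed
  also have "\<dots> \<le> (b - a)\<^sup>2 * integral ?B (\<lambda>p. (\<phi>x p)\<^sup>2)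
      + ((d - c)\<^sup>2 * ((b - a) * integral ?B (\<lambda>p. (\<phi>t p)\<^sup>2)) + (integral ?B \<phi>)\<^sup>2 / (d - c)) / (b - a)"
  proof -
    have "integral {c..d} (\<lambda>t. (M t)\<^sup>2) \<le> (d - c)\<^sup>2 * integral {c..d} (\<lambda>t. (M' t)\<^sup>2) + (integral {c..d} M)\<^sup>2 / (d - c)"
      by (rule poincare_interval[OF assms(2) M' cM'])
    moreover have "integral {c..d} (\<lambda>t. (M' t)\<^sup>2) \<le> integral {c..d} (\<lambda>t. (b - a) * integral {a..b} (\<lambda>x. (\<phi>t (x, t))\<^sup>2))"
    proof (rule integral_le)
      show "(M' t)\<^sup>2 \<le> (b - a) * integral {a..b} (\<lambda>x. (\<phi>t (x, t))\<^sup>2)" if "t \<in> {c..d}" for t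
        using integral_square_le[of a b "\<lambda>x. \<phi>t (x, t)"] continuous_on_box_slice[OF C(3) that] assms(1)
        by (simp add: M'_def)
    qed (intro integrable_continuous_real continuous_intros ci cM')+
    moreover have "integral {c..d} (\<lambda>t. (b - a) * integral {a..b} (\<lambda>x. (\<phi>t (x, t))\<^sup>2)) = (b - a) * integral ?B (\<lambda>p. (\<phi>t p)\<^sup>2)"
      by (simp add: integral_box_swap[OF Csq(3)])
    moreover have "integral {c..d} M = integral ?B \<phi>" by (simp add: M_def integral_box_swap[OF C(1)])
    ultimately have "integral {c..d} (\<lambda>t. (M t)\<^sup>2)
        \<le> (d - c)\<^sup>2 * ((b - a) * integral ?B (\<lambda>p. (\<phi>t p)\<^sup>2)) + (integral ?B \<phi>)\<^sup>2 / (d - c)"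
      by (smt (verit) mult_left_mono zero_le_power2)
    then show ?thesis using assms(1) by (simp add: divide_right_mono)
  qed
  also have "\<dots> = (b - a)\<^sup>2 * integral ?B (\<lambda>p. (\<phi>x p)\<^sup>2) + (d - c)\<^sup>2 * integral ?B (\<lambda>p. (\<phi>t p)\<^sup>2)
     + (integral ?B \<phi>)\<^sup>2 / ((b - a) * (d - c))"
    using assms(1,2) by (simp add: add_divide_distrib mult.assoc)
  finally show ?thesis .
qed

text \<open>Two functions whose cell averages are close are close in \<open>L\<^sup>2\<close>. Since there are finitely many cells,
  this carries the compactness of the embedding of \<open>H\<^sup>1\<close> into \<open>L\<^sup>2\<close>.\<close>

lemma L2_le_cell_averages:
  assumes "h > 0"
  obtains \<D> where "\<D> tagged_division_of cbox a b"
    and "\<And>\<phi>. \<phi> \<in> test_functions \<Omega> \<Longrightarrow>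
      integral (cbox a b) (\<lambda>p. (\<phi> p)\<^sup>2) \<le>
        h * integral (cbox a b) (\<lambda>p. (partial_x \<phi> p)\<^sup>2 + (partial_t \<phi> p)\<^sup>2)
        + (\<Sum>(x, k)\<in>\<D>. (integral k \<phi>)\<^sup>2 / measure lborel k)"
proof -
  \<comment> \<open>A cell lies in a ball of radius \<open>r\<close> about its tag, so its sides are
    at most \<open>2 * r\<close>, the square root of \<open>h\<close>.\<close>
  define r where "r = sqrt h / 2"
  have r: "r > 0" "(2 * r)\<^sup>2 = h" using assms by (auto simp: r_def power2_eq_square)
  obtain \<D> where D: "\<D> tagged_division_of cbox a b" "(\<lambda>x. ball x r) fine \<D>"
    using fine_division_exists[OF gauge_ball[OF r(1)]] by blast
  show ?thesis
  proof (rule that[OF D(1)])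
    fix \<phi> assume tf: "\<phi> \<in> test_functions \<Omega>"
    note C = test_function_continuous[OF tf] test_function_derivative_continuous[OF tf]
    let ?E = "\<lambda>p. (partial_x \<phi> p)\<^sup>2 + (partial_t \<phi> p)\<^sup>2"
    have cell: "integral k (\<lambda>p. (\<phi> p)\<^sup>2) \<le> h * integral k ?E + (integral k \<phi>)\<^sup>2 / measure lborel k"
      if k: "(x, k) \<in> \<D>" for x k
    proof -
      obtain u v where uv: "k = cbox u v" using tagged_division_ofD(4)[OF D(1) k] by blast
      obtain u1 u2 v1 v2 where e: "u = (u1, u2)" "v = (v1, v2)" by fastforce
      have xk: "x \<in> k" using tagged_division_ofD(2)[OF D(1) k] .
      have le: "u1 \<le> v1" "u2 \<le> v2" using xk by (auto simp: uv e cbox_Pair_eq)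
      show ?thesis
      proof (cases "u1 < v1 \<and> u2 < v2")
        \<comment> \<open>A flat cell has measure zero, so every integral over it vanishes and both
          sides are 0.\<close>
        case False
        then have "measure lborel k = 0" using le by (auto simp: uv e content_Pair)
        then have "integral k f = 0" for f :: "real \<times> real \<Rightarrow> real" unfolding uv by (simp add: integral_null)
        then show ?thesis by simp
      next
        case True
        have "k \<subseteq> ball x r" using D(2) k by (auto simp: fine_def)
        moreover have "u \<in> k" "v \<in> k" using le by (auto simp: uv e cbox_Pair_eq)
        ultimately have "dist x u < r" "dist x v < r" by (auto simp del: split_paired_All)
        then have "dist u v < 2 * r"
          using dist_triangle_less_add[of u x r v r] by (simp add: dist_commute)
        moreover have "dist u1 v1 \<le> dist u v" "dist u2 v2 \<le> dist u v"
          using dist_fst_le[of u v] dist_snd_le[of u v] by (auto simp: e)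
        ultimately have "v1 - u1 \<le> 2 * r" "v2 - u2 \<le> 2 * r" by (auto simp: dist_real_def)
        then have sm: "(v1 - u1)\<^sup>2 \<le> h" "(v2 - u2)\<^sup>2 \<le> h"
          using le power_mono[of "v1 - u1" "2 * r" 2] power_mono[of "v2 - u2" "2 * r" 2] r(2) by simp_all
        have nn: "integral k (\<lambda>p. (frechet_derivative \<phi> (at p) z)\<^sup>2) \<ge> 0" for z
          unfolding uv by (intro Henstock_Kurzweil_Integration.integral_nonneg integrable_continuous continuous_intros C) auto
        have "integral k (\<lambda>p. (\<phi> p)\<^sup>2) \<le> (v1 - u1)\<^sup>2 * integral k (\<lambda>p. (partial_x \<phi> p)\<^sup>2)
            + (v2 - u2)\<^sup>2 * integral k (\<lambda>p. (partial_t \<phi> p)\<^sup>2) + (integral k \<phi>)\<^sup>2 / ((v1 - u1) * (v2 - u2))"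
          unfolding uv e using True
          by (intro poincare_box test_function_partial_x[OF tf] test_function_partial_t[OF tf] C) auto
        also have "\<dots> \<le> h * integral k (\<lambda>p. (partial_x \<phi> p)\<^sup>2)
            + h * integral k (\<lambda>p. (partial_t \<phi> p)\<^sup>2) + (integral k \<phi>)\<^sup>2 / ((v1 - u1) * (v2 - u2))"
          by (intro add_mono mult_right_mono sm nn order_refl)
        also have "(v1 - u1) * (v2 - u2) = measure lborel k" using le by (simp add: uv e content_Pair)
        also have "h * integral k (\<lambda>p. (partial_x \<phi> p)\<^sup>2) + h * integral k (\<lambda>p. (partial_t \<phi> p)\<^sup>2) = h * integral k ?E"
          unfolding uv by (subst integral_add) (auto intro!: integrable_continuous continuous_intros C simp: algebra_simps)
        finally show ?thesis .
      qed
    qed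
    have "integral (cbox a b) (\<lambda>p. (\<phi> p)\<^sup>2) = (\<Sum>(x, k)\<in>\<D>. integral k (\<lambda>p. (\<phi> p)\<^sup>2))"
      by (intro integral_combine_tagged_division_topdown D(1) integrable_continuous continuous_intros C)
    also have "\<dots> \<le> (\<Sum>(x, k)\<in>\<D>. h * integral k ?E + (integral k \<phi>)\<^sup>2 / measure lborel k)"
      by (intro sum_mono) (use cell in auto)
    also have "\<dots> = h * (\<Sum>(x, k)\<in>\<D>. integral k ?E) + (\<Sum>(x, k)\<in>\<D>. (integral k \<phi>)\<^sup>2 / measure lborel k)"
      by (simp add: split_beta sum.distrib sum_distrib_left)
    also have "(\<Sum>(x, k)\<in>\<D>. integral k ?E) = integral (cbox a b) ?E"
      by (intro integral_combine_tagged_division_topdown[symmetric] D(1) integrable_continuous continuous_intros C)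
    finally show "integral (cbox a b) (\<lambda>p. (\<phi> p)\<^sup>2) \<le> h * integral (cbox a b) ?E
        + (\<Sum>(x, k)\<in>\<D>. (integral k \<phi>)\<^sup>2 / measure lborel k)" .
  qed
qed

text \<open>A member of the unit ball is encoded by its cell integrals rounded to multiples of
  \<open>s\<close>. Cell integrals are uniformly bounded, so finitely many codes occur, and one
  representative per code forms the net: the difference of two functions with equal code has small
  cell averages and bounded gradient energy.\<close>

lemma rellich:
  assumes "\<Omega> \<subseteq> cbox a b" "\<kappa> > 0"
  obtains \<Phi> where "finite \<Phi>" "\<Phi> \<subseteq> {\<phi> \<in> test_functions \<Omega>. H1_norm \<phi> \<le> 1}"
    and "\<And>\<phi>. \<phi> \<in> test_functions \<Omega> \<Longrightarrow> H1_norm \<phi> \<le> 1 \<Longrightarrow>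
      \<exists>\<psi>\<in>\<Phi>. integral (cbox a b) (\<lambda>p. (\<phi> p - \<psi> p)\<^sup>2) \<le> \<kappa>"
proof -
  let ?B = "{\<phi> \<in> test_functions \<Omega>. H1_norm \<phi> \<le> 1}"
  obtain \<D> where D: "\<D> tagged_division_of cbox a b"
    and av: "\<And>\<phi>. \<phi> \<in> test_functions \<Omega> \<Longrightarrow>
      integral (cbox a b) (\<lambda>p. (\<phi> p)\<^sup>2) \<le>
        (\<kappa> / 8) * integral (cbox a b) (\<lambda>p. (partial_x \<phi> p)\<^sup>2 + (partial_t \<phi> p)\<^sup>2)
        + (\<Sum>(x, k)\<in>\<D>. (integral k \<phi>)\<^sup>2 / measure lborel k)"
    using L2_le_cell_averages[of "\<kappa> / 8" a b \<Omega>] assms(2) by auto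
  have fin: "finite \<D>" using D by blast
  define Z where "Z = (\<Sum>(x, k)\<in>\<D>. 1 / measure lborel k)"
  have Z: "Z \<ge> 0" unfolding Z_def by (intro sum_nonneg) auto
  \<comment> \<open>Half of \<kappa> pays for the cell averages; the other half is \<kappa>/8 times
    the bound 4 on the gradient energy of a difference. The summand 1 in \<open>1 + Z\<close> avoids
    division by zero.\<close>
  define s where "s = sqrt (\<kappa> / 2 / (1 + Z))"
  have s: "s > 0" "s\<^sup>2 * Z \<le> \<kappa> / 2" using assms(2) Z by (auto simp: s_def field_simps)
  have box: "\<exists>u v. k = cbox u v \<and> cbox u v \<subseteq> cbox a b" if "(x, k) \<in> \<D>" for x k
    using tagged_division_ofD(3,4)[OF D that] by blast
  \<comment> \<open>Adding 1 makes the square of \<open>V\<close> dominate the measure, so the bound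
    on cell integrals contains no square root.\<close>
  define V where "V = measure lborel (cbox a b) + 1"
  have bd: "\<bar>integral k \<phi>\<bar> \<le> V" if k: "(x, k) \<in> \<D>" and \<phi>: "\<phi> \<in> ?B" for x k \<phi>
  proof -
    obtain u v where uv: "k = cbox u v" "cbox u v \<subseteq> cbox a b" using box[OF k] by blast
    have tf: "\<phi> \<in> test_functions \<Omega>" using \<phi> by simp
    note C = test_function_continuous[OF tf] test_function_derivative_continuous[OF tf]
    have "(integral k \<phi>)\<^sup>2 \<le> measure lborel k * integral k (\<lambda>p. (\<phi> p)\<^sup>2)"
      unfolding uv by (intro integral_square_le C)
    also have "\<dots> \<le> measure lborel (cbox a b) * integral (cbox a b) (\<lambda>p. (\<phi> p)\<^sup>2)"
      unfolding uv using uv(2)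
      by (intro mult_mono content_subset integral_subset_le Henstock_Kurzweil_Integration.integral_nonneg
          integrable_continuous continuous_intros C) auto
    also have "\<dots> \<le> measure lborel (cbox a b) * (H1_norm \<phi>)\<^sup>2"
      unfolding H1_norm_square[OF tf assms(1)]
      by (intro mult_left_mono integral_le integrable_continuous continuous_intros C) auto
    also have "\<dots> \<le> measure lborel (cbox a b) * 1"
      using \<phi> H1_norm_nonneg[of \<phi>] by (intro mult_left_mono power_le_one) auto
    also have "\<dots> \<le> V\<^sup>2" unfolding V_def power2_eq_square by (simp add: algebra_simps add_increasing2)
    finally show ?thesis using V_def abs_le_square_iff[of "integral k \<phi>" V] by simp
  qed
  define code where "code = (\<lambda>\<phi>. restrict (\<lambda>(x, k). \<lfloor>integral k \<phi> / s\<rfloor>) \<D>)"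
  have "code ` ?B \<subseteq> PiE \<D> (\<lambda>_. {\<lfloor>- V / s\<rfloor>..\<lfloor>V / s\<rfloor>})"
  proof (intro image_subsetI PiE_I)
    fix \<phi> i assume "\<phi> \<in> ?B" "i \<in> \<D>"
    moreover obtain x k where "i = (x, k)" by fastforce
    moreover from calculation have "- V \<le> integral k \<phi>" "integral k \<phi> \<le> V"
      using bd[of x k \<phi>] by (auto simp: abs_le_iff)
    ultimately show "code \<phi> i \<in> {\<lfloor>- V / s\<rfloor>..\<lfloor>V / s\<rfloor>}"
      using s(1) divide_right_mono[of "- V" "integral k \<phi>" s]
      by (auto simp: code_def intro!: floor_mono divide_right_mono)
  qed (auto simp: code_def)
  then have fc: "finite (code ` ?B)" by (rule finite_subset) (intro finite_PiE fin finite_atLeastAtMost_int)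
  \<comment> \<open>The right inverse of \<open>code\<close> picks one member of the unit ball for
    every code that occurs.\<close>
  let ?\<Phi> = "inv_into ?B code ` (code ` ?B)"
  show ?thesis
  proof (rule that[of ?\<Phi>])
    show "finite ?\<Phi>" using fc by blast
    show "?\<Phi> \<subseteq> ?B"
    proof (rule image_subsetI)
      show "inv_into ?B code z \<in> ?B" if "z \<in> code ` ?B" for z using that by (rule inv_into_into)
    qed
    fix \<phi> assume \<phi>: "\<phi> \<in> test_functions \<Omega>" "H1_norm \<phi> \<le> 1"
    define \<psi> where "\<psi> = inv_into ?B code (code \<phi>)"
    have \<phi>B: "\<phi> \<in> ?B" using \<phi> by simp
    have \<psi>: "\<psi> \<in> ?\<Phi>" "\<psi> \<in> ?B" "code \<psi> = code \<phi>"
      using inv_into_into[OF imageI[OF \<phi>B, of code]] f_inv_into_f[OF imageI[OF \<phi>B, of code]] imageI[OF imageI[OF \<phi>B]]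
      unfolding \<psi>_def by (fact | simp only: imageI \<phi>B)+
    let ?\<chi> = "\<lambda>p. \<phi> p - \<psi> p"
    have tf: "?\<chi> \<in> test_functions \<Omega>" using test_functions_diff \<phi> \<psi> by blast
    note C = test_function_continuous[OF tf] test_function_derivative_continuous[OF tf]
    have "integral (cbox a b) (\<lambda>p. (partial_x ?\<chi> p)\<^sup>2 + (partial_t ?\<chi> p)\<^sup>2) \<le> (H1_norm ?\<chi>)\<^sup>2"
      unfolding H1_norm_square[OF tf assms(1)] by (intro integral_le integrable_continuous continuous_intros C) auto
    also have "\<dots> \<le> 2\<^sup>2"
      using H1_norm_diff_le[OF \<phi>(1) _ assms(1) \<phi>(2)] \<psi>(2) H1_norm_nonneg by (intro power_mono) auto
    finally have E: "integral (cbox a b) (\<lambda>p. (partial_x ?\<chi> p)\<^sup>2 + (partial_t ?\<chi> p)\<^sup>2) \<le> 4" by simp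
    have cell: "(integral k ?\<chi>)\<^sup>2 / measure lborel k \<le> s\<^sup>2 * (1 / measure lborel k)" if k: "(x, k) \<in> \<D>" for x k
    proof -
      obtain u v where uv: "k = cbox u v" using box[OF k] by blast
      have \<psi>tf: "\<psi> \<in> test_functions \<Omega>" using \<psi>(2) by simp
      have "\<phi> integrable_on k" "\<psi> integrable_on k" unfolding uv
        by (intro integrable_continuous test_function_continuous[OF \<phi>(1)] test_function_continuous[OF \<psi>tf])+
      then have d: "integral k ?\<chi> = integral k \<phi> - integral k \<psi>" by (rule integral_diff)
      have "\<lfloor>integral k \<psi> / s\<rfloor> = \<lfloor>integral k \<phi> / s\<rfloor>"
        using fun_cong[OF \<psi>(3), of "(x, k)"] k by (simp add: code_def)
      then have "\<bar>integral k \<phi> / s - integral k \<psi> / s\<bar> \<le> 1" by linarith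
      then have "\<bar>integral k ?\<chi>\<bar> \<le> s" using s(1) by (simp add: d diff_divide_distrib[symmetric] abs_div divide_le_eq)
      then have "(integral k ?\<chi>)\<^sup>2 \<le> s\<^sup>2" using s(1) abs_le_square_iff[of "integral k ?\<chi>" s] by simp
      then show ?thesis by (simp add: divide_right_mono)
    qed
    have "integral (cbox a b) (\<lambda>p. (?\<chi> p)\<^sup>2) \<le> (\<kappa> / 8) * 4 + (\<Sum>(x, k)\<in>\<D>. s\<^sup>2 * (1 / measure lborel k))"
    proof (rule order_trans[OF av[OF tf]], intro add_mono mult_left_mono E sum_mono)
      show "(case i of (x, k) \<Rightarrow> (integral k ?\<chi>)\<^sup>2 / measure lborel k) \<le> (case i of (x, k) \<Rightarrow> s\<^sup>2 * (1 / measure lborel k))" if "i \<in> \<D>" for i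
        using cell that by (cases i) auto
    qed (use assms in simp)
    also have "(\<Sum>(x, k)\<in>\<D>. s\<^sup>2 * (1 / measure lborel k)) = s\<^sup>2 * Z"
      by (simp add: Z_def split_beta sum_distrib_left)
    also have "(\<kappa> / 8) * 4 + s\<^sup>2 * Z \<le> \<kappa>" using s(2) by simp
    finally show "\<exists>\<psi>\<in>?\<Phi>. integral (cbox a b) (\<lambda>p. (\<phi> p - \<psi> p)\<^sup>2) \<le> \<kappa>" using \<psi>(1) by blast
  qed
qed

subsection \<open>Compactness in the local negative Sobolev space\<close>

abbreviation strip_box :: "real \<Rightarrow> real \<Rightarrow> (real \<times> real) set" where
  "strip_box T r \<equiv> {-r<..<r} \<times> {0<..<T}"

lemma strip_box_subset: "strip_box T r \<subseteq> cbox (-r, 0) (r, T)"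
  by auto

lemma local_domain_subset_strip_box:
  assumes "\<Omega> \<in> local_domains T"
  obtains r where "r > 0" "\<Omega> \<subseteq> strip_box T r"
proof -
  obtain B where B: "\<And>p. p \<in> \<Omega> \<Longrightarrow> norm p \<le> B" using assms by (auto simp: local_domains_def bounded_iff)
  have "\<Omega> \<subseteq> strip_box T (\<bar>B\<bar> + 1)"
  proof
    fix p assume p: "p \<in> \<Omega>"
    obtain x t where xt: "p = (x, t)" by fastforce
    have "\<bar>x\<bar> \<le> norm p" using norm_fst_le[of x t] by (simp add: xt)
    then have "\<bar>x\<bar> < \<bar>B\<bar> + 1" using B[OF p] by linarith
    then show "p \<in> strip_box T (\<bar>B\<bar> + 1)" using p assms by (auto simp: xt local_domains_def)
  qed
  then show ?thesis by (intro that[of "\<bar>B\<bar> + 1"]) auto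
qed

lemma test_function_strip_box:
  assumes "\<phi> \<in> test_functions (UNIV \<times> {0<..<T})"
  obtains r where "r > 0" "\<phi> \<in> test_functions (strip_box T r)"
proof -
  let ?C = "closure {p. \<phi> p \<noteq> 0}"
  have C: "compact ?C" "?C \<subseteq> UNIV \<times> {0<..<T}" using assms by (auto simp: test_functions_def)
  obtain B where B: "\<And>p. p \<in> ?C \<Longrightarrow> norm p \<le> B" using compact_imp_bounded[OF C(1)] by (auto simp: bounded_iff)
  have "?C \<subseteq> strip_box T (\<bar>B\<bar> + 1)"
  proof
    fix p assume p: "p \<in> ?C"
    obtain x t where xt: "p = (x, t)" by fastforce
    have "\<bar>x\<bar> \<le> norm p" using norm_fst_le[of x t] by (simp add: xt)
    then have "\<bar>x\<bar> < \<bar>B\<bar> + 1" using B[OF p] by linarith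
    then show "p \<in> strip_box T (\<bar>B\<bar> + 1)" using p C(2) by (auto simp: xt)
  qed
  then show ?thesis using assms by (intro that[of "\<bar>B\<bar> + 1"]) (auto simp: test_functions_def)
qed

definition linear_on_tests :: "real \<Rightarrow> ((real \<times> real \<Rightarrow> real) \<Rightarrow> real) \<Rightarrow> bool" where
  "linear_on_tests T L \<longleftrightarrow>
    (\<forall>\<phi> \<in> test_functions (UNIV \<times> {0<..<T}). \<forall>\<psi> \<in> test_functions (UNIV \<times> {0<..<T}). \<forall>a b.
       L (\<lambda>p. a * \<phi> p + b * \<psi> p) = a * L \<phi> + b * L \<psi>)"

lemma linear_on_tests_diff:
  assumes "linear_on_tests T L" "\<phi> \<in> test_functions \<Omega>" "\<psi> \<in> test_functions \<Omega>" "\<Omega> \<subseteq> UNIV \<times> {0<..<T}"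
  shows "L (\<lambda>p. \<phi> p - \<psi> p) = L \<phi> - L \<psi>"
proof -
  have "L (\<lambda>p. 1 * \<phi> p + (-1) * \<psi> p) = 1 * L \<phi> + (-1) * L \<psi>"
    using assms test_functions_mono[OF assms(4)] unfolding linear_on_tests_def by blast
  then show ?thesis by simp
qed

lemma Hm1_norm_le:
  assumes "\<And>\<phi>. \<phi> \<in> test_functions \<Omega> \<Longrightarrow> H1_norm \<phi> \<le> 1 \<Longrightarrow> \<bar>L \<phi>\<bar> \<le> c"
  shows "Hm1_norm \<Omega> L \<le> c"
  unfolding Hm1_norm_def
proof (rule cSUP_least)
  have "H1_norm (\<lambda>p. 0) = 0" by (simp add: H1_norm_def)
  then show "{\<phi> \<in> test_functions \<Omega>. H1_norm \<phi> \<le> 1} \<noteq> {}" using zero_in_test_functions by fastforce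
qed (use assms in auto)

text \<open>The seminorm is a supremum of reals, which dominates its members only if they are
  bounded above; the boundedness of both functionals on \<open>\<Omega>\<close> supplies
  this.\<close>

lemma le_Hm1_norm:
  assumes "Hm1_bounded \<Omega> L" "Hm1_bounded \<Omega> L'" "\<phi> \<in> test_functions \<Omega>" "H1_norm \<phi> \<le> 1"
  shows "\<bar>L \<phi> - L' \<phi>\<bar> \<le> Hm1_norm \<Omega> (\<lambda>\<phi>. L \<phi> - L' \<phi>)"
  unfolding Hm1_norm_def
proof (rule cSUP_upper)
  obtain B where B: "\<And>\<phi>. \<phi> \<in> test_functions \<Omega> \<Longrightarrow> \<bar>L \<phi>\<bar> \<le> B * H1_norm \<phi>" using assms(1) by (auto simp: Hm1_bounded_def)
  obtain B' where B': "\<And>\<phi>. \<phi> \<in> test_functions \<Omega> \<Longrightarrow> \<bar>L' \<phi>\<bar> \<le> B' * H1_norm \<phi>" using assms(2) by (auto simp: Hm1_bounded_def)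
  have *: "c * H1_norm \<phi> \<le> \<bar>c\<bar>" if "H1_norm \<phi> \<le> 1" for \<phi> c
  proof -
    have "c * H1_norm \<phi> \<le> \<bar>c\<bar> * H1_norm \<phi>" using H1_norm_nonneg[of \<phi>] by (intro mult_right_mono) auto
    also have "\<dots> \<le> \<bar>c\<bar> * 1" using that by (intro mult_left_mono) auto
    finally show ?thesis by simp
  qed
  have "\<bar>L \<phi> - L' \<phi>\<bar> \<le> \<bar>B\<bar> + \<bar>B'\<bar>" if "\<phi> \<in> test_functions \<Omega>" "H1_norm \<phi> \<le> 1" for \<phi>
    using B[OF that(1)] B'[OF that(1)] *[OF that(2), of B] *[OF that(2), of B'] by linarith
  then show "bdd_above ((\<lambda>\<phi>. \<bar>L \<phi> - L' \<phi>\<bar>) ` {\<phi> \<in> test_functions \<Omega>. H1_norm \<phi> \<le> 1})"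
    by (intro bdd_aboveI2) auto
qed (use assms in auto)

text \<open>The candidate compact set consists of the functionals that satisfy the same bounds as \<open>S\<close>. These
  bounds are closed under pointwise convergence, so the set is compact in the product topology; by
  the \<open>L\<^sup>2\<close>-compactness of the \<open>H\<^sup>1\<close>-ball, pointwise convergence in it is convergence in every
  \<open>H\<^sup>-\<^sup>1\<close>-seminorm.\<close>

lemma Hm1_loc_compactness:
  assumes ext: "S \<subseteq> extensional (test_functions (UNIV \<times> {0<..<T}))"
    and lin: "\<And>L. L \<in> S \<Longrightarrow> linear_on_tests T L"
    and bdd: "\<And>r. r > 0 \<Longrightarrow> \<exists>B. \<forall>L\<in>S. \<forall>\<phi>\<in>test_functions (strip_box T r). \<bar>L \<phi>\<bar> \<le> B * H1_norm \<phi>"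
    and L2_small: "\<And>r \<tau>. r > 0 \<Longrightarrow> \<tau> > 0 \<Longrightarrow> \<exists>\<kappa>>0. \<forall>L\<in>S. \<forall>\<phi>\<in>test_functions (strip_box T r).
        H1_norm \<phi> \<le> 2 \<and> integral (cbox (-r, 0) (r, T)) (\<lambda>p. (\<phi> p)\<^sup>2) \<le> \<kappa> \<longrightarrow> \<bar>L \<phi>\<bar> \<le> \<tau>"
  shows "\<exists>\<K>. compactin (Hm1_loc_topology T) \<K> \<and> S \<subseteq> \<K>"
proof -
  let ?I = "test_functions (UNIV \<times> {0<..<T})"
  let ?D = "\<lambda>r. test_functions (strip_box T r)"
  have DI: "?D r \<subseteq> ?I" for r by (intro test_functions_mono) auto
  obtain Bf where Bf: "\<And>r L \<phi>. r > 0 \<Longrightarrow> L \<in> S \<Longrightarrow> \<phi> \<in> ?D r \<Longrightarrow> \<bar>L \<phi>\<bar> \<le> Bf r * H1_norm \<phi>"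
    using bdd by metis
  obtain \<kappa>f where \<kappa>0: "\<And>r \<tau>. r > 0 \<Longrightarrow> \<tau> > 0 \<Longrightarrow> \<kappa>f r \<tau> > (0::real)"
    and \<kappa>f: "\<And>r \<tau> L \<phi>. r > 0 \<Longrightarrow> \<tau> > 0 \<Longrightarrow> L \<in> S \<Longrightarrow> \<phi> \<in> ?D r \<Longrightarrow> H1_norm \<phi> \<le> 2 \<Longrightarrow>
        integral (cbox (-r, 0) (r, T)) (\<lambda>p. (\<phi> p)\<^sup>2) \<le> \<kappa>f r \<tau> \<Longrightarrow> \<bar>L \<phi>\<bar> \<le> \<tau>"
    using L2_small by metis
  \<comment> \<open>Functionals are points of a product of real lines indexed by the test functions;
    extensionality makes the carrier of the product consist of exactly such functionals.\<close>
  define X where "X = product_topology (\<lambda>_. euclideanreal) ?I"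
  have topX: "topspace X = extensional ?I" by (simp add: X_def PiE_UNIV_domain extensional_def PiE_def)
  have proj: "continuous_map X euclideanreal (\<lambda>L. L \<phi>)" if "\<phi> \<in> ?I" for \<phi>
    unfolding X_def using that by (rule continuous_map_product_projection)
  define P1 where "P1 = {(\<phi>, \<psi>, a, b). \<phi> \<in> ?I \<and> \<psi> \<in> ?I} \<inter> (UNIV :: (_ \<times> _ \<times> real \<times> real) set)"
  define P2 where "P2 = {(r, \<phi>). r > 0 \<and> \<phi> \<in> ?D r}"
  define P3 where "P3 = {(r, \<tau>, \<phi>). r > 0 \<and> \<tau> > 0 \<and> \<phi> \<in> ?D r \<and> H1_norm \<phi> \<le> 2 \<and>
      integral (cbox (-r, 0) (r, T)) (\<lambda>p. (\<phi> p)\<^sup>2) \<le> \<kappa>f r \<tau>}"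
  define \<K> where "\<K> = {L \<in> topspace X. linear_on_tests T L \<and> (\<forall>(r, \<phi>) \<in> P2. \<bar>L \<phi>\<bar> \<le> Bf r * H1_norm \<phi>) \<and>
      (\<forall>(r, \<tau>, \<phi>) \<in> P3. \<bar>L \<phi>\<bar> \<le> \<tau>)}"
  have lin_P1: "linear_on_tests T L \<longleftrightarrow> (\<forall>(\<phi>, \<psi>, a, b) \<in> P1. L (\<lambda>p. a * \<phi> p + b * \<psi> p) = a * L \<phi> + b * L \<psi>)" for L
    unfolding P1_def linear_on_tests_def by auto
  have SK: "S \<subseteq> \<K>"
    using ext lin Bf \<kappa>f unfolding \<K>_def P2_def P3_def topX by auto
  have clos_le: "closedin X {L \<in> topspace X. \<bar>L \<phi>\<bar> \<le> c}" if "\<phi> \<in> ?I" for \<phi> c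
  proof -
    have "closedin X {L \<in> topspace X. L \<phi> \<in> cball 0 c}"
      by (rule closedin_continuous_map_preimage[OF proj[OF that]]) simp
    then show ?thesis by simp
  qed
  have clos_lin: "closedin X {L \<in> topspace X. L (\<lambda>p. a * \<phi> p + b * \<psi> p) = a * L \<phi> + b * L \<psi>}"
    if "\<phi> \<in> ?I" "\<psi> \<in> ?I" for \<phi> \<psi> a b
  proof -
    have "continuous_map X euclideanreal (\<lambda>L. L (\<lambda>p. a * \<phi> p + b * \<psi> p) - (a * L \<phi> + b * L \<psi>))"
      by (intro continuous_map_diff continuous_map_add continuous_map_real_mult_left proj
          test_functions_combination that)
    then have "closedin X {L \<in> topspace X. L (\<lambda>p. a * \<phi> p + b * \<psi> p) - (a * L \<phi> + b * L \<psi>) \<in> {0}}"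
      by (rule closedin_continuous_map_preimage) simp
    then show ?thesis by simp
  qed
  \<comment> \<open>Each single condition involves finitely many coordinates and is the preimage of
    a closed set. Inserting \<open>topspace X\<close> keeps the intersected family nonempty.\<close>
  have "\<K> = \<Inter>(insert (topspace X)
      ((\<lambda>(\<phi>, \<psi>, a, b). {L \<in> topspace X. L (\<lambda>p. a * \<phi> p + b * \<psi> p) = a * L \<phi> + b * L \<psi>}) ` P1
       \<union> (\<lambda>(r, \<phi>). {L \<in> topspace X. \<bar>L \<phi>\<bar> \<le> Bf r * H1_norm \<phi>}) ` P2
       \<union> (\<lambda>(r, \<tau>, \<phi>). {L \<in> topspace X. \<bar>L \<phi>\<bar> \<le> \<tau>}) ` P3))"
    unfolding \<K>_def lin_P1 by (simp add: set_eq_iff ball_Un split_beta) blast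
  also have "closedin X \<dots>"
    by (rule closedin_Inter) (auto simp: P1_def P2_def P3_def intro!: clos_le clos_lin subsetD[OF DI])
  finally have clK: "closedin X \<K>" .
  have Kbdd: "\<bar>L \<phi>\<bar> \<le> Bf r * H1_norm \<phi>" if "L \<in> \<K>" "r > 0" "\<phi> \<in> ?D r" for L r \<phi>
    using that by (auto simp: \<K>_def P2_def)
  have Ksmall: "\<bar>L \<phi>\<bar> \<le> \<tau>" if "L \<in> \<K>" "r > 0" "\<tau> > 0" "\<phi> \<in> ?D r" "H1_norm \<phi> \<le> 2"
    "integral (cbox (-r, 0) (r, T)) (\<lambda>p. (\<phi> p)\<^sup>2) \<le> \<kappa>f r \<tau>" for L r \<tau> \<phi>
    using that by (auto simp: \<K>_def P3_def)
  have Klin: "linear_on_tests T L" if "L \<in> \<K>" for L using that by (simp add: \<K>_def)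
  have KHm1: "L \<in> Hm1_loc T" if "L \<in> \<K>" for L
  proof -
    have "Hm1_bounded \<Omega> L" if \<Omega>: "\<Omega> \<in> local_domains T" for \<Omega>
    proof -
      obtain r where "r > 0" "\<Omega> \<subseteq> strip_box T r" using local_domain_subset_strip_box[OF \<Omega>] by blast
      then show ?thesis using Kbdd[OF \<open>L \<in> \<K>\<close>, of r] test_functions_mono unfolding Hm1_bounded_def by blast
    qed
    then show ?thesis using that Klin[OF that] by (auto simp: Hm1_loc_def linear_on_tests_def \<K>_def topX)
  qed
  have "\<exists>b. \<forall>L\<in>\<K>. \<bar>L \<phi>\<bar> \<le> b" if "\<phi> \<in> ?I" for \<phi>
    using test_function_strip_box[OF that] Kbdd by metis
  then obtain b where b: "\<And>\<phi> L. \<phi> \<in> ?I \<Longrightarrow> L \<in> \<K> \<Longrightarrow> \<bar>L \<phi>\<bar> \<le> b \<phi>" by metis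
  \<comment> \<open>Tychonoff: the bounds on single test functions confine \<K> to a product of
    compact balls, and \<K> is closed.\<close>
  have "compactin X (PiE ?I (\<lambda>\<phi>. cball 0 (b \<phi>)))"
    unfolding X_def by (simp add: compactin_PiE)
  moreover have "\<K> \<subseteq> PiE ?I (\<lambda>\<phi>. cball 0 (b \<phi>))"
    using b by (auto simp: PiE_def \<K>_def topX)
  ultimately have cK: "compactin X \<K>" using closed_compactin clK by blast
  have topK: "topspace (subtopology X \<K>) = \<K>" by (auto simp: \<K>_def)
  \<comment> \<open>Compactness passes to the seminorm topology as that of a continuous image; for
    the identity it suffices to examine subbasic sets.\<close>
  have "continuous_map (subtopology X \<K>) (Hm1_loc_topology T) id"
    unfolding Hm1_loc_topology_def
  proof (rule continuous_on_generated_topo)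
    fix U assume "U \<in> {{L' \<in> Hm1_loc T. Hm1_norm \<Omega> (\<lambda>\<phi>. L' \<phi> - L \<phi>) < r} | \<Omega> L r.
          \<Omega> \<in> local_domains T \<and> L \<in> Hm1_loc T \<and> r > 0}"
    then obtain \<Omega> L \<rho> where U: "U = {L' \<in> Hm1_loc T. Hm1_norm \<Omega> (\<lambda>\<phi>. L' \<phi> - L \<phi>) < \<rho>}"
      and \<Omega>: "\<Omega> \<in> local_domains T" and L: "L \<in> Hm1_loc T" by blast
    obtain r where r: "r > 0" "\<Omega> \<subseteq> strip_box T r" using local_domain_subset_strip_box[OF \<Omega>] .
    have \<Omega>s: "\<Omega> \<subseteq> cbox (-r, 0) (r, T)" using r(2) strip_box_subset by blast
    have \<Omega>I: "\<Omega> \<subseteq> UNIV \<times> {0<..<T}" using \<Omega> by (auto simp: local_domains_def)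
    have hb: "Hm1_bounded \<Omega> L'" if "L' \<in> Hm1_loc T" for L' using that \<Omega> by (auto simp: Hm1_loc_def)
    have "\<exists>W. openin (subtopology X \<K>) W \<and> L0 \<in> W \<and> W \<subseteq> U \<inter> \<K>" if L0: "L0 \<in> U \<inter> \<K>" for L0
    proof -
      define N0 where "N0 = Hm1_norm \<Omega> (\<lambda>\<phi>. L0 \<phi> - L \<phi>)"
      \<comment> \<open>Three errors of size \<tau> must fit below \<rho>: \<open>L'\<close> on
        \<phi> - \<psi>, \<open>L0\<close> on \<phi> - \<psi>, and \<open>L' - L0\<close> on the net
        function \<psi>. Dividing by 6 leaves the inequality strict.\<close>
      define \<tau> where "\<tau> = (\<rho> - N0) / 6"
      have \<tau>: "\<tau> > 0" "N0 + 3 * \<tau> < \<rho>"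
      proof -
        have "N0 < \<rho>" using L0 by (auto simp: U N0_def)
        then show "\<tau> > 0" "N0 + 3 * \<tau> < \<rho>" by (auto simp: \<tau>_def field_simps)
      qed
      obtain \<Phi> where \<Phi>: "finite \<Phi>" "\<Phi> \<subseteq> {\<phi> \<in> test_functions \<Omega>. H1_norm \<phi> \<le> 1}"
        and net: "\<And>\<phi>. \<phi> \<in> test_functions \<Omega> \<Longrightarrow> H1_norm \<phi> \<le> 1 \<Longrightarrow>
          \<exists>\<psi>\<in>\<Phi>. integral (cbox (-r, 0) (r, T)) (\<lambda>p. (\<phi> p - \<psi> p)\<^sup>2) \<le> \<kappa>f r \<tau>"
        by (rule rellich[OF \<Omega>s \<kappa>0[OF r(1) \<tau>(1)], of thesis]) blast
      have \<Phi>I: "\<Phi> \<subseteq> ?I" using \<Phi>(2) test_functions_mono[OF \<Omega>I] by blast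
      \<comment> \<open>Only the finitely many net functions are constrained, so \<open>W\<close> is
        relatively open in \<K>; the rest of the unit ball is reached through the smallness
        condition built into \<K>.\<close>
      define W where "W = \<K> \<inter> \<Inter>(insert (topspace X) ((\<lambda>\<psi>. {L' \<in> topspace X. L' \<psi> \<in> ball (L0 \<psi>) \<tau>}) ` \<Phi>))"
      have "openin X (\<Inter>(insert (topspace X) ((\<lambda>\<psi>. {L' \<in> topspace X. L' \<psi> \<in> ball (L0 \<psi>) \<tau>}) ` \<Phi>)))"
        using \<Phi>(1) \<Phi>I by (intro openin_Inter) (auto intro!: openin_continuous_map_preimage[OF proj] simp del: mem_ball)
      then have oW: "openin (subtopology X \<K>) W" unfolding W_def by (rule openin_subtopology_Int2)
      have L0W: "L0 \<in> W" using L0 \<tau>(1) by (auto simp: W_def \<K>_def)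
      have "L' \<in> U" if L': "L' \<in> W" for L'
      proof -
        have L'K: "L' \<in> \<K>" and L0K: "L0 \<in> \<K>" using L' L0 by (auto simp: W_def)
        have close: "\<bar>L' \<psi> - L0 \<psi>\<bar> < \<tau>" if "\<psi> \<in> \<Phi>" for \<psi>
          using L' that by (auto simp: W_def dist_real_def abs_minus_commute)
        have "Hm1_norm \<Omega> (\<lambda>\<phi>. L' \<phi> - L \<phi>) \<le> N0 + 3 * \<tau>"
        proof (rule Hm1_norm_le)
          fix \<phi> assume \<phi>: "\<phi> \<in> test_functions \<Omega>" "H1_norm \<phi> \<le> 1"
          obtain \<psi> where \<psi>: "\<psi> \<in> \<Phi>" "integral (cbox (-r, 0) (r, T)) (\<lambda>p. (\<phi> p - \<psi> p)\<^sup>2) \<le> \<kappa>f r \<tau>"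
            using net[OF \<phi>] by blast
          have \<psi>': "\<psi> \<in> test_functions \<Omega>" "H1_norm \<psi> \<le> 1" using \<psi>(1) \<Phi>(2) by auto
          have d: "(\<lambda>p. \<phi> p - \<psi> p) \<in> ?D r" "H1_norm (\<lambda>p. \<phi> p - \<psi> p) \<le> 2"
            using test_functions_diff[OF \<phi>(1) \<psi>'(1)] test_functions_mono[OF r(2)]
              H1_norm_diff_le[OF \<phi>(1) \<psi>'(1) \<Omega>s \<phi>(2) \<psi>'(2)] by auto
          have "\<bar>M \<phi> - M \<psi>\<bar> \<le> \<tau>" if "M \<in> \<K>" for M
            using Ksmall[OF that r(1) \<tau>(1) d \<psi>(2)] linear_on_tests_diff[OF Klin[OF that] \<phi>(1) \<psi>'(1) \<Omega>I] by simp
          then have "\<bar>L' \<phi> - L' \<psi>\<bar> \<le> \<tau>" "\<bar>L0 \<phi> - L0 \<psi>\<bar> \<le> \<tau>" using L'K L0K by auto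
          moreover have "\<bar>L0 \<phi> - L \<phi>\<bar> \<le> N0"
            unfolding N0_def by (rule le_Hm1_norm[OF hb[OF KHm1[OF L0K]] hb[OF L] \<phi>])
          ultimately show "\<bar>L' \<phi> - L \<phi>\<bar> \<le> N0 + 3 * \<tau>" using close[OF \<psi>(1)] by linarith
        qed
        then show ?thesis using \<tau>(2) KHm1[OF L'K] by (simp add: U)
      qed
      then have "W \<subseteq> U \<inter> \<K>" by (auto simp: W_def)
      then show ?thesis using oW L0W by blast
    qed
    then have "openin (subtopology X \<K>) (U \<inter> \<K>)"
      using openin_subopen[of "subtopology X \<K>" "U \<inter> \<K>"] by blast
    then show "openin (subtopology X \<K>) (id -` U \<inter> topspace (subtopology X \<K>))" by (simp only: topK vimage_id id_apply)
  next
    show "id ` topspace (subtopology X \<K>) \<subseteq> \<Union> {{L' \<in> Hm1_loc T. Hm1_norm \<Omega> (\<lambda>\<phi>. L' \<phi> - L \<phi>) < r} | \<Omega> L r.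
          \<Omega> \<in> local_domains T \<and> L \<in> Hm1_loc T \<and> r > 0}"
      unfolding topK image_id id_apply
    proof
      fix L assume L: "L \<in> \<K>"
      \<comment> \<open>The empty domain has zero seminorm and so gives a subbasic set around
        \<open>L\<close>; hence \<K> lies in the space that the seminorm sets generate.\<close>
      let ?U = "{L' \<in> Hm1_loc T. Hm1_norm {} (\<lambda>\<phi>. L' \<phi> - L \<phi>) < 1}"
      have "L \<in> ?U"
        using KHm1[OF L] Hm1_norm_le[of "{}" "\<lambda>\<phi>. L \<phi> - L \<phi>" 0] by simp
      moreover have "{} \<in> local_domains T" by (simp add: local_domains_def)
      then have "\<exists>\<Omega> L0 r. ?U = {L' \<in> Hm1_loc T. Hm1_norm \<Omega> (\<lambda>\<phi>. L' \<phi> - L0 \<phi>) < r} \<and>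
          \<Omega> \<in> local_domains T \<and> L0 \<in> Hm1_loc T \<and> r > 0"
        using KHm1[OF L] zero_less_one by blast
      ultimately show "L \<in> \<Union> {{L' \<in> Hm1_loc T. Hm1_norm \<Omega> (\<lambda>\<phi>. L' \<phi> - L \<phi>) < r} | \<Omega> L r.
          \<Omega> \<in> local_domains T \<and> L \<in> Hm1_loc T \<and> r > 0}"
        by (intro UnionI[of ?U], intro CollectI)
    qed
  qed
  from image_compactin[OF _ this, of \<K>] cK have "compactin (Hm1_loc_topology T) \<K>"
    by (simp add: compactin_subtopology)
  with SK show ?thesis by blast
qed

subsection \<open>The energy identity\<close>

lemma has_vector_derivative_inner:
  fixes f g :: "real \<Rightarrow> 'a::real_inner"
  assumes "(f has_vector_derivative f') (at x within A)" "(g has_vector_derivative g') (at x within A)"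
  shows "((\<lambda>y. f y \<bullet> g y) has_vector_derivative f x \<bullet> g' + f' \<bullet> g x) (at x within A)"
  by (rule bounded_bilinear.has_vector_derivative[OF bounded_bilinear_inner assms])

lemma has_vector_derivative_matrix:
  fixes A :: "real^'n^'m"
  assumes "(f has_vector_derivative f') (at x within S)"
  shows "((\<lambda>y. A *v f y) has_vector_derivative A *v f') (at x within S)"
  by (rule bounded_linear.has_vector_derivative[OF matrix_vector_mul_bounded_linear assms])

lemma has_vector_derivative_grad_chain:
  assumes "f differentiable (at (k x))" "(k has_vector_derivative k') (at x within A)"
  shows "((\<lambda>y. f (k y)) has_vector_derivative grad f (k x) \<bullet> k') (at x within A)"
  using vector_derivative_diff_chain_within[OF assms(2) has_derivative_at_withinI[OF has_derivative_grad[OF assms(1)]]]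
  by (simp add: o_def)

lemma has_vector_derivative_hessian_chain:
  assumes "Ck_on 2 UNIV f" "(k has_vector_derivative k') (at x within A)"
  shows "((\<lambda>y. grad f (k y)) has_vector_derivative hessian f (k x) *v k') (at x within A)"
  using vector_derivative_diff_chain_within[OF assms(2) has_derivative_at_withinI[OF hessian_has_derivative[OF assms(1)]]]
  by (simp add: o_def)

lemma has_vector_derivative_jacobian_chain:
  fixes F :: "real^'n \<Rightarrow> real^'m"
  assumes "Ck_on 1 UNIV F" "(k has_vector_derivative k') (at x within A)"
  shows "((\<lambda>y. F (k y)) has_vector_derivative jacobian F (at (k x)) *v k') (at x within A)"
  using vector_derivative_diff_chain_within[OF assms(2) has_derivative_at_withinI[OF jacobian_has_derivative[OF assms(1)]]]
  by (simp add: o_def)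

lemma vector_matrix_inner: "(g v* J) \<bullet> x = g \<bullet> (J *v x)" for J :: "real^'n^'m"
  by (rule dot_lmul_matrix)

lemma C2_differentiable: "Ck_on 2 UNIV f \<Longrightarrow> f differentiable (at u)"
  using Ck_on_differentiable[of 1 f] by (simp only: Suc_1)

lemma C2_continuous_grad: "Ck_on 2 UNIV f \<Longrightarrow> continuous_on UNIV (grad f)"
  using Ck_on_imp_continuous_on[OF Ck_on_grad[of 1 f]] by (simp only: Suc_1)

section \<open>Smooth fields on the strip and the relaxation system\<close>

locale smooth_strip =
  fixes T :: real and w :: "real \<times> real \<Rightarrow> real^'n"
  assumes T_pos: "T > 0" and smooth: "Cinf_on (UNIV \<times> {0..T}) w"
begin

abbreviation S :: "(real \<times> real) set" where "S \<equiv> UNIV \<times> {0..T}"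
abbreviation "ux \<equiv> dx w"
abbreviation "ut \<equiv> dt T w"
abbreviation "uxx \<equiv> dx (dx w)"
abbreviation "uxt \<equiv> dt T (dx w)"
abbreviation "utx \<equiv> dx (dt T w)"
abbreviation "utt \<equiv> dt T (dt T w)"

lemma C2_w: "Ck_on (Suc (Suc 0)) S w" using smooth unfolding Cinf_on_def by blast

lemmas C1_ux = Ck_on_strip_partials(3)[OF C2_w T_pos]
lemmas C1_ut = Ck_on_strip_partials(4)[OF C2_w T_pos]

lemma partials:
  assumes "t \<in> {0..T}"
  shows "((\<lambda>y. w (y, t)) has_vector_derivative ux (x, t)) (at x within A)"
    and "((\<lambda>y. ux (y, t)) has_vector_derivative uxx (x, t)) (at x within A)"
    and "((\<lambda>y. ut (y, t)) has_vector_derivative utx (x, t)) (at x within A)"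
  by (rule has_vector_derivative_at_within, rule Ck_on_strip_partials(1)[OF _ T_pos assms], rule C2_w C1_ux C1_ut)+

text \<open>The time interval may end before \<open>T\<close>, because the energy inequality is
  integrated up to an arbitrary time and uses derivatives within that shorter interval.\<close>

lemma partials_t:
  assumes "t \<in> {0..d}" "d \<le> T"
  shows "((\<lambda>s. w (x, s)) has_vector_derivative ut (x, t)) (at t within {0..d})"
    and "((\<lambda>s. ux (x, s)) has_vector_derivative uxt (x, t)) (at t within {0..d})"
    and "((\<lambda>s. ut (x, s)) has_vector_derivative utt (x, t)) (at t within {0..d})"
proof -
  have t: "t \<in> {0..T}" and sub: "{0..d} \<subseteq> {0..T}" using assms by auto
  show "((\<lambda>s. w (x, s)) has_vector_derivative ut (x, t)) (at t within {0..d})"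
    "((\<lambda>s. ux (x, s)) has_vector_derivative uxt (x, t)) (at t within {0..d})"
    "((\<lambda>s. ut (x, s)) has_vector_derivative utt (x, t)) (at t within {0..d})"
    by (rule has_vector_derivative_within_subset[OF _ sub], rule Ck_on_strip_partials(2)[OF _ T_pos t], rule C2_w C1_ux C1_ut)+
qed

lemma continuous_partials:
  "continuous_on S w" "continuous_on S ux" "continuous_on S ut" "continuous_on S uxx"
  "continuous_on S uxt" "continuous_on S utx" "continuous_on S utt"
proof -
  show "continuous_on S w" by (rule Ck_on_imp_continuous_on[OF C2_w])
  show "continuous_on S ux" by (rule Ck_on_imp_continuous_on[OF C1_ux])
  show "continuous_on S ut" by (rule Ck_on_imp_continuous_on[OF C1_ut])
  show "continuous_on S uxx" using Ck_on_strip_partials(3)[OF C1_ux T_pos] by simp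
  show "continuous_on S uxt" using Ck_on_strip_partials(4)[OF C1_ux T_pos] by simp
  show "continuous_on S utx" using Ck_on_strip_partials(3)[OF C1_ut T_pos] by simp
  show "continuous_on S utt" using Ck_on_strip_partials(4)[OF C1_ut T_pos] by simp
qed

text \<open>The time derivative of the energy density contains \<open>uxt\<close> and the flux
  derivative contains \<open>utx\<close>; their contributions cancel once the two are
  identified.\<close>

lemma mixed:
  assumes "t \<in> {0..T}" shows "uxt (x, t) = utx (x, t)"
proof (rule mixed_partials[where a = "x - 1" and b = "x + 1" and c = 0 and d = T and f = w and fx = ux and ft = ut])
  show "continuous_on ({x - 1..x + 1} \<times> {0..T}) uxt" "continuous_on ({x - 1..x + 1} \<times> {0..T}) utx"
    by (rule continuous_on_subset[OF continuous_partials(5)], force, rule continuous_on_subset[OF continuous_partials(6)], force)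
qed (use T_pos assms partials partials_t[where d = T] in auto)

lemma continuous_comp: "continuous_on UNIV f \<Longrightarrow> continuous_on S (\<lambda>p. f (w p))"
  by (rule continuous_on_compose2[OF _ continuous_partials(1)]) auto

end

locale relaxation = smooth_strip T w for T :: real and w :: "real \<times> real \<Rightarrow> real^'n" +
  fixes A :: "real^'n^'n" and F G :: "real^'n \<Rightarrow> real^'n" and \<epsilon> :: real
  assumes A_sym: "transpose A = A" and eps_pos: "\<epsilon> > 0"
    and F_C1: "Ck_on 1 UNIV F" and G_cont: "continuous_on UNIV G"
    and solution: "smooth_solution A F G T \<epsilon> w"
begin

lemma pde:
  assumes "t \<in> {0..T}"
  shows "ut (x, t) + jacobian F (at (w (x, t))) *v ux (x, t) = G (w (x, t)) + \<epsilon> *\<^sub>R (A *v uxx (x, t) - utt (x, t))"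
proof -
  have "dx (F \<circ> w) (x, t) = jacobian F (at (w (x, t))) *v ux (x, t)"
    unfolding dx_def[of "F \<circ> w"]
    using vector_derivative_at[OF has_vector_derivative_jacobian_chain[OF F_C1 partials(1)[OF assms]]] by (simp add: o_def)
  moreover have "ut (x, t) + dx (F \<circ> w) (x, t) = G (w (x, t)) + \<epsilon> *\<^sub>R (A *v uxx (x, t) - utt (x, t))"
    using solution assms unfolding smooth_solution_def by blast
  ultimately show ?thesis by simp
qed

text \<open>The system paired with the gradient of the entropy, the transport term being rewritten
  by the compatibility of \<eta> and \<open>q\<close>. It serves the convex entropy in the energy
  identity and the bounded pairs in the production.\<close>

lemma entropy_balance:
  assumes "entropy_pair F \<eta> q" "t \<in> {0..T}" "p = (x, t)"
  shows "grad \<eta> (w p) \<bullet> ut p + grad q (w p) \<bullet> ux p =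
    grad \<eta> (w p) \<bullet> G (w p) + \<epsilon> * (grad \<eta> (w p) \<bullet> (A *v uxx p)) - \<epsilon> * (grad \<eta> (w p) \<bullet> utt p)"
proof -
  have "grad q (w p) = grad \<eta> (w p) v* jacobian F (at (w p))" using assms(1) by (simp add: entropy_pair_def)
  then have "grad \<eta> (w p) \<bullet> ut p + grad q (w p) \<bullet> ux p = grad \<eta> (w p) \<bullet> (ut p + jacobian F (at (w p)) *v ux p)"
    by (simp add: vector_matrix_inner inner_add_right)
  also have "ut p + jacobian F (at (w p)) *v ux p = G (w p) + \<epsilon> *\<^sub>R (A *v uxx p - utt p)"
    using pde[OF assms(2)] assms(3) by simp
  finally show ?thesis by (simp add: inner_add_right inner_diff_right algebra_simps)
qed

lemma entropy_derivatives:
  assumes "entropy_pair F \<eta> q" "t \<in> {0..d}" "d \<le> T"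
  shows "((\<lambda>s. \<eta> (w (x, s))) has_vector_derivative grad \<eta> (w (x, t)) \<bullet> ut (x, t)) (at t within {0..d})"
    and "((\<lambda>y. q (w (y, t))) has_vector_derivative grad q (w (x, t)) \<bullet> ux (x, t)) (at x within B)"
proof -
  have t: "t \<in> {0..T}" using assms by auto
  have "\<eta> differentiable (at u)" "q differentiable (at u)" for u
    using assms(1) C2_differentiable[of \<eta>] by (auto simp: entropy_pair_def differentiable_on_def)
  then show "((\<lambda>s. \<eta> (w (x, s))) has_vector_derivative grad \<eta> (w (x, t)) \<bullet> ut (x, t)) (at t within {0..d})"
    "((\<lambda>y. q (w (y, t))) has_vector_derivative grad q (w (x, t)) \<bullet> ux (x, t)) (at x within B)"
    using has_vector_derivative_grad_chain[OF _ partials_t(1)[OF assms(2,3)]]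
      has_vector_derivative_grad_chain[OF _ partials(1)[OF t]] by blast+
qed

text \<open>An entropy flux is assumed differentiable; its gradient is continuous because it is the
  product of the gradient of \<eta> with the Jacobian of \<open>F\<close>.\<close>

lemma continuous_entropy:
  assumes "entropy_pair F \<eta> q"
  shows "continuous_on S (\<lambda>p. \<eta> (w p))" "continuous_on S (\<lambda>p. q (w p))"
    "continuous_on S (\<lambda>p. grad \<eta> (w p))" "continuous_on S (\<lambda>p. grad q (w p))"
    "continuous_on S (\<lambda>p. hessian \<eta> (w p))" "continuous_on S (\<lambda>p. G (w p))"
proof -
  have C2: "Ck_on 2 UNIV \<eta>" and q: "q differentiable_on UNIV"
    and qe: "\<And>u. grad q u = grad \<eta> u v* jacobian F (at u)" using assms by (auto simp: entropy_pair_def)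
  show "continuous_on S (\<lambda>p. \<eta> (w p))" by (rule continuous_comp[OF Ck_on_imp_continuous_on[OF C2]])
  show "continuous_on S (\<lambda>p. q (w p))" by (rule continuous_comp[OF differentiable_imp_continuous_on[OF q]])
  show g: "continuous_on S (\<lambda>p. grad \<eta> (w p))" by (rule continuous_comp[OF C2_continuous_grad[OF C2]])
  show "continuous_on S (\<lambda>p. hessian \<eta> (w p))" by (rule continuous_comp[OF continuous_on_hessian[OF C2]])
  show "continuous_on S (\<lambda>p. G (w p))" by (rule continuous_comp[OF G_cont])
  have "continuous_on UNIV (\<lambda>u. transpose (jacobian F (at u)))"
    unfolding transpose_def by (intro continuous_on_vec_lambda continuous_on_component continuous_on_jacobian[OF F_C1])
  then have "continuous_on S (\<lambda>p. transpose (jacobian F (at (w p))) *v grad \<eta> (w p))"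
    by (intro continuous_on_matrix_vector_mult' g) (rule continuous_comp)
  then show "continuous_on S (\<lambda>p. grad q (w p))" by (simp add: qe transpose_matrix_vector)
qed

end

section \<open>Energy density, flux and dissipation\<close>

locale relaxation_entropy = relaxation T w A F G \<epsilon>
  for T :: real and w :: "real \<times> real \<Rightarrow> real^'n" and A :: "real^'n^'n"
    and F G :: "real^'n \<Rightarrow> real^'n" and \<epsilon> :: real +
  fixes \<eta> q R :: "real^'n \<Rightarrow> real" and \<alpha> \<beta> \<mu> \<nu> :: real
  assumes alpha_pos: "\<alpha> > 0" and beta_pos: "\<beta> > 0" and mu_pos: "\<mu> > 0" and nu_pos: "\<nu> > 0"
    and entropy: "entropy_condition F \<eta> q \<alpha> \<beta>"
    and A_pos: "\<And>\<xi>. \<mu> * (norm \<xi>)\<^sup>2 \<le> \<xi> \<bullet> (A *v \<xi>)"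
    and subchar: "\<And>u \<xi>. \<nu> * (norm \<xi>)\<^sup>2 + \<alpha> * (norm (jacobian F (at u) *v \<xi>))\<^sup>2 \<le> (hessian \<eta> u *v \<xi>) \<bullet> (A *v \<xi>)"
    and dissipation: "weak_dissipation \<eta> G" and G_zero: "G 0 = 0"
    and source: "source_potential G R" and decay: "fast_decay T w"
begin

lemma pair: "entropy_pair F \<eta> q"
  using entropy by (simp add: entropy_condition_def)

lemma eta_C2: "Ck_on 2 UNIV \<eta>"
  using pair by (simp add: entropy_pair_def)

lemma hessian_upper: "\<xi> \<bullet> (hessian \<eta> u *v \<xi>) \<le> \<alpha> / 2 * (norm \<xi>)\<^sup>2"
  using entropy by (auto simp: entropy_condition_def form_le_mat_right)

lemma hessian_lower: "\<beta> * (norm \<xi>)\<^sup>2 \<le> \<xi> \<bullet> (hessian \<eta> u *v \<xi>)"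
  using entropy by (auto simp: entropy_condition_def form_le_mat_left)

lemma eta_grad_zero: "grad \<eta> 0 = 0"
  using entropy by (simp add: entropy_condition_def)

text \<open>Weak dissipation compared with the rest state 0, where \<open>G\<close> and the gradient
  of \<eta> vanish.\<close>

lemma source_dissipative: "grad \<eta> u \<bullet> G u \<le> 0"
  using dissipation[unfolded weak_dissipation_def, rule_format, of u 0] by (simp add: eta_grad_zero G_zero)

lemma R_props: "R differentiable (at u)" "G u = - grad R u" "R u \<ge> 0" "R 0 = 0"
  using source by (auto simp: source_potential_def differentiable_on_def)

lemma R_continuous: "continuous_on UNIV R"
  using source by (auto simp: source_potential_def intro: differentiable_imp_continuous_on)

definition e :: "real \<times> real \<Rightarrow> real" where
  "e p = \<eta> (w p) + \<epsilon> * (grad \<eta> (w p) \<bullet> ut p) + \<alpha> * \<epsilon>\<^sup>2 / 2 * (ut p \<bullet> ut p + ux p \<bullet> (A *v ux p)) + \<alpha> * \<epsilon> * R (w p)"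

definition e_t :: "real \<times> real \<Rightarrow> real" where
  "e_t p = grad \<eta> (w p) \<bullet> ut p + \<epsilon> * (grad \<eta> (w p) \<bullet> utt p + (hessian \<eta> (w p) *v ut p) \<bullet> ut p)
    + \<alpha> * \<epsilon>\<^sup>2 * (utt p \<bullet> ut p + uxt p \<bullet> (A *v ux p)) - \<alpha> * \<epsilon> * (G (w p) \<bullet> ut p)"

text \<open>A function of the state and its two derivatives rather than of the point, so that its
  behaviour at the lateral boundary follows from continuity at zero.\<close>

definition flux :: "real^'n \<Rightarrow> real^'n \<Rightarrow> real^'n \<Rightarrow> real" where
  "flux a b c = q a - \<epsilon> * (grad \<eta> a \<bullet> (A *v b)) - \<alpha> * \<epsilon>\<^sup>2 * (c \<bullet> (A *v b))"

definition flux_x :: "real \<times> real \<Rightarrow> real" where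
  "flux_x p = grad q (w p) \<bullet> ux p
    - \<epsilon> * (grad \<eta> (w p) \<bullet> (A *v uxx p) + (hessian \<eta> (w p) *v ux p) \<bullet> (A *v ux p))
    - \<alpha> * \<epsilon>\<^sup>2 * (ut p \<bullet> (A *v uxx p) + utx p \<bullet> (A *v ux p))"

definition D :: "real \<times> real \<Rightarrow> real" where
  "D p = \<bar>grad \<eta> (w p) \<bullet> G (w p)\<bar> + \<epsilon> * (\<nu> * (norm (ux p))\<^sup>2 + \<alpha> / 4 * (norm (ut p))\<^sup>2)"

text \<open>Its integral over x is the left side of the stability estimate without the dissipation
  integral.\<close>

definition m :: "real \<times> real \<Rightarrow> real" where
  "m p = (norm (w p))\<^sup>2 + \<epsilon>\<^sup>2 * (norm (ux p))\<^sup>2 + \<epsilon>\<^sup>2 * (norm (ut p))\<^sup>2 + \<epsilon> * R (w p)"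

lemma A_inner: "x \<bullet> (A *v y) = (A *v x) \<bullet> y"
  by (rule symmetric_matrix_inner[OF A_sym])

lemma e_derivative:
  assumes "t \<in> {0..d}" "d \<le> T"
  shows "((\<lambda>s. e (x, s)) has_vector_derivative e_t (x, t)) (at t within {0..d})"
proof -
  note dt = partials_t[OF assms]
  have h: "((\<lambda>s. e (x, s)) has_vector_derivative
      grad \<eta> (w (x, t)) \<bullet> ut (x, t)
      + \<epsilon> * (grad \<eta> (w (x, t)) \<bullet> utt (x, t) + (hessian \<eta> (w (x, t)) *v ut (x, t)) \<bullet> ut (x, t))
      + \<alpha> * \<epsilon>\<^sup>2 / 2 * (ut (x, t) \<bullet> utt (x, t) + utt (x, t) \<bullet> ut (x, t)
          + (ux (x, t) \<bullet> (A *v uxt (x, t)) + uxt (x, t) \<bullet> (A *v ux (x, t))))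
      + \<alpha> * \<epsilon> * (grad R (w (x, t)) \<bullet> ut (x, t))) (at t within {0..d})"
    unfolding e_def
    by (intro has_vector_derivative_add has_vector_derivative_mult_right has_vector_derivative_inner
        has_vector_derivative_matrix has_vector_derivative_grad_chain has_vector_derivative_hessian_chain
        R_props(1) C2_differentiable eta_C2 dt)
  show ?thesis
    by (rule has_vector_derivative_eq_rhs[OF h])
      (use A_inner[of "ux (x, t)" "uxt (x, t)"] in \<open>simp add: e_t_def R_props(2) inner_commute algebra_simps\<close>)
qed

lemma flux_derivative:
  assumes "t \<in> {0..T}"
  shows "((\<lambda>y. flux (w (y, t)) (ux (y, t)) (ut (y, t))) has_vector_derivative flux_x (x, t)) (at x within B)"
proof -
  have q: "q differentiable (at u)" for u using pair by (auto simp: entropy_pair_def differentiable_on_def)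
  show ?thesis
    unfolding flux_def flux_x_def
    by (intro has_vector_derivative_diff has_vector_derivative_mult_right has_vector_derivative_inner
        has_vector_derivative_matrix has_vector_derivative_grad_chain has_vector_derivative_hessian_chain
        q eta_C2 partials[OF assms])
qed

text \<open>In \<open>e_t + flux_x\<close> all second derivatives cancel: those paired with the
  gradient of \<eta> by the entropy balance, those paired with \<open>ut\<close> by the system, the
  mixed ones by symmetry. The potential \<open>R\<close> removes the product of \<open>G\<close> and
  \<open>ut\<close>. What remains is the dissipation by the source and a quadratic form in
  \<open>ux\<close>, \<open>ut\<close> and \<open>a\<close>, where \<open>a\<close> is the Jacobian
  of \<open>F\<close> applied to \<open>ux\<close>.\<close>

lemma D_le:
  assumes "t \<in> {0..T}"
  shows "D (x, t) \<le> - (e_t (x, t) + flux_x (x, t))"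
proof -
  define p where "p = (x, t)"
  define a where "a = jacobian F (at (w p)) *v ux p"
  have pde': "\<epsilon> *\<^sub>R utt p = G (w p) + \<epsilon> *\<^sub>R (A *v uxx p) - a - ut p"
    using pde[OF assms, of x] unfolding a_def p_def by (simp add: algebra_simps)
  have bal: "grad \<eta> (w p) \<bullet> ut p + grad q (w p) \<bullet> ux p =
    grad \<eta> (w p) \<bullet> G (w p) + \<epsilon> * (grad \<eta> (w p) \<bullet> (A *v uxx p)) - \<epsilon> * (grad \<eta> (w p) \<bullet> utt p)"
    by (rule entropy_balance[OF pair assms p_def])
  have "\<epsilon> * (utt p \<bullet> ut p) = (\<epsilon> *\<^sub>R utt p) \<bullet> ut p" by simp
  also have "\<dots> = G (w p) \<bullet> ut p + \<epsilon> * (ut p \<bullet> (A *v uxx p)) - a \<bullet> ut p - ut p \<bullet> ut p"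
    unfolding pde' by (simp add: inner_add_right inner_diff_right inner_commute)
  finally have "\<alpha> * \<epsilon> * (\<epsilon> * (utt p \<bullet> ut p)) =
      \<alpha> * \<epsilon> * (G (w p) \<bullet> ut p + \<epsilon> * (ut p \<bullet> (A *v uxx p)) - a \<bullet> ut p - ut p \<bullet> ut p)" by simp
  then have utt: "\<alpha> * \<epsilon>\<^sup>2 * (utt p \<bullet> ut p) = \<alpha> * \<epsilon> * (G (w p) \<bullet> ut p)
      + \<alpha> * \<epsilon>\<^sup>2 * (ut p \<bullet> (A *v uxx p)) - \<alpha> * \<epsilon> * (a \<bullet> ut p) - \<alpha> * \<epsilon> * (ut p \<bullet> ut p)"
    by (simp add: power2_eq_square algebra_simps)
  have mix: "utx p = uxt p" unfolding p_def using mixed[OF assms] by simp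
  have id: "- (e_t p + flux_x p) = - (grad \<eta> (w p) \<bullet> G (w p))
      + \<epsilon> * ((hessian \<eta> (w p) *v ux p) \<bullet> (A *v ux p) - (hessian \<eta> (w p) *v ut p) \<bullet> ut p
          + \<alpha> * (a \<bullet> ut p) + \<alpha> * (ut p \<bullet> ut p))"
    using bal utt unfolding e_t_def flux_x_def mix by (simp add: algebra_simps)
  have 1: "\<nu> * (norm (ux p))\<^sup>2 + \<alpha> * (norm a)\<^sup>2 \<le> (hessian \<eta> (w p) *v ux p) \<bullet> (A *v ux p)"
    unfolding a_def by (rule subchar)
  have 2: "(hessian \<eta> (w p) *v ut p) \<bullet> ut p \<le> \<alpha> / 2 * (norm (ut p))\<^sup>2"
    using hessian_upper[of "ut p" "w p"] by (simp add: inner_commute)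
  \<comment> \<open>Completing this square lets the |a|^2 term of the subcharacteristic inequality
    absorb the cross term, at the cost of \<alpha>/4 of |ut|^2. The Hessian costs \<alpha>/2, so
    \<alpha>/4 of the available \<alpha> is left for \<open>D\<close>.\<close>
  have "0 \<le> (norm (a + (1 / 2) *\<^sub>R ut p))\<^sup>2" by simp
  also have "\<dots> = (norm a)\<^sup>2 + a \<bullet> ut p + (norm (ut p))\<^sup>2 / 4"
    unfolding power2_norm_eq_inner by (simp add: inner_add_left inner_add_right inner_commute)
  finally have "0 \<le> \<alpha> * ((norm a)\<^sup>2 + a \<bullet> ut p + (norm (ut p))\<^sup>2 / 4)" using alpha_pos by simp
  then have 3: "0 \<le> \<alpha> * (norm a)\<^sup>2 + \<alpha> * (a \<bullet> ut p) + \<alpha> / 4 * (norm (ut p))\<^sup>2" by (simp add: algebra_simps)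
  have "\<nu> * (norm (ux p))\<^sup>2 + \<alpha> / 4 * (norm (ut p))\<^sup>2 \<le> (hessian \<eta> (w p) *v ux p) \<bullet> (A *v ux p)
      - (hessian \<eta> (w p) *v ut p) \<bullet> ut p + \<alpha> * (a \<bullet> ut p) + \<alpha> * (ut p \<bullet> ut p)"
    using 1 2 3 unfolding power2_norm_eq_inner[of "ut p"] by linarith
  then have "\<epsilon> * (\<nu> * (norm (ux p))\<^sup>2 + \<alpha> / 4 * (norm (ut p))\<^sup>2) \<le> \<epsilon> * ((hessian \<eta> (w p) *v ux p) \<bullet> (A *v ux p)
      - (hessian \<eta> (w p) *v ut p) \<bullet> ut p + \<alpha> * (a \<bullet> ut p) + \<alpha> * (ut p \<bullet> ut p))"
    using eps_pos by (intro mult_left_mono) auto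
  then show ?thesis
    unfolding p_def[symmetric] id D_def using source_dissipative[of "w p"] by linarith
qed

lemma D_nonneg: "D p \<ge> 0"
  using eps_pos nu_pos alpha_pos by (simp add: D_def)

lemma m_nonneg: "m p \<ge> 0"
  using eps_pos R_props(3) by (simp add: m_def)

text \<open>Young's inequality, with \<alpha> \<eta> as a bound for the squared gradient. The
  weights let a third of \<eta> and a quarter of the |ut|^2 term of \<open>e\<close>
  survive.\<close>

lemma cross_le: "\<epsilon> * \<bar>grad \<eta> v \<bullet> b\<bar> \<le> 2 / 3 * \<eta> v + 3 / 8 * (\<alpha> * \<epsilon>\<^sup>2) * (norm b)\<^sup>2"
proof -
  define g where "g = norm (grad \<eta> v)"
  define h where "h = \<epsilon> * norm b"
  have "\<epsilon> * \<bar>grad \<eta> v \<bullet> b\<bar> \<le> \<epsilon> * (g * norm b)"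
    unfolding g_def using eps_pos by (intro mult_left_mono Cauchy_Schwarz_ineq2) auto
  also have "\<dots> = g * h" by (simp add: h_def)
  also have "\<dots> \<le> 2 / (3 * \<alpha>) * g\<^sup>2 + 3 / 8 * \<alpha> * h\<^sup>2"
  proof -
    have "0 \<le> (4 * g - 3 * \<alpha> * h)\<^sup>2" by simp
    then have "24 * \<alpha> * (g * h) \<le> 16 * g\<^sup>2 + 9 * \<alpha>\<^sup>2 * h\<^sup>2" by (simp add: power2_eq_square algebra_simps)
    then have "(24 * \<alpha> * (g * h)) / (24 * \<alpha>) \<le> (16 * g\<^sup>2 + 9 * \<alpha>\<^sup>2 * h\<^sup>2) / (24 * \<alpha>)"
      using alpha_pos by (intro divide_right_mono) auto
    also have "(24 * \<alpha> * (g * h)) / (24 * \<alpha>) = g * h" using alpha_pos by simp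
    also have "(16 * g\<^sup>2 + 9 * \<alpha>\<^sup>2 * h\<^sup>2) / (24 * \<alpha>) = 2 / (3 * \<alpha>) * g\<^sup>2 + 3 / 8 * \<alpha> * h\<^sup>2"
      using alpha_pos by (simp add: add_divide_distrib power2_eq_square)
    finally show ?thesis .
  qed
  also have "2 / (3 * \<alpha>) * g\<^sup>2 \<le> 2 / (3 * \<alpha>) * (\<alpha> * \<eta> v)"
    unfolding g_def using entropy_bounds(3)[OF entropy alpha_pos] alpha_pos by (intro mult_left_mono) auto
  also have "\<dots> = 2 / 3 * \<eta> v" using alpha_pos by simp
  finally show ?thesis by (simp add: h_def power_mult_distrib)
qed

text \<open>Once the cross term is absorbed, \<open>e\<close> keeps \<eta>/3, hence \<beta>/6 of
  |w|^2, and \<alpha>/8 of \<epsilon>^2 |ut|^2, while the form of \<open>A\<close> gives \<alpha>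
  \<mu>/2 of \<epsilon>^2 |ux|^2. These are the three ceilings on \<open>c\<close>.\<close>

lemma e_bounds:
  assumes c: "c \<ge> 0" "c \<le> \<beta> / 6" "c \<le> \<alpha> / 8" "c \<le> \<alpha> * \<mu> / 2"
  shows "c * m p \<le> e p" and "e p \<le> \<alpha> * (1 + norm A) * m p"
proof -
  let ?a = "(norm (w p))\<^sup>2" and ?b = "\<epsilon>\<^sup>2 * (norm (ux p))\<^sup>2" and ?c = "\<epsilon>\<^sup>2 * (norm (ut p))\<^sup>2"
    and ?r = "\<epsilon> * R (w p)"
  have nn: "?a \<ge> 0" "?b \<ge> 0" "?c \<ge> 0" "?r \<ge> 0" using eps_pos R_props(3) by auto
  have cr: "\<bar>\<epsilon> * (grad \<eta> (w p) \<bullet> ut p)\<bar> \<le> 2 / 3 * \<eta> (w p) + 3 / 8 * \<alpha> * ?c"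
    using cross_le[of "w p" "ut p"] eps_pos by (simp add: abs_mult mult.assoc)
  have lo: "\<beta> / 2 * ?a \<le> \<eta> (w p)" and up: "\<eta> (w p) \<le> \<alpha> / 4 * ?a"
    using entropy_bounds[OF entropy alpha_pos] by auto
  have A1: "\<epsilon>\<^sup>2 * (\<mu> * (norm (ux p))\<^sup>2) \<le> \<epsilon>\<^sup>2 * (ux p \<bullet> (A *v ux p))"
    using A_pos by (intro mult_left_mono) auto
  have "ux p \<bullet> (A *v ux p) \<le> norm (ux p) * (norm A * norm (ux p))"
    by (rule order_trans[OF norm_cauchy_schwarz]) (intro mult_left_mono norm_matrix_vector_mult_le norm_ge_zero)
  then have A2: "\<epsilon>\<^sup>2 * (ux p \<bullet> (A *v ux p)) \<le> \<epsilon>\<^sup>2 * (norm A * (norm (ux p))\<^sup>2)"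
    by (intro mult_left_mono) (auto simp: power2_eq_square mult_ac)
  have A1': "\<alpha> / 2 * (\<mu> * ?b) \<le> \<alpha> / 2 * (\<epsilon>\<^sup>2 * (ux p \<bullet> (A *v ux p)))"
    using A1 alpha_pos by (intro mult_left_mono) (auto simp: mult_ac)
  have A2': "\<alpha> / 2 * (\<epsilon>\<^sup>2 * (ux p \<bullet> (A *v ux p))) \<le> \<alpha> / 2 * (norm A * ?b)"
    using A2 alpha_pos by (intro mult_left_mono) (auto simp: mult_ac)
  have e: "e p = \<eta> (w p) + \<epsilon> * (grad \<eta> (w p) \<bullet> ut p) + \<alpha> / 2 * ?c
      + \<alpha> / 2 * (\<epsilon>\<^sup>2 * (ux p \<bullet> (A *v ux p))) + \<alpha> * ?r"
    by (simp add: e_def power2_norm_eq_inner algebra_simps)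
  have c': "c * ?a \<le> \<beta> / 6 * ?a" "c * ?c \<le> \<alpha> / 8 * ?c" "c * ?b \<le> \<alpha> * \<mu> / 2 * ?b" "c * ?r \<le> \<alpha> / 8 * ?r"
    by (rule mult_right_mono[OF c(2) nn(1)] mult_right_mono[OF c(3) nn(3)]
        mult_right_mono[OF c(4) nn(2)] mult_right_mono[OF c(3) nn(4)])+
  have r': "\<alpha> / 8 * ?r \<le> \<alpha> * ?r" using alpha_pos nn by (intro mult_right_mono) auto
  have "c * m p = c * ?a + c * ?b + c * ?c + c * ?r" by (simp add: m_def algebra_simps)
  also have "\<dots> \<le> \<eta> (w p) / 3 + \<alpha> / 2 * (\<mu> * ?b) + \<alpha> / 8 * ?c + \<alpha> * ?r"
    using c' r' lo by (simp add: mult_ac)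
  also have "\<dots> \<le> e p" unfolding e using cr A1' by linarith
  finally show "c * m p \<le> e p" .
  \<comment> \<open>Here the cross term is added: 5/12 is (1 + 2/3)/4 and 7/8 is 1/2 + 3/8.\<close>
  have "e p \<le> 5 / 12 * \<alpha> * ?a + \<alpha> / 2 * (norm A * ?b) + 7 / 8 * \<alpha> * ?c + \<alpha> * ?r"
    unfolding e using cr up A2' by linarith
  also have "\<dots> \<le> \<alpha> * (1 + norm A) * ?a + \<alpha> * (1 + norm A) * ?b + \<alpha> * (1 + norm A) * ?c + \<alpha> * (1 + norm A) * ?r"
  proof -
    have "5 / 12 * \<alpha> \<le> \<alpha> * (1 + norm A)" "7 / 8 * \<alpha> \<le> \<alpha> * (1 + norm A)" "\<alpha> \<le> \<alpha> * (1 + norm A)"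
      "\<alpha> / 2 * norm A \<le> \<alpha> * (1 + norm A)"
      using alpha_pos by (simp_all add: algebra_simps add_increasing2)
    then have "5 / 12 * \<alpha> * ?a \<le> \<alpha> * (1 + norm A) * ?a" "7 / 8 * \<alpha> * ?c \<le> \<alpha> * (1 + norm A) * ?c"
      "\<alpha> * ?r \<le> \<alpha> * (1 + norm A) * ?r" "\<alpha> / 2 * norm A * ?b \<le> \<alpha> * (1 + norm A) * ?b"
      using nn by (blast intro: mult_right_mono)+
    then show ?thesis by (simp add: mult.assoc)
  qed
  also have "\<dots> = \<alpha> * (1 + norm A) * m p" by (simp add: m_def algebra_simps)
  finally show "e p \<le> \<alpha> * (1 + norm A) * m p" .
qed

end

subsection \<open>The stability estimate\<close>

context relaxation_entropy
begin

lemmas continuous_fields = continuous_partials continuous_entropy[OF pair] continuous_comp[OF R_continuous]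

lemma continuous_energies:
  "continuous_on S e" "continuous_on S e_t" "continuous_on S (\<lambda>p. flux (w p) (ux p) (ut p))"
  "continuous_on S flux_x" "continuous_on S D" "continuous_on S m"
  unfolding e_def[abs_def] e_t_def[abs_def] flux_def flux_x_def[abs_def] D_def[abs_def] m_def[abs_def]
  by (intro continuous_intros continuous_on_matrix_vector_mult' continuous_fields)+

lemma continuous_slice:
  assumes "continuous_on S f" "t \<in> {0..T}" shows "continuous_on B (\<lambda>x. f (x, t))"
  by (rule continuous_on_compose2[OF assms(1)]) (use assms(2) in \<open>auto intro!: continuous_intros\<close>)

lemma continuous_slice_t:
  assumes "continuous_on S f" "B \<subseteq> {0..T}" shows "continuous_on B (\<lambda>s. f (x, s))"
  by (rule continuous_on_compose2[OF assms(1)]) (use assms(2) in \<open>auto intro!: continuous_intros\<close>)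

lemma box_energy_inequality:
  assumes "t \<in> {0..T}" "r \<ge> 0"
  shows "integral {-r..r} (\<lambda>x. e (x, t)) + integral (cbox (-r, 0) (r, t)) D \<le>
    integral {-r..r} (\<lambda>x. e (x, 0))
    - integral {0..t} (\<lambda>s. flux (w (r, s)) (ux (r, s)) (ut (r, s)) - flux (w (-r, s)) (ux (-r, s)) (ut (-r, s)))"
proof -
  let ?B = "cbox (-r, 0) (r, t)"
  have sub: "?B \<subseteq> S" using assms by auto
  have C: "continuous_on ?B e_t" "continuous_on ?B flux_x" "continuous_on ?B D"
    by (rule continuous_on_subset[OF continuous_energies(2) sub] continuous_on_subset[OF continuous_energies(4) sub]
        continuous_on_subset[OF continuous_energies(5) sub])+
  have "integral ?B D \<le> integral ?B (\<lambda>p. - (e_t p + flux_x p))"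
  proof (rule integral_le)
    show "D integrable_on ?B" "(\<lambda>p. - (e_t p + flux_x p)) integrable_on ?B"
      by (intro integrable_continuous continuous_intros C)+
    show "D p \<le> - (e_t p + flux_x p)" if "p \<in> ?B" for p
      using D_le[of "snd p" "fst p"] that sub by (auto simp: mem_Times_iff)
  qed
  also have "\<dots> = - integral ?B (\<lambda>p. e_t p + flux_x p)" by (rule Henstock_Kurzweil_Integration.integral_neg)
  also have "integral ?B (\<lambda>p. e_t p + flux_x p) = integral {-r..r} (\<lambda>x. e (x, t) - e (x, 0))
      + integral {0..t} (\<lambda>s. flux (w (r, s)) (ux (r, s)) (ut (r, s)) - flux (w (-r, s)) (ux (-r, s)) (ut (-r, s)))"
  proof (rule divergence_box[where Q = "\<lambda>p. flux (w p) (ux p) (ut p)"])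
    show "((\<lambda>s. e (x, s)) has_vector_derivative e_t (x, s)) (at s within {0..t})" if "s \<in> {0..t}" for x s
      using e_derivative[OF that] assms by simp
    show "((\<lambda>y. flux (w (y, s)) (ux (y, s)) (ut (y, s))) has_vector_derivative flux_x (x, s)) (at x within {-r..r})"
      if "s \<in> {0..t}" for x s
      using flux_derivative[of s] that assms by simp
  qed (use assms C in auto)
  also have "integral {-r..r} (\<lambda>x. e (x, t) - e (x, 0)) = integral {-r..r} (\<lambda>x. e (x, t)) - integral {-r..r} (\<lambda>x. e (x, 0))"
    using assms T_pos by (intro integral_diff integrable_continuous_real continuous_slice[OF continuous_energies(1)]) auto
  finally show ?thesis by simp
qed

text \<open>Decay of order 2 yields the integrable weight, since
  \<open>1 + x\<^sup>2 \<le> (1 + \<bar>x\<bar>) ^ 2\<close>.\<close>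

lemma decay_bound:
  obtains B where "B \<ge> 0"
    "\<And>x t. t \<in> {0..T} \<Longrightarrow> norm (w (x, t)) + norm (ux (x, t)) + norm (ut (x, t)) \<le> B / (1 + x\<^sup>2)"
proof -
  obtain B where B: "\<And>x t. t \<in> {0..T} \<Longrightarrow>
      (1 + \<bar>x\<bar>) ^ 2 * (norm (w (x, t)) + norm (ux (x, t)) + norm (ut (x, t))) \<le> B"
    using decay unfolding fast_decay_def by blast
  have "norm (w (x, t)) + norm (ux (x, t)) + norm (ut (x, t)) \<le> B / (1 + x\<^sup>2)" if "t \<in> {0..T}" for x t
  proof -
    let ?n = "norm (w (x, t)) + norm (ux (x, t)) + norm (ut (x, t))"
    have "(1 + x\<^sup>2) * ?n \<le> (1 + \<bar>x\<bar>) ^ 2 * ?n"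
      by (intro mult_right_mono) (auto simp: power2_eq_square algebra_simps abs_mult_self_eq)
    then have "?n * (1 + x\<^sup>2) \<le> B" using B[OF that, of x] by (simp add: mult.commute)
    then show ?thesis by (subst pos_le_divide_eq) (auto intro: add_pos_nonneg)
  qed
  moreover have "B \<ge> 0"
  proof (rule order_trans[OF _ B[of 0 0]])
    show "0 \<in> {0..T}" using T_pos by simp
  qed simp
  ultimately show ?thesis using that by blast
qed

text \<open>The states at x = r and x = -r tend to zero uniformly in time, and the flux is
  continuous at zero. Its value there is \<open>q 0\<close>, which need not vanish; it cancels in
  the difference of the two ends.\<close>

lemma flux_small:
  assumes "\<delta> > 0"
  obtains r0 where "r0 > 0" "\<And>r s. r \<ge> r0 \<Longrightarrow> s \<in> {0..T} \<Longrightarrow>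
    \<bar>flux (w (r, s)) (ux (r, s)) (ut (r, s)) - flux (w (-r, s)) (ux (-r, s)) (ut (-r, s))\<bar> \<le> \<delta>"
proof -
  let ?f = "\<lambda>z. flux (fst z) (fst (snd z)) (snd (snd z))"
  have q: "continuous_on UNIV q" using pair by (auto simp: entropy_pair_def intro: differentiable_imp_continuous_on)
  have "continuous_on UNIV ?f"
    unfolding flux_def
    by (intro continuous_intros continuous_on_matrix_vector_mult' continuous_on_compose2[OF q]
        continuous_on_compose2[OF C2_continuous_grad[OF eta_C2]]) auto
  then have "\<forall>y\<in>UNIV. \<forall>e>0. \<exists>d>0. \<forall>z\<in>UNIV. dist z y < d \<longrightarrow> dist (?f z) (?f y) < e"
    unfolding continuous_on_iff .
  from this[rule_format, OF UNIV_I half_gt_zero[OF assms], of 0]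
  obtain \<rho> where \<rho>: "\<rho> > 0" "\<And>z. dist z 0 < \<rho> \<Longrightarrow> dist (?f z) (?f 0) < \<delta> / 2"
    by auto
  obtain B where B: "B \<ge> 0"
    "\<And>x t. t \<in> {0..T} \<Longrightarrow> norm (w (x, t)) + norm (ux (x, t)) + norm (ut (x, t)) \<le> B / (1 + x\<^sup>2)"
    using decay_bound by blast
  \<comment> \<open>The summand 1 gives r0 \<ge> 1, so \<bar>x\<bar> \<ge> r0 implies x^2 \<ge> r0
    and hence \<open>B / (1 + x\<^sup>2) < \<rho>\<close>.\<close>
  define r0 where "r0 = 1 + B / \<rho>"
  have r0: "r0 \<ge> 1" using B(1) \<rho>(1) by (simp add: r0_def)
  have near: "\<bar>flux (w (x, s)) (ux (x, s)) (ut (x, s)) - ?f 0\<bar> < \<delta> / 2" if "\<bar>x\<bar> \<ge> r0" "s \<in> {0..T}" for x s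
  proof -
    let ?z = "(w (x, s), ux (x, s), ut (x, s))"
    have "\<bar>x\<bar> * 1 \<le> \<bar>x\<bar> * \<bar>x\<bar>" using that(1) r0 by (intro mult_left_mono) auto
    then have x2: "r0 \<le> x\<^sup>2" using that(1) by (simp add: power2_eq_square abs_mult_self_eq)
    have "norm ?z \<le> norm (w (x, s)) + (norm (ux (x, s)) + norm (ut (x, s)))"
      using norm_Pair_le[of "w (x, s)" "(ux (x, s), ut (x, s))"] norm_Pair_le[of "ux (x, s)" "ut (x, s)"] by linarith
    also have "\<dots> \<le> B / (1 + x\<^sup>2)" using B(2)[OF that(2)] by (simp add: add.assoc)
    also have "\<dots> < \<rho>"
    proof -
      have "B = (r0 - 1) * \<rho>" using \<rho>(1) by (simp add: r0_def)
      also have "\<dots> < (1 + x\<^sup>2) * \<rho>" using x2 \<rho>(1) by (intro mult_strict_right_mono) auto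
      finally show ?thesis by (subst pos_divide_less_eq) (auto simp: mult.commute intro: add_pos_nonneg)
    qed
    finally show ?thesis using \<rho>(2)[of ?z] by (simp add: dist_real_def)
  qed
  show ?thesis
  proof (rule that[of r0])
    show "r0 > 0" using r0 by simp
    fix r s assume "r \<ge> r0" "s \<in> {0..T}"
    then show "\<bar>flux (w (r, s)) (ux (r, s)) (ut (r, s)) - flux (w (-r, s)) (ux (-r, s)) (ut (-r, s))\<bar> \<le> \<delta>"
      using near[of r s] near[of "-r" s] r0 by linarith
  qed
qed

text \<open>All values of the solution lie in one ball, on which the continuous \<open>G\<close> is
  bounded by \<open>K\<close>; there \<open>R\<close> is Lipschitz and at most \<open>K\<close>
  times the norm. With the linear bound on the gradient of \<eta>, all three densities inherit the
  integrable decay of the state.\<close>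

lemma field_decay:
  obtains C where "\<And>x t. t \<in> {0..T} \<Longrightarrow> R (w (x, t)) \<le> C / (1 + x\<^sup>2)"
    "\<And>x t. t \<in> {0..T} \<Longrightarrow> (norm (w (x, t)))\<^sup>2 + \<epsilon>\<^sup>2 * (norm (ux (x, t)))\<^sup>2 + \<epsilon>\<^sup>2 * (norm (ut (x, t)))\<^sup>2 \<le> C / (1 + x\<^sup>2)"
    "\<And>x t. t \<in> {0..T} \<Longrightarrow> \<bar>grad \<eta> (w (x, t)) \<bullet> G (w (x, t))\<bar> \<le> C / (1 + x\<^sup>2)"
proof -
  obtain B where B: "B \<ge> 0"
    "\<And>x t. t \<in> {0..T} \<Longrightarrow> norm (w (x, t)) + norm (ux (x, t)) + norm (ut (x, t)) \<le> B / (1 + x\<^sup>2)"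
    using decay_bound by blast
  have pos: "1 + x\<^sup>2 > 0" for x :: real by (auto intro: add_pos_nonneg)
  have Bx: "B / (1 + x\<^sup>2) \<le> B" for x :: real
    using B(1) by (subst pos_divide_le_eq[OF pos]) (simp add: algebra_simps)
  have "compact (G ` cball 0 B)"
    by (rule compact_continuous_image[OF continuous_on_subset[OF G_cont]]) auto
  then have "\<exists>K. \<forall>y\<in>G ` cball 0 B. norm y \<le> K"
    using compact_imp_bounded unfolding bounded_iff[symmetric] by blast
  then obtain K where K: "\<And>v. norm v \<le> B \<Longrightarrow> norm (G v) \<le> K" by force
  have K0: "K \<ge> 0" using K[of 0] B(1) by (simp add: G_zero)
  have Rl: "R v \<le> K * norm v" if "norm v \<le> B" for v
  proof -
    have "norm (R v - R 0) \<le> K * norm (v - 0)"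
    proof (rule differentiable_bound[of "cball 0 B" R "\<lambda>u h. grad R u \<bullet> h"])
      show "(R has_derivative (\<lambda>h. grad R u \<bullet> h)) (at u within cball 0 B)" for u
        by (rule has_derivative_at_withinI[OF has_derivative_grad[OF R_props(1)]])
      show "onorm (\<lambda>h. grad R u \<bullet> h) \<le> K" if "u \<in> cball 0 B" for u
      proof (rule onorm_bound[OF K0])
        have "norm (grad R u) \<le> K" using K[of u] that R_props(2)[of u] by simp
        then have "norm (grad R u) * norm h \<le> K * norm h" for h :: "real^'n" by (rule mult_right_mono) simp
        then show "norm (grad R u \<bullet> h) \<le> K * norm h" for h
          using order_trans[OF Cauchy_Schwarz_ineq2[of "grad R u" h]] by simp
      qed
    qed (use that B(1) in auto)
    then show ?thesis using R_props(3)[of v] R_props(4) by simp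
  qed
  have gl: "norm (grad \<eta> v) \<le> \<alpha> / 2 * norm v" for v
  proof (rule power2_le_imp_le)
    have "(norm (grad \<eta> v))\<^sup>2 \<le> \<alpha> * (\<alpha> / 4 * (norm v)\<^sup>2)"
      using entropy_bounds(3)[OF entropy alpha_pos, of v] mult_left_mono[OF entropy_bounds(2)[OF entropy alpha_pos, of v], of \<alpha>] alpha_pos
      by linarith
    then show "(norm (grad \<eta> v))\<^sup>2 \<le> (\<alpha> / 2 * norm v)\<^sup>2" by (simp add: power2_eq_square mult_ac)
  qed (use alpha_pos in simp)
  define C where "C = K * B + (1 + \<epsilon>\<^sup>2) * B * B + K * (\<alpha> / 2) * B"
  have C: "K * B \<le> C" "(1 + \<epsilon>\<^sup>2) * B * B \<le> C" "K * (\<alpha> / 2) * B \<le> C"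
    using K0 B(1) alpha_pos by (auto simp: C_def)
  show ?thesis
  proof (rule that[of C])
    fix x t assume t: "t \<in> {0..T}"
    let ?a = "norm (w (x, t))" and ?b = "norm (ux (x, t))" and ?c = "norm (ut (x, t))" and ?y = "1 + x\<^sup>2"
    have s: "?a + ?b + ?c \<le> B / ?y" by (rule B(2)[OF t])
    have aB: "?a \<le> B / ?y" using s norm_ge_zero[of "ux (x, t)"] norm_ge_zero[of "ut (x, t)"] by linarith
    then have a1: "?a \<le> B" using Bx[of x] by linarith
    have "R (w (x, t)) \<le> K * (B / ?y)" using Rl[OF a1] mult_left_mono[OF aB K0] by linarith
    also have "\<dots> \<le> C / ?y" using divide_right_mono[OF C(1), of ?y] pos[of x] by simp
    finally show "R (w (x, t)) \<le> C / ?y" .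
    have "\<bar>grad \<eta> (w (x, t)) \<bullet> G (w (x, t))\<bar> \<le> norm (grad \<eta> (w (x, t))) * norm (G (w (x, t)))"
      by (rule Cauchy_Schwarz_ineq2)
    also have "\<dots> \<le> (\<alpha> / 2 * (B / ?y)) * K"
    proof (rule mult_mono[OF _ K[OF a1]])
      show "norm (grad \<eta> (w (x, t))) \<le> \<alpha> / 2 * (B / ?y)"
        by (rule order_trans[OF gl mult_left_mono[OF aB]]) (use alpha_pos in simp)
      show "0 \<le> \<alpha> / 2 * (B / ?y)" using alpha_pos B(1) pos[of x] by simp
    qed simp
    also have "\<dots> \<le> C / ?y" using divide_right_mono[OF C(3), of ?y] pos[of x] by (simp add: mult_ac)
    finally show "\<bar>grad \<eta> (w (x, t)) \<bullet> G (w (x, t))\<bar> \<le> C / ?y" .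
    let ?n = "?a + ?b + ?c"
    have sq: "?a\<^sup>2 + \<epsilon>\<^sup>2 * ?b\<^sup>2 + \<epsilon>\<^sup>2 * ?c\<^sup>2 \<le> (1 + \<epsilon>\<^sup>2) * ?n\<^sup>2"
    proof -
      have "?a\<^sup>2 \<le> ?n\<^sup>2" by (intro power_mono) auto
      moreover have "?b\<^sup>2 + ?c\<^sup>2 \<le> ?n\<^sup>2" by (simp add: power2_eq_square algebra_simps)
      then have "\<epsilon>\<^sup>2 * (?b\<^sup>2 + ?c\<^sup>2) \<le> \<epsilon>\<^sup>2 * ?n\<^sup>2" by (intro mult_left_mono) auto
      ultimately show ?thesis by (simp only: distrib_left distrib_right mult_1)
    qed
    have "?n * ?n \<le> (B / ?y) * B" using s Bx[of x] B(1) pos[of x] by (intro mult_mono) auto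
    then have "(1 + \<epsilon>\<^sup>2) * ?n\<^sup>2 \<le> (1 + \<epsilon>\<^sup>2) * ((B / ?y) * B)"
      unfolding power2_eq_square[of ?n] by (intro mult_left_mono) auto
    also have "\<dots> \<le> C / ?y" using divide_right_mono[OF C(2), of ?y] pos[of x] by (simp add: mult_ac)
    finally show "?a\<^sup>2 + \<epsilon>\<^sup>2 * ?b\<^sup>2 + \<epsilon>\<^sup>2 * ?c\<^sup>2 \<le> C / ?y" using sq by linarith
  qed
qed

text \<open>The energy and the potential energy are separate Bochner integrals; joining them under
  one integral sign requires each density to be integrable, which the decay supplies.\<close>

lemma m_integrable:
  assumes t: "t \<in> {0..T}"
  shows "integrable lborel (\<lambda>x. m (x, t))"
    and "(LINT x|lborel. m (x, t)) = energy T \<epsilon> w t + \<epsilon> * potential_energy R w t"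
proof -
  obtain C where C: "\<And>x t. t \<in> {0..T} \<Longrightarrow> R (w (x, t)) \<le> C / (1 + x\<^sup>2)"
    "\<And>x t. t \<in> {0..T} \<Longrightarrow> (norm (w (x, t)))\<^sup>2 + \<epsilon>\<^sup>2 * (norm (ux (x, t)))\<^sup>2 + \<epsilon>\<^sup>2 * (norm (ut (x, t)))\<^sup>2 \<le> C / (1 + x\<^sup>2)"
    by (rule field_decay) blast
  let ?d = "\<lambda>x. (norm (w (x, t)))\<^sup>2 + \<epsilon>\<^sup>2 * (norm (ux (x, t)))\<^sup>2 + \<epsilon>\<^sup>2 * (norm (ut (x, t)))\<^sup>2"
  have cd: "continuous_on UNIV ?d"
    by (intro continuous_intros continuous_slice[OF continuous_partials(1) t] continuous_slice[OF continuous_partials(2) t]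
        continuous_slice[OF continuous_partials(3) t])
  have cR: "continuous_on UNIV (\<lambda>x. R (w (x, t)))"
    by (rule continuous_slice[OF continuous_comp[OF R_continuous] t])
  have d: "integrable lborel ?d"
    by (rule nonneg_continuous_integral_limit(1)[OF cd _ integral_le_cauchy_weight[OF cd C(2)[OF t]]]) auto
  have R: "integrable lborel (\<lambda>x. R (w (x, t)))"
    by (rule nonneg_continuous_integral_limit(1)[OF cR _ integral_le_cauchy_weight[OF cR C(1)[OF t]]]) (rule R_props)
  show "integrable lborel (\<lambda>x. m (x, t))"
    unfolding m_def by (intro Bochner_Integration.integrable_add[OF d] integrable_mult_right R)
  show "(LINT x|lborel. m (x, t)) = energy T \<epsilon> w t + \<epsilon> * potential_energy R w t"
    unfolding m_def energy_def potential_energy_def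
    by (subst Bochner_Integration.integral_add[OF d integrable_mult_right[OF R]]) simp
qed

lemma m_box_le:
  assumes t: "t \<in> {0..T}"
  shows "integral {-real n..real n} (\<lambda>x. m (x, t)) \<le> (LINT x|lborel. m (x, t))"
    and "(\<lambda>n. integral {-real n..real n} (\<lambda>x. m (x, t))) \<longlonglongrightarrow> (LINT x|lborel. m (x, t))"
proof -
  have c: "continuous_on UNIV (\<lambda>x. m (x, t))" by (rule continuous_slice[OF continuous_energies(6) t])
  have "integral {-real n..real n} (\<lambda>x. m (x, t)) \<le> (LINT x|lborel. m (x, t))" for n
  proof -
    have cc: "continuous_on (cbox (-real n) (real n)) (\<lambda>x. m (x, t))" by (rule continuous_on_subset[OF c subset_UNIV])
    have "integral {-real n..real n} (\<lambda>x. m (x, t)) = (LINT x|lborel. indicator {-real n..real n} x *\<^sub>R m (x, t))"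
      using integral_lborel_eq_box[OF cc] by simp
    also have "\<dots> \<le> (LINT x|lborel. m (x, t))"
      using borel_integrable_compact[of "{-real n..real n}" "\<lambda>x. m (x, t)"] cc m_integrable(1)[OF t] m_nonneg
      by (intro integral_mono) (auto simp: indicator_scaleR_eq_if indicator_def)
    finally show ?thesis .
  qed
  then show "integral {-real n..real n} (\<lambda>x. m (x, t)) \<le> (LINT x|lborel. m (x, t))"
    "(\<lambda>n. integral {-real n..real n} (\<lambda>x. m (x, t))) \<longlonglongrightarrow> (LINT x|lborel. m (x, t))"
    by (blast, intro nonneg_continuous_integral_limit(2)[OF c m_nonneg]) blast
qed

text \<open>Letting the lateral boundary of the box go to infinity removes the flux; the integrands on the left
  are nonnegative, so that a fixed box can be kept there.\<close>

lemma energy_estimate: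
  assumes c: "c \<ge> 0" "c \<le> \<beta> / 6" "c \<le> \<alpha> / 8" "c \<le> \<alpha> * \<mu> / 2" and t: "t \<in> {0..T}"
  shows "c * integral {-real n..real n} (\<lambda>x. m (x, t)) + integral (cbox (-real n, 0) (real n, t)) D
    \<le> \<alpha> * (1 + norm A) * (energy T \<epsilon> w 0 + \<epsilon> * potential_energy R w 0)"
proof -
  define M where "M = \<alpha> * (1 + norm A) * (LINT x|lborel. m (x, 0))"
  have t0: "0 \<in> {0..T}" using T_pos by simp
  let ?L = "c * integral {-real n..real n} (\<lambda>x. m (x, t)) + integral (cbox (-real n, 0) (real n, t)) D"
  have L: "?L \<le> M + \<delta> * T" if \<delta>: "\<delta> > 0" for \<delta>
  proof -
    obtain r0 where r0: "\<And>r s. r \<ge> r0 \<Longrightarrow> s \<in> {0..T} \<Longrightarrow>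
      \<bar>flux (w (r, s)) (ux (r, s)) (ut (r, s)) - flux (w (-r, s)) (ux (-r, s)) (ut (-r, s))\<bar> \<le> \<delta>"
      using flux_small[OF \<delta>] by blast
    obtain k :: nat where k: "r0 \<le> real k" using real_arch_simple by blast
    \<comment> \<open>The box must contain the given one and also be long enough for the flux
      difference to stay below \<delta>.\<close>
    define N where "N = max n k"
    define r where "r = real N"
    have r: "r \<ge> 0" "real n \<le> r" "r0 \<le> r" using k by (auto simp: r_def N_def)
    have im: "(\<lambda>x. m (x, s)) integrable_on {a..b}" "(\<lambda>x. e (x, s)) integrable_on {a..b}" if "s \<in> {0..T}" for s a b
      by (intro integrable_continuous_real continuous_slice[OF _ that] continuous_energies)+
    have sub: "cbox (-r, 0) (r, t) \<subseteq> S" for r using t by auto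
    have "c * integral {-real n..real n} (\<lambda>x. m (x, t)) \<le> c * integral {-r..r} (\<lambda>x. m (x, t))"
      using c(1) r m_nonneg by (intro mult_left_mono integral_subset_le im t) auto
    also have "\<dots> = integral {-r..r} (\<lambda>x. c * m (x, t))" by simp
    also have "\<dots> \<le> integral {-r..r} (\<lambda>x. e (x, t))"
      by (intro integral_le integrable_on_mult_right im t e_bounds(1)[OF c])
    finally have 1: "c * integral {-real n..real n} (\<lambda>x. m (x, t)) \<le> integral {-r..r} (\<lambda>x. e (x, t))" .
    have 2: "integral (cbox (-real n, 0) (real n, t)) D \<le> integral (cbox (-r, 0) (r, t)) D"
      using r D_nonneg continuous_on_subset[OF continuous_energies(5) sub]
      by (intro integral_subset_le integrable_continuous) (auto simp: cbox_Pair_eq)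
    have "integral {-r..r} (\<lambda>x. e (x, 0)) \<le> integral {-r..r} (\<lambda>x. \<alpha> * (1 + norm A) * m (x, 0))"
      by (intro integral_le integrable_on_mult_right im t0 e_bounds(2)[OF c])
    also have "\<dots> = \<alpha> * (1 + norm A) * integral {-r..r} (\<lambda>x. m (x, 0))" by simp
    also have "\<dots> \<le> M"
      unfolding M_def r_def using alpha_pos m_box_le(1)[OF t0] by (intro mult_left_mono) auto
    finally have 3: "integral {-r..r} (\<lambda>x. e (x, 0)) \<le> M" .
    let ?f = "\<lambda>s. flux (w (r, s)) (ux (r, s)) (ut (r, s)) - flux (w (-r, s)) (ux (-r, s)) (ut (-r, s))"
    have "norm (integral (cbox 0 t) ?f) \<le> \<delta> * measure lborel (cbox 0 t)"
    proof (rule integrable_bound)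
      show "?f integrable_on cbox 0 t"
        using t by (intro integrable_continuous continuous_on_diff continuous_slice_t[OF continuous_energies(3)]) auto
      show "norm (?f s) \<le> \<delta>" if "s \<in> cbox 0 t" for s using r0[OF r(3), of s] that t by auto
    qed (use \<delta> in simp)
    also have "\<dots> \<le> \<delta> * T" using t \<delta> by simp
    finally have "- integral {0..t} ?f \<le> \<delta> * T" by simp
    then show ?thesis using box_energy_inequality[OF t r(1)] 1 2 3 by linarith
  qed
  have "?L \<le> M + \<delta>" if "\<delta> > 0" for \<delta>
    using L[of "\<delta> / T"] that T_pos by simp
  then have "?L \<le> M" by (rule field_le_epsilon)
  then show ?thesis unfolding M_def m_integrable(2)[OF t0] .
qed

text \<open>Boxes exhaust the line at fixed \<open>t\<close>: the energy converges monotonically,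
  and the time integral of the line integrals converges by domination, since these are at most a
  fixed multiple of pi. The condition \<open>c \<le> 1\<close> lets the same constant serve the
  dissipation integral.\<close>

lemma stability:
  assumes c: "c > 0" "c \<le> 1" "c \<le> \<beta> / 6" "c \<le> \<alpha> / 8" "c \<le> \<alpha> * \<mu> / 2"
  shows "stability_estimate (\<alpha> * (1 + norm A) / c) G \<eta> R T \<epsilon> w"
  unfolding stability_estimate_def
proof
  fix t assume t: "t \<in> {0..T}"
  let ?g = "\<lambda>p. \<bar>grad \<eta> (w p) \<bullet> G (w p)\<bar>"
  let ?M = "\<alpha> * (1 + norm A) * (energy T \<epsilon> w 0 + \<epsilon> * potential_energy R w 0)"
  have c0: "c \<ge> 0" using c by simp
  have cg: "continuous_on S ?g" by (intro continuous_intros continuous_fields)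
  obtain C where C: "\<And>x t. t \<in> {0..T} \<Longrightarrow> ?g (x, t) \<le> C / (1 + x\<^sup>2)" by (rule field_decay) blast
  define H where "H = (\<lambda>n s. integral {-real n..real n} (\<lambda>x. ?g (x, s)))"
  have H: "H n s \<le> \<bar>C\<bar> * pi" "0 \<le> H n s" "(\<lambda>n. H n s) \<longlonglongrightarrow> (LINT x|lborel. ?g (x, s))" if s: "s \<in> {0..T}" for n s
  proof -
    have cs: "continuous_on UNIV (\<lambda>x. ?g (x, s))" by (rule continuous_slice[OF cg s])
    show le: "H n s \<le> \<bar>C\<bar> * pi" for n unfolding H_def by (rule integral_le_cauchy_weight[OF cs C[OF s]])
    show "0 \<le> H n s" unfolding H_def
      by (intro Henstock_Kurzweil_Integration.integral_nonneg integrable_continuous_real continuous_on_subset[OF cs]) auto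
    show "(\<lambda>n. H n s) \<longlonglongrightarrow> (LINT x|lborel. ?g (x, s))"
      unfolding H_def by (rule nonneg_continuous_integral_limit(2)[OF cs _ le[unfolded H_def]]) simp
  qed
  have sub: "{0..t} \<subseteq> {0..T}" using t by auto
  have bS: "cbox (-real n, 0) (real n, t) \<subseteq> S" for n using t by auto
  have cH: "continuous_on {0..t} (H n)" for n
    unfolding H_def by (rule continuous_on_box_integral) (rule continuous_on_subset[OF cg bS])
  have lim: "(\<lambda>n. LINT s|lborel. indicator {0..t} s *\<^sub>R H n s) \<longlonglongrightarrow>
      (LINT s|lborel. indicator {0..t} s *\<^sub>R (LINT x|lborel. ?g (x, s)))"
  proof (rule integral_dominated_convergence[where w = "\<lambda>s. indicator {0..t} s * (\<bar>C\<bar> * pi)"])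
    have mH: "(\<lambda>s. indicator {0..t} s *\<^sub>R H n s) \<in> borel_measurable lborel" for n
      using borel_integrable_compact[of "{0..t}" "H n"] cH by (simp add: indicator_scaleR_eq_if borel_measurable_integrable)
    have l: "(\<lambda>n. indicator {0..t} s *\<^sub>R H n s) \<longlonglongrightarrow> indicator {0..t} s *\<^sub>R (LINT x|lborel. ?g (x, s))" for s
      using H(3)[of s] sub by (auto simp: indicator_def)
    \<comment> \<open>The line integral is measurable in time as a limit of integrals over finite
      intervals, which are continuous in time.\<close>
    show "(\<lambda>s. indicator {0..t} s *\<^sub>R (LINT x|lborel. ?g (x, s))) \<in> borel_measurable lborel"
      by (rule borel_measurable_LIMSEQ_real[OF _ mH]) (rule l)
    show "AE s in lborel. (\<lambda>n. indicator {0..t} s *\<^sub>R H n s) \<longlonglongrightarrow> indicator {0..t} s *\<^sub>R (LINT x|lborel. ?g (x, s))"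
      using l by simp
    show "(\<lambda>s. indicator {0..t} s *\<^sub>R H n s) \<in> borel_measurable lborel" for n by (rule mH)
    show "integrable lborel (\<lambda>s. indicator {0..t} s * (\<bar>C\<bar> * pi))" by (intro integrable_mult_left integrable_real_indicator) (auto simp: emeasure_lborel_Icc_eq)
    show "AE s in lborel. norm (indicator {0..t} s *\<^sub>R H n s) \<le> indicator {0..t} s * (\<bar>C\<bar> * pi)" for n
      using H(1,2) sub by (intro AE_I2) (auto simp: indicator_def)
  qed
  have eqH: "(LINT s|lborel. indicator {0..t} s *\<^sub>R H n s) = integral (cbox (-real n, 0) (real n, t)) ?g" for n
    using integral_lborel_eq_box[of 0 t "H n"] cH integral_box_swap[OF continuous_on_subset[OF cg bS]] by (simp add: H_def)
  have le: "c * integral {-real n..real n} (\<lambda>x. m (x, t)) + (LINT s|lborel. indicator {0..t} s *\<^sub>R H n s) \<le> ?M" for n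
  proof -
    have "integral (cbox (-real n, 0) (real n, t)) ?g \<le> integral (cbox (-real n, 0) (real n, t)) D"
      using eps_pos nu_pos alpha_pos
      by (intro integral_le integrable_continuous continuous_on_subset[OF cg bS] continuous_on_subset[OF continuous_energies(5) bS])
        (simp add: D_def)
    then show ?thesis unfolding eqH using energy_estimate[OF c0 c(3-5) t, of n] by linarith
  qed
  let ?I = "LINT s:{0..t}|lborel. (LINT x|lborel. ?g (x, s))"
  have I: "?I \<ge> 0" unfolding set_lebesgue_integral_def
    by (intro Bochner_Integration.integral_nonneg) (auto intro!: Bochner_Integration.integral_nonneg)
  have "c * (energy T \<epsilon> w t + \<epsilon> * potential_energy R w t) + ?I \<le> ?M"
    unfolding m_integrable(2)[OF t, symmetric] set_lebesgue_integral_def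
    by (rule LIMSEQ_le_const2[OF tendsto_add[OF tendsto_mult_left[OF m_box_le(2)[OF t]] lim]]) (use le in auto)
  moreover have "c * ?I \<le> 1 * ?I" by (rule mult_right_mono[OF c(2) I])
  ultimately have "c * (energy T \<epsilon> w t + \<epsilon> * potential_energy R w t + ?I) \<le> ?M" by (simp add: distrib_left)
  then show "energy T \<epsilon> w t + \<epsilon> * potential_energy R w t + ?I
      \<le> \<alpha> * (1 + norm A) / c * (energy T \<epsilon> w 0 + \<epsilon> * potential_energy R w 0)"
    using c(1) by (simp add: pos_le_divide_eq mult.commute)
qed

end

subsection \<open>Entropy production\<close>

lemma young_abs: "\<bar>a * b\<bar> \<le> \<theta> / 2 * a\<^sup>2 + b\<^sup>2 / (2 * \<theta>)" if "\<theta> > 0" for a b \<theta> :: real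
proof -
  have "0 \<le> (\<theta> * \<bar>a\<bar> - \<bar>b\<bar>)\<^sup>2" by simp
  then have "2 * \<theta> * \<bar>a * b\<bar> \<le> \<theta>\<^sup>2 * a\<^sup>2 + b\<^sup>2" by (simp add: power2_eq_square algebra_simps abs_mult)
  then have "\<bar>a * b\<bar> \<le> (\<theta>\<^sup>2 * a\<^sup>2 + b\<^sup>2) / (2 * \<theta>)" using that by (simp add: pos_le_divide_eq mult_ac)
  also have "\<dots> = \<theta> / 2 * a\<^sup>2 + b\<^sup>2 / (2 * \<theta>)" using that by (simp add: add_divide_distrib power2_eq_square)
  finally show ?thesis .
qed

text \<open>Half-angle formula, with one of the two sine factors bounded by 1. The bound is linear
  so that the gradient of the truncation remainder becomes a product of two square integrable
  functions.\<close>

lemma one_minus_cos_le: "\<bar>1 - cos y\<bar> \<le> \<bar>y\<bar>" for y :: real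
proof -
  have "1 - cos y = 2 * (sin (y / 2))\<^sup>2" using cos_double_sin[of "y / 2"] by simp
  also have "\<dots> \<le> 2 * \<bar>sin (y / 2)\<bar>"
    using abs_sin_le_one[of "y / 2"] mult_right_mono[of "\<bar>sin (y / 2)\<bar>" 1 "\<bar>sin (y / 2)\<bar>"]
    by (simp add: power2_eq_square abs_mult_self_eq)
  also have "\<dots> \<le> \<bar>y\<bar>" using abs_sin_x_le_abs_x[of "y / 2"] by simp
  finally show ?thesis using cos_le_one[of y] by simp
qed

context relaxation_entropy
begin

section \<open>Uniform bounds on boxes of the strip\<close>

lemma box_sub: "cbox (-r, 0) (r, T) \<subseteq> S"
  by auto

lemmas continuous_box = continuous_fields[THEN continuous_on_subset, OF box_sub]
  continuous_energies[THEN continuous_on_subset, OF box_sub]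

text \<open>The dissipation is bounded by the estimate at the final time; for \<open>m\<close> the
  estimate is integrated over all times, which brings the factor \<open>T\<close>. Boxes are
  enlarged to integer half-width to fit the energy estimate.\<close>

lemma box_estimates:
  assumes c: "c > 0" "c \<le> \<beta> / 6" "c \<le> \<alpha> / 8" "c \<le> \<alpha> * \<mu> / 2"
    and K: "energy T \<epsilon> w 0 + \<epsilon> * potential_energy R w 0 \<le> K"
  shows "integral (cbox (-r, 0) (r, T)) D \<le> \<alpha> * (1 + norm A) * K"
    and "c * integral (cbox (-r, 0) (r, T)) m \<le> T * (\<alpha> * (1 + norm A) * K)"
proof -
  obtain n :: nat where n: "r \<le> real n" using real_arch_simple by blast
  have sub: "cbox (-r, 0) (r, T) \<subseteq> cbox (-real n, 0) (real n, T)" using n by (auto simp: cbox_Pair_eq)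
  have c0: "c \<ge> 0" using c by simp
  have TT: "T \<in> {0..T}" using T_pos by simp
  have mi: "(\<lambda>x. m (x, t)) integrable_on {a..b}" if "t \<in> {0..T}" for t a b
    by (intro integrable_continuous_real continuous_slice[OF continuous_energies(6) that])
  have est: "c * integral {-real n..real n} (\<lambda>x. m (x, t)) + integral (cbox (-real n, 0) (real n, t)) D \<le> \<alpha> * (1 + norm A) * K"
    if "t \<in> {0..T}" for t
    by (rule order_trans[OF energy_estimate[OF c0 c(2-4) that] mult_left_mono[OF K]]) (use alpha_pos in simp)
  have "integral (cbox (-r, 0) (r, T)) D \<le> integral (cbox (-real n, 0) (real n, T)) D"
    by (intro integral_subset_le sub integrable_continuous continuous_box ballI D_nonneg)
  moreover have "c * integral {-real n..real n} (\<lambda>x. m (x, T)) \<ge> 0"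
    by (intro mult_nonneg_nonneg c0 Henstock_Kurzweil_Integration.integral_nonneg mi TT m_nonneg)
  ultimately show "integral (cbox (-r, 0) (r, T)) D \<le> \<alpha> * (1 + norm A) * K" using est[OF TT] by linarith
  have "c * integral (cbox (-r, 0) (r, T)) m \<le> c * integral (cbox (-real n, 0) (real n, T)) m"
    by (intro mult_left_mono integral_subset_le sub integrable_continuous continuous_box ballI m_nonneg c0)
  also have "\<dots> = integral {0..T} (\<lambda>t. c * integral {-real n..real n} (\<lambda>x. m (x, t)))"
    \<comment> \<open>Fact 20 is the continuity of \<open>m\<close>: seven facts on partials, six on
      the entropy, one on \<open>R\<close>, and \<open>m\<close> is the last of the six
      energies.\<close>
    by (simp add: integral_box_swap[OF continuous_box(20)])
  also have "\<dots> \<le> integral {0..T} (\<lambda>t. \<alpha> * (1 + norm A) * K)"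
  proof (rule integral_le)
    show "(\<lambda>t. c * integral {-real n..real n} (\<lambda>x. m (x, t))) integrable_on {0..T}"
      by (intro integrable_on_mult_right integrable_continuous_real continuous_on_box_integral continuous_box)
    show "c * integral {-real n..real n} (\<lambda>x. m (x, t)) \<le> \<alpha> * (1 + norm A) * K" if t: "t \<in> {0..T}" for t
    proof -
      have "integral (cbox (-real n, 0) (real n, t)) D \<ge> 0"
        using t by (intro Henstock_Kurzweil_Integration.integral_nonneg integrable_continuous
            continuous_on_subset[OF continuous_energies(5)] D_nonneg) auto
      then show ?thesis using est[OF t] by linarith
    qed
  qed (rule integrable_const_ivl)
  also have "\<dots> = T * (\<alpha> * (1 + norm A) * K)" using T_pos by simp
  finally show "c * integral (cbox (-r, 0) (r, T)) m \<le> T * (\<alpha> * (1 + norm A) * K)" .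
qed

definition dirichlet :: "real \<Rightarrow> real" where
  "dirichlet r = integral (cbox (-r, 0) (r, T)) (\<lambda>p. (norm (ux p))\<^sup>2 + (norm (ut p))\<^sup>2)"

definition absorbed :: "real \<Rightarrow> real" where
  "absorbed r = integral (cbox (-r, 0) (r, T)) (\<lambda>p. \<bar>grad \<eta> (w p) \<bullet> G (w p)\<bar>)"

text \<open>Two bounds of different weight for one integral. The dissipation controls it with the
  weight \<epsilon>, which is the useful one as \<epsilon> tends to 0; the energy controls it with
  \<epsilon>^2, which matches a data bound \<open>K\<close> growing like 1 + \<epsilon>^2 when
  \<epsilon> is large.\<close>

lemma dirichlet_le:
  assumes c: "c > 0" "c \<le> \<beta> / 6" "c \<le> \<alpha> / 8" "c \<le> \<alpha> * \<mu> / 2"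
    and K: "energy T \<epsilon> w 0 + \<epsilon> * potential_energy R w 0 \<le> K"
  shows "\<epsilon> * (min \<nu> (\<alpha> / 4) * dirichlet r) \<le> \<alpha> * (1 + norm A) * K"
    and "c * (\<epsilon>\<^sup>2 * dirichlet r) \<le> T * (\<alpha> * (1 + norm A) * K)"
    and "absorbed r \<le> \<alpha> * (1 + norm A) * K"
proof -
  let ?B = "cbox (-r, 0) (r, T)"
  let ?d = "\<lambda>p. (norm (ux p))\<^sup>2 + (norm (ut p))\<^sup>2"
  have d: "?d integrable_on ?B" by (intro integrable_continuous continuous_intros continuous_box)
  have D: "D integrable_on ?B" by (intro integrable_continuous continuous_intros continuous_box)
  have m: "m integrable_on ?B" by (intro integrable_continuous continuous_intros continuous_box)
  have "integral ?B (\<lambda>p. (\<epsilon> * min \<nu> (\<alpha> / 4)) * ?d p) \<le> integral ?B D"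
  proof (rule integral_le[OF integrable_on_mult_right[OF d] D])
    fix p
    have "\<epsilon> * (min \<nu> (\<alpha> / 4) * (norm (ux p))\<^sup>2 + min \<nu> (\<alpha> / 4) * (norm (ut p))\<^sup>2)
        \<le> \<epsilon> * (\<nu> * (norm (ux p))\<^sup>2 + \<alpha> / 4 * (norm (ut p))\<^sup>2)"
      using eps_pos by (intro mult_left_mono add_mono mult_right_mono) auto
    then show "\<epsilon> * min \<nu> (\<alpha> / 4) * ?d p \<le> D p" unfolding D_def by (simp add: distrib_left mult.assoc)
  qed
  then show "\<epsilon> * (min \<nu> (\<alpha> / 4) * dirichlet r) \<le> \<alpha> * (1 + norm A) * K"
    using box_estimates(1)[OF c K, of r] by (simp add: dirichlet_def mult.assoc)
  have "integral ?B (\<lambda>p. \<epsilon>\<^sup>2 * ?d p) \<le> integral ?B m"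
    using eps_pos R_props(3)
    by (intro integral_le[OF integrable_on_mult_right[OF d] m]) (simp add: m_def distrib_left)
  then have "c * (\<epsilon>\<^sup>2 * dirichlet r) \<le> c * integral ?B m"
    unfolding dirichlet_def using c(1) by (intro mult_left_mono) auto
  then show "c * (\<epsilon>\<^sup>2 * dirichlet r) \<le> T * (\<alpha> * (1 + norm A) * K)"
    using box_estimates(2)[OF c K, of r] by linarith
  have "absorbed r \<le> integral ?B D"
    unfolding absorbed_def using eps_pos nu_pos alpha_pos
    by (intro integral_le D integrable_continuous continuous_intros continuous_box) (simp add: D_def)
  then show "absorbed r \<le> \<alpha> * (1 + norm A) * K" using box_estimates(1)[OF c K, of r] by linarith
qed

text \<open>The subcharacteristic inequality bounds \<alpha> times the squared norm by a Hessian
  form, and polarization bounds that form by \<alpha>/8 times (|\<xi>| + |A \<xi>|)^2. The factor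
  \<alpha> cancels, so wave speeds are bounded in terms of \<open>A\<close> only.\<close>

lemma jacobian_bound: "norm (jacobian F (at u) *v \<xi>) \<le> (1 + norm A) * norm \<xi>"
proof (rule power2_le_imp_le)
  have lo: "0 \<le> \<xi> \<bullet> (hessian \<eta> u *v \<xi>)" for \<xi>
    by (rule order_trans[OF _ hessian_lower]) (use beta_pos in simp)
  have "\<alpha> * (norm (jacobian F (at u) *v \<xi>))\<^sup>2 \<le> (hessian \<eta> u *v \<xi>) \<bullet> (A *v \<xi>)"
    by (rule order_trans[OF _ subchar[of \<xi> u]]) (use nu_pos in simp)
  also have "\<dots> \<le> \<alpha> / 2 / 4 * (norm \<xi> + norm (A *v \<xi>))\<^sup>2"
    by (rule inner_hessian_le[OF eta_C2 lo hessian_upper])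
  also have "\<dots> \<le> \<alpha> / 2 / 4 * ((1 + norm A) * norm \<xi>)\<^sup>2"
    using alpha_pos norm_matrix_vector_mult_le[of A \<xi>] by (intro mult_left_mono power_mono) (auto simp: algebra_simps)
  also have "\<dots> \<le> \<alpha> * ((1 + norm A) * norm \<xi>)\<^sup>2" using alpha_pos by (intro mult_right_mono) auto
  finally show "(norm (jacobian F (at u) *v \<xi>))\<^sup>2 \<le> ((1 + norm A) * norm \<xi>)\<^sup>2"
    using alpha_pos by (rule mult_left_le_imp_le)
qed simp

end

section \<open>Production of a bounded entropy pair\<close>

locale bounded_entropy = relaxation_entropy T w A F G \<epsilon> \<eta> q R \<alpha> \<beta> \<mu> \<nu>
  for T :: real and w :: "real \<times> real \<Rightarrow> real^'n" and A :: "real^'n^'n"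
    and F G :: "real^'n \<Rightarrow> real^'n" and \<epsilon> :: real and \<eta> q R :: "real^'n \<Rightarrow> real" and \<alpha> \<beta> \<mu> \<nu> :: real +
  fixes \<eta>b qb :: "real^'n \<Rightarrow> real" and C M :: real
  assumes pair_b: "entropy_pair F \<eta>b qb"
    and eta_b: "\<And>v. \<bar>\<eta>b v\<bar> \<le> C" and q_b: "\<And>v. \<bar>qb v\<bar> \<le> C"
    and grad_b: "\<And>v. norm (grad \<eta>b v) \<le> C" and hessian_b: "\<And>v. norm (hessian \<eta>b v) \<le> C"
    and source_b: "\<And>v. \<bar>grad \<eta>b v \<bullet> G v\<bar> \<le> C * (M - grad \<eta> v \<bullet> G v)"
begin

lemma C_nonneg: "C \<ge> 0"
  using eta_b[of 0] by simp

definition production :: "real \<times> real \<Rightarrow> real" where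
  "production p = grad \<eta>b (w p) \<bullet> ut p + grad qb (w p) \<bullet> ux p"

lemmas continuous_b = continuous_entropy[OF pair_b, THEN continuous_on_subset, OF box_sub]

lemma continuous_prod: "continuous_on (cbox (-r, 0) (r, T)) production"
  unfolding production_def[abs_def] by (intro continuous_intros continuous_box continuous_b)

lemma eta_b_C2: "Ck_on 2 UNIV \<eta>b"
  using pair_b by (simp add: entropy_pair_def)

lemma production_pointwise:
  assumes "t \<in> {0..T}"
  shows "dt T (\<eta>b \<circ> w) (x, t) + dx (qb \<circ> w) (x, t) = production (x, t)"
proof -
  have "dt T (\<eta>b \<circ> w) (x, t) = grad \<eta>b (w (x, t)) \<bullet> ut (x, t)"
    unfolding dt_def[of T "\<eta>b \<circ> w"]
    using vector_derivative_within_cbox[of 0 T t "\<lambda>s. \<eta>b (w (x, s))"] T_pos assms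
      entropy_derivatives(1)[OF pair_b assms order_refl, of x] by (simp add: o_def)
  moreover have "dx (qb \<circ> w) (x, t) = grad qb (w (x, t)) \<bullet> ux (x, t)"
    unfolding dx_def[of "qb \<circ> w"]
    using vector_derivative_at[OF entropy_derivatives(2)[OF pair_b assms order_refl, of x UNIV]] by (simp add: o_def)
  ultimately show ?thesis by (simp add: production_def)
qed

text \<open>Test functions vanish off the open strip box, so the integral over the strip is one over
  a compact box, on which the chain rule gives the integrand.\<close>

lemma production_eq:
  assumes "\<phi> \<in> test_functions (strip_box T r)"
  shows "entropy_production T \<eta>b qb w \<phi> = integral (cbox (-r, 0) (r, T)) (\<lambda>p. production p * \<phi> p)"
proof -
  let ?B = "cbox (-r, 0) (r, T)"
  have I: "\<phi> \<in> test_functions (UNIV \<times> {0<..<T})"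
    using assms test_functions_mono[of "strip_box T r" "UNIV \<times> {0<..<T}"] by auto
  have "indicator (UNIV \<times> {0<..<T}) p *\<^sub>R ((dt T (\<eta>b \<circ> w) p + dx (qb \<circ> w) p) * \<phi> p) = indicator ?B p *\<^sub>R (production p * \<phi> p)" for p
  proof (cases "p \<in> strip_box T r")
    case True
    then obtain x t where p: "p = (x, t)" "t \<in> {0<..<T}" "x \<in> {-r<..<r}" by auto
    then show ?thesis using production_pointwise[of t x] by (simp add: indicator_def cbox_Pair_eq)
  next
    case False
    then show ?thesis using test_function_outside(1)[OF assms False] by simp
  qed
  then have "entropy_production T \<eta>b qb w \<phi> = (LINT p|lborel. indicator ?B p *\<^sub>R (production p * \<phi> p))"
    unfolding entropy_production_def regular_distribution_def set_lebesgue_integral_def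
    by (simp only: restrict_apply'[OF I])
  also have "\<dots> = integral ?B (\<lambda>p. production p * \<phi> p)"
    by (intro integral_lborel_eq_box continuous_intros continuous_prod test_function_continuous[OF assms])
  finally show ?thesis .
qed

text \<open>Covers the test functions and their truncations, for which smoothness need not be checked.\<close>

definition admissible :: "real \<Rightarrow> (real \<times> real \<Rightarrow> real) \<Rightarrow> (real \<times> real \<Rightarrow> real) \<Rightarrow> (real \<times> real \<Rightarrow> real) \<Rightarrow> bool" where
  "admissible r \<psi> \<psi>x \<psi>t \<longleftrightarrow>
    (\<forall>x t. ((\<lambda>y. \<psi> (y, t)) has_vector_derivative \<psi>x (x, t)) (at x)) \<and>
    (\<forall>x t. ((\<lambda>s. \<psi> (x, s)) has_vector_derivative \<psi>t (x, t)) (at t)) \<and>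
    continuous_on UNIV \<psi> \<and> continuous_on UNIV \<psi>x \<and> continuous_on UNIV \<psi>t \<and>
    (\<forall>p. p \<notin> strip_box T r \<longrightarrow> \<psi> p = 0)"

text \<open>Integration by parts. The strip box is open, so \<psi> vanishes on all four sides of the
  closed box and no boundary term remains.\<close>

lemma divergence_vanishing:
  assumes ad: "admissible r \<psi> \<psi>x \<psi>t" and r: "r > 0"
    and P: "\<And>x t. t \<in> {0..T} \<Longrightarrow> ((\<lambda>s. P (x, s)) has_vector_derivative Pt (x, t)) (at t within {0..T})"
    and Q: "\<And>x t. t \<in> {0..T} \<Longrightarrow> ((\<lambda>y. Q (y, t)) has_vector_derivative Qx (x, t)) (at x within {-r..r})"
    and c: "continuous_on (cbox (-r, 0) (r, T)) P" "continuous_on (cbox (-r, 0) (r, T)) Q"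
      "continuous_on (cbox (-r, 0) (r, T)) Pt" "continuous_on (cbox (-r, 0) (r, T)) Qx"
  shows "integral (cbox (-r, 0) (r, T)) (\<lambda>p. (Pt p + Qx p) * \<psi> p) =
     - integral (cbox (-r, 0) (r, T)) (\<lambda>p. P p * \<psi>t p + Q p * \<psi>x p)"
proof -
  let ?B = "cbox (-r, 0) (r, T)"
  have C: "continuous_on ?B \<psi>" "continuous_on ?B \<psi>x" "continuous_on ?B \<psi>t"
    using ad unfolding admissible_def by (blast intro: continuous_on_subset[OF _ subset_UNIV])+
  have z: "\<psi> (x, t) = 0" if "t \<le> 0 \<or> t \<ge> T \<or> x \<le> -r \<or> x \<ge> r" for x t
    using ad that unfolding admissible_def by auto
  have dx: "((\<lambda>y. \<psi> (y, t)) has_vector_derivative \<psi>x (x, t)) (at x within X)"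
    and dt: "((\<lambda>s. \<psi> (x, s)) has_vector_derivative \<psi>t (x, t)) (at t within X)" for x t X
    using ad unfolding admissible_def by (blast intro: has_vector_derivative_at_within)+
  have "integral ?B (\<lambda>p. (P p * \<psi>t p + Pt p * \<psi> p) + (Q p * \<psi>x p + Qx p * \<psi> p)) =
      integral {-r..r} (\<lambda>x. P (x, T) * \<psi> (x, T) - P (x, 0) * \<psi> (x, 0))
      + integral {0..T} (\<lambda>s. Q (r, s) * \<psi> (r, s) - Q (-r, s) * \<psi> (-r, s))"
    using r T_pos
    by (intro divergence_box[where P = "\<lambda>p. P p * \<psi> p" and Q = "\<lambda>p. Q p * \<psi> p"] has_vector_derivative_mult P Q dx dt
        continuous_intros c C) auto
  also have "\<dots> = 0" by (simp add: z)
  finally have "integral ?B (\<lambda>p. (Pt p + Qx p) * \<psi> p + (P p * \<psi>t p + Q p * \<psi>x p)) = 0"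
    by (simp add: algebra_simps)
  moreover have "integral ?B (\<lambda>p. (Pt p + Qx p) * \<psi> p + (P p * \<psi>t p + Q p * \<psi>x p)) =
      integral ?B (\<lambda>p. (Pt p + Qx p) * \<psi> p) + integral ?B (\<lambda>p. P p * \<psi>t p + Q p * \<psi>x p)"
    by (intro Henstock_Kurzweil_Integration.integral_add integrable_continuous continuous_intros c C)
  ultimately show ?thesis by linarith
qed

lemma admissible_continuous:
  assumes "admissible r \<psi> \<psi>x \<psi>t"
  shows "continuous_on X \<psi>" "continuous_on X \<psi>x" "continuous_on X \<psi>t"
  using assms unfolding admissible_def by (blast intro: continuous_on_subset[OF _ subset_UNIV])+

text \<open>Both derivatives are moved to \<psi>, where they meet the bounded functions \<eta>b(w)
  and qb(w); the bound is therefore free of \<epsilon> and of the energy.\<close>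

lemma production_negative_order:
  assumes ad: "admissible r \<psi> \<psi>x \<psi>t" and r: "r > 0"
  shows "\<bar>integral (cbox (-r, 0) (r, T)) (\<lambda>p. production p * \<psi> p)\<bar>
    \<le> C * integral (cbox (-r, 0) (r, T)) (\<lambda>p. \<bar>\<psi>t p\<bar> + \<bar>\<psi>x p\<bar>)"
proof -
  let ?B = "cbox (-r, 0) (r, T)"
  note cc = admissible_continuous[OF ad]
  have "integral ?B (\<lambda>p. production p * \<psi> p) = - integral ?B (\<lambda>p. \<eta>b (w p) * \<psi>t p + qb (w p) * \<psi>x p)"
    unfolding production_def
    by (rule divergence_vanishing[OF ad r])
      (use entropy_derivatives[OF pair_b _ order_refl] in blast | intro continuous_intros continuous_box continuous_b)+
  moreover have "norm (integral ?B (\<lambda>p. \<eta>b (w p) * \<psi>t p + qb (w p) * \<psi>x p)) \<le> integral ?B (\<lambda>p. C * (\<bar>\<psi>t p\<bar> + \<bar>\<psi>x p\<bar>))"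
  proof (rule integral_norm_bound_integral)
    show "(\<lambda>p. \<eta>b (w p) * \<psi>t p + qb (w p) * \<psi>x p) integrable_on ?B" "(\<lambda>p. C * (\<bar>\<psi>t p\<bar> + \<bar>\<psi>x p\<bar>)) integrable_on ?B"
      by (intro integrable_continuous continuous_intros continuous_b cc)+
    show "norm (\<eta>b (w p) * \<psi>t p + qb (w p) * \<psi>x p) \<le> C * (\<bar>\<psi>t p\<bar> + \<bar>\<psi>x p\<bar>)" for p
    proof -
      have "norm (\<eta>b (w p) * \<psi>t p + qb (w p) * \<psi>x p) \<le> \<bar>\<eta>b (w p)\<bar> * \<bar>\<psi>t p\<bar> + \<bar>qb (w p)\<bar> * \<bar>\<psi>x p\<bar>"
        using abs_triangle_ineq[of "\<eta>b (w p) * \<psi>t p" "qb (w p) * \<psi>x p"] by (simp add: abs_mult)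
      also have "\<dots> \<le> C * \<bar>\<psi>t p\<bar> + C * \<bar>\<psi>x p\<bar>" by (intro add_mono mult_right_mono eta_b q_b) auto
      finally show ?thesis by (simp add: distrib_left)
    qed
  qed
  ultimately show ?thesis by simp
qed

text \<open>The production is the gradient of \<eta>b paired with \<open>ut\<close> plus the
  Jacobian of \<open>F\<close> applied to \<open>ux\<close>, and that Jacobian is globally bounded.
  This is the estimate for \<epsilon> away from 0.\<close>

lemma production_square_integrable:
  assumes "continuous_on (cbox (-r, 0) (r, T)) \<psi>"
  shows "\<bar>integral (cbox (-r, 0) (r, T)) (\<lambda>p. production p * \<psi> p)\<bar>
    \<le> C * (1 + norm A) * integral (cbox (-r, 0) (r, T)) (\<lambda>p. (norm (ut p) + norm (ux p)) * \<bar>\<psi> p\<bar>)"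
proof -
  let ?B = "cbox (-r, 0) (r, T)"
  have b: "\<bar>production p\<bar> \<le> C * (1 + norm A) * (norm (ut p) + norm (ux p))" for p
  proof -
    have "grad qb (w p) = grad \<eta>b (w p) v* jacobian F (at (w p))" using pair_b by (simp add: entropy_pair_def)
    then have "production p = grad \<eta>b (w p) \<bullet> (ut p + jacobian F (at (w p)) *v ux p)"
      by (simp add: production_def vector_matrix_inner inner_add_right)
    also have "\<bar>\<dots>\<bar> \<le> norm (grad \<eta>b (w p)) * norm (ut p + jacobian F (at (w p)) *v ux p)" by (rule Cauchy_Schwarz_ineq2)
    also have "\<dots> \<le> C * ((1 + norm A) * (norm (ut p) + norm (ux p)))"
    proof (rule mult_mono[OF grad_b])
      have "norm (ut p + jacobian F (at (w p)) *v ux p) \<le> norm (ut p) + (1 + norm A) * norm (ux p)"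
        using norm_triangle_ineq[of "ut p" "jacobian F (at (w p)) *v ux p"] jacobian_bound[of "w p" "ux p"] by linarith
      also have "\<dots> \<le> norm (ut p) + (1 + norm A) * norm (ux p) + norm A * norm (ut p)" by simp
      also have "\<dots> = (1 + norm A) * (norm (ut p) + norm (ux p))" by (simp add: algebra_simps)
      finally show "norm (ut p + jacobian F (at (w p)) *v ux p) \<le> (1 + norm A) * (norm (ut p) + norm (ux p))" .
    qed (use C_nonneg in auto)
    finally show ?thesis by (simp add: mult.assoc)
  qed
  have "norm (integral ?B (\<lambda>p. production p * \<psi> p)) \<le> integral ?B (\<lambda>p. C * (1 + norm A) * ((norm (ut p) + norm (ux p)) * \<bar>\<psi> p\<bar>))"
  proof (rule integral_norm_bound_integral)
    show "norm (production p * \<psi> p) \<le> C * (1 + norm A) * ((norm (ut p) + norm (ux p)) * \<bar>\<psi> p\<bar>)" for p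
      using mult_right_mono[OF b[of p], of "\<bar>\<psi> p\<bar>"] by (simp add: abs_mult mult.assoc)
  qed (intro integrable_continuous continuous_intros continuous_prod continuous_box assms)+
  then show ?thesis by simp
qed

text \<open>The viscous terms of the entropy balance are a divergence minus Hessian terms. The
  source and the Hessian terms, integrable uniformly for small \<epsilon>, meet the supremum of
  \<psi>; the divergence meets the derivatives of \<psi> after integration by parts. The factor
  \<open>2 * r * T\<close> is the area of the box, from the constant \<open>M\<close> in the source
  bound.\<close>

lemma production_measure_bound:
  assumes ad: "admissible r \<psi> \<psi>x \<psi>t" and r: "r > 0" and \<delta>: "\<delta> \<ge> 0" "\<And>p. \<bar>\<psi> p\<bar> \<le> \<delta>"
  shows "\<bar>integral (cbox (-r, 0) (r, T)) (\<lambda>p. production p * \<psi> p)\<bar>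
    \<le> \<delta> * (C * (\<bar>M\<bar> * (2 * r * T) + absorbed r) + C * (1 + norm A) * (\<epsilon> * dirichlet r))
      + C * (1 + norm A) * integral (cbox (-r, 0) (r, T)) (\<lambda>p. \<epsilon> * (norm (ut p) * \<bar>\<psi>t p\<bar> + norm (ux p) * \<bar>\<psi>x p\<bar>))"
proof -
  let ?B = "cbox (-r, 0) (r, T)"
  note cc = admissible_continuous[OF ad]
  let ?g = "\<lambda>p. grad \<eta>b (w p)" and ?H = "\<lambda>p. hessian \<eta>b (w p)"
  let ?P = "\<lambda>p. - (\<epsilon> * (?g p \<bullet> ut p))" and ?Q = "\<lambda>p. \<epsilon> * (?g p \<bullet> (A *v ux p))"
  let ?Pt = "\<lambda>p. - (\<epsilon> * (?g p \<bullet> utt p + (?H p *v ut p) \<bullet> ut p))"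
  let ?Qx = "\<lambda>p. \<epsilon> * (?g p \<bullet> (A *v uxx p) + (?H p *v ux p) \<bullet> (A *v ux p))"
  let ?s = "\<lambda>p. ?g p \<bullet> G (w p) + \<epsilon> * ((?H p *v ut p) \<bullet> ut p) - \<epsilon> * ((?H p *v ux p) \<bullet> (A *v ux p))"
  let ?K = "\<lambda>p. norm (ut p) * \<bar>\<psi>t p\<bar> + norm (ux p) * \<bar>\<psi>x p\<bar>"
  have parts: "integral ?B (\<lambda>p. (?Pt p + ?Qx p) * \<psi> p) = - integral ?B (\<lambda>p. ?P p * \<psi>t p + ?Q p * \<psi>x p)"
  proof (rule divergence_vanishing[OF ad r])
    fix x t assume t: "t \<in> {0..T}"
    show "((\<lambda>s. ?P (x, s)) has_vector_derivative ?Pt (x, t)) (at t within {0..T})"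
      by (intro has_vector_derivative_minus has_vector_derivative_mult_right has_vector_derivative_inner
          has_vector_derivative_hessian_chain eta_b_C2 partials_t[OF t order_refl])
    show "((\<lambda>y. ?Q (y, t)) has_vector_derivative ?Qx (x, t)) (at x within {-r..r})"
      by (intro has_vector_derivative_mult_right has_vector_derivative_inner has_vector_derivative_matrix
          has_vector_derivative_hessian_chain eta_b_C2 partials[OF t])
  qed (intro continuous_intros continuous_on_matrix_vector_mult' continuous_box continuous_b)+
  \<comment> \<open>By the product rule \<open>?Pt + ?Qx\<close> contains the second-derivative
    terms of the balance and the Hessian terms, which \<open>?s\<close> takes back with opposite
    signs.\<close>
  have split: "production p = ?s p + (?Pt p + ?Qx p)" if p: "p \<in> ?B" for p
  proof -
    obtain x t where xt: "p = (x, t)" "t \<in> {0..T}" using p by (cases p) auto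
    show ?thesis unfolding production_def entropy_balance[OF pair_b xt(2,1)] by (simp add: algebra_simps)
  qed
  have "integral ?B (\<lambda>p. production p * \<psi> p) = integral ?B (\<lambda>p. ?s p * \<psi> p + (?Pt p + ?Qx p) * \<psi> p)"
    by (rule Henstock_Kurzweil_Integration.integral_cong) (simp only: split distrib_right)
  also have "\<dots> = integral ?B (\<lambda>p. ?s p * \<psi> p) + integral ?B (\<lambda>p. (?Pt p + ?Qx p) * \<psi> p)"
    by (intro Henstock_Kurzweil_Integration.integral_add integrable_continuous continuous_intros
        continuous_on_matrix_vector_mult' continuous_box continuous_b cc)
  finally have eq: "integral ?B (\<lambda>p. production p * \<psi> p) = integral ?B (\<lambda>p. ?s p * \<psi> p) - integral ?B (\<lambda>p. ?P p * \<psi>t p + ?Q p * \<psi>x p)"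
    unfolding parts by simp
  have Ap: "norm (A *v \<xi>) \<le> (1 + norm A) * norm \<xi>" for \<xi>
    using norm_matrix_vector_mult_le[of A \<xi>] by (simp add: algebra_simps add_increasing)
  have gp: "\<bar>?g p \<bullet> \<xi>\<bar> \<le> C * norm \<xi>" for p \<xi>
    by (rule order_trans[OF Cauchy_Schwarz_ineq2]) (intro mult_right_mono grad_b norm_ge_zero)
  have Hp: "\<bar>(?H p *v \<xi>) \<bullet> \<zeta>\<bar> \<le> C * norm \<xi> * norm \<zeta>" for p \<xi> \<zeta>
    by (rule order_trans[OF Cauchy_Schwarz_ineq2])
      (intro mult_right_mono order_trans[OF norm_matrix_vector_mult_le] hessian_b norm_ge_zero)
  have one: "1 \<le> 1 + norm A" by simp
  let ?d = "\<lambda>p. (norm (ux p))\<^sup>2 + (norm (ut p))\<^sup>2"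
  have s_le: "\<bar>?s p\<bar> \<le> C * (\<bar>M\<bar> + \<bar>grad \<eta> (w p) \<bullet> G (w p)\<bar>) + C * (1 + norm A) * (\<epsilon> * ?d p)" for p
  proof -
    have 1: "\<bar>?g p \<bullet> G (w p)\<bar> \<le> C * (\<bar>M\<bar> + \<bar>grad \<eta> (w p) \<bullet> G (w p)\<bar>)"
      by (rule order_trans[OF source_b]) (intro mult_left_mono C_nonneg, linarith)
    have "\<bar>(?H p *v ut p) \<bullet> ut p\<bar> \<le> C * norm (ut p) * norm (ut p)" by (rule Hp)
    also have "\<dots> = C * 1 * (norm (ut p))\<^sup>2" by (simp add: power2_eq_square)
    also have "\<dots> \<le> C * (1 + norm A) * (norm (ut p))\<^sup>2" by (intro mult_right_mono mult_left_mono one C_nonneg) simp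
    finally have 2: "\<epsilon> * \<bar>(?H p *v ut p) \<bullet> ut p\<bar> \<le> \<epsilon> * (C * (1 + norm A) * (norm (ut p))\<^sup>2)"
      using eps_pos by (intro mult_left_mono) auto
    have "\<bar>(?H p *v ux p) \<bullet> (A *v ux p)\<bar> \<le> C * norm (ux p) * norm (A *v ux p)" by (rule Hp)
    also have "\<dots> \<le> C * norm (ux p) * ((1 + norm A) * norm (ux p))" using C_nonneg by (intro mult_left_mono Ap) simp
    also have "\<dots> = C * (1 + norm A) * (norm (ux p))\<^sup>2" by (simp add: power2_eq_square)
    finally have 3: "\<epsilon> * \<bar>(?H p *v ux p) \<bullet> (A *v ux p)\<bar> \<le> \<epsilon> * (C * (1 + norm A) * (norm (ux p))\<^sup>2)"
      using eps_pos by (intro mult_left_mono) auto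
    have "\<bar>?s p\<bar> \<le> \<bar>?g p \<bullet> G (w p)\<bar> + \<epsilon> * \<bar>(?H p *v ut p) \<bullet> ut p\<bar> + \<epsilon> * \<bar>(?H p *v ux p) \<bullet> (A *v ux p)\<bar>"
      using eps_pos abs_triangle_ineq4[of "?g p \<bullet> G (w p) + \<epsilon> * ((?H p *v ut p) \<bullet> ut p)" "\<epsilon> * ((?H p *v ux p) \<bullet> (A *v ux p))"]
        abs_triangle_ineq[of "?g p \<bullet> G (w p)" "\<epsilon> * ((?H p *v ut p) \<bullet> ut p)"] by (simp add: abs_mult)
    also have "\<dots> \<le> C * (\<bar>M\<bar> + \<bar>grad \<eta> (w p) \<bullet> G (w p)\<bar>) + \<epsilon> * (C * (1 + norm A) * (norm (ut p))\<^sup>2)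
        + \<epsilon> * (C * (1 + norm A) * (norm (ux p))\<^sup>2)" by (intro add_mono 1 2 3)
    finally show ?thesis by (simp add: algebra_simps)
  qed
  have "norm (integral ?B (\<lambda>p. ?s p * \<psi> p)) \<le> integral ?B (\<lambda>p. \<delta> * (C * \<bar>M\<bar> + C * \<bar>grad \<eta> (w p) \<bullet> G (w p)\<bar> + C * (1 + norm A) * \<epsilon> * ?d p))"
  proof (rule integral_norm_bound_integral)
    show "norm (?s p * \<psi> p) \<le> \<delta> * (C * \<bar>M\<bar> + C * \<bar>grad \<eta> (w p) \<bullet> G (w p)\<bar> + C * (1 + norm A) * \<epsilon> * ?d p)" for p
    proof -
      have "norm (?s p * \<psi> p) = \<bar>?s p\<bar> * \<bar>\<psi> p\<bar>" by (simp add: abs_mult)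
      also have "\<dots> \<le> \<bar>?s p\<bar> * \<delta>" by (intro mult_left_mono \<delta>(2)) simp
      also have "\<dots> \<le> (C * (\<bar>M\<bar> + \<bar>grad \<eta> (w p) \<bullet> G (w p)\<bar>) + C * (1 + norm A) * (\<epsilon> * ?d p)) * \<delta>"
        by (intro mult_right_mono s_le \<delta>(1))
      finally show ?thesis by (simp add: algebra_simps)
    qed
  qed (intro integrable_continuous continuous_intros continuous_on_matrix_vector_mult' continuous_box continuous_b cc)+
  also have "\<dots> = \<delta> * (C * \<bar>M\<bar> * (2 * r * T) + C * absorbed r + C * (1 + norm A) * \<epsilon> * dirichlet r)"
  proof -
    have i: "(\<lambda>p. C * \<bar>grad \<eta> (w p) \<bullet> G (w p)\<bar>) integrable_on ?B" "(\<lambda>p. C * (1 + norm A) * \<epsilon> * ?d p) integrable_on ?B"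
      by (intro integrable_continuous continuous_intros continuous_box)+
    have vol: "measure lborel ?B = 2 * r * T" using r T_pos by (simp add: content_Pair)
    show ?thesis
      unfolding integral_mult_right Henstock_Kurzweil_Integration.integral_add[OF integrable_add[OF integrable_const i(1)] i(2)]
        Henstock_Kurzweil_Integration.integral_add[OF integrable_const i(1)] absorbed_def dirichlet_def
      using vol by (simp add: algebra_simps)
  qed
  finally have I1: "\<bar>integral ?B (\<lambda>p. ?s p * \<psi> p)\<bar> \<le> \<delta> * (C * \<bar>M\<bar> * (2 * r * T) + C * absorbed r + C * (1 + norm A) * \<epsilon> * dirichlet r)"
    by simp
  have "norm (integral ?B (\<lambda>p. ?P p * \<psi>t p + ?Q p * \<psi>x p)) \<le> integral ?B (\<lambda>p. C * (1 + norm A) * (\<epsilon> * ?K p))"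
  proof (rule integral_norm_bound_integral)
    show "norm (?P p * \<psi>t p + ?Q p * \<psi>x p) \<le> C * (1 + norm A) * (\<epsilon> * ?K p)" for p
    proof -
      have 1: "\<bar>?g p \<bullet> ut p\<bar> \<le> C * ((1 + norm A) * norm (ut p))"
        by (rule order_trans[OF gp]) (intro mult_left_mono C_nonneg, simp add: algebra_simps)
      have 2: "\<bar>?g p \<bullet> (A *v ux p)\<bar> \<le> C * ((1 + norm A) * norm (ux p))"
        by (rule order_trans[OF gp]) (intro mult_left_mono C_nonneg Ap)
      have "norm (?P p * \<psi>t p + ?Q p * \<psi>x p) \<le> \<epsilon> * (\<bar>?g p \<bullet> ut p\<bar> * \<bar>\<psi>t p\<bar>) + \<epsilon> * (\<bar>?g p \<bullet> (A *v ux p)\<bar> * \<bar>\<psi>x p\<bar>)"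
        using abs_triangle_ineq[of "?P p * \<psi>t p" "?Q p * \<psi>x p"] eps_pos by (simp add: abs_mult mult.assoc)
      also have "\<dots> \<le> \<epsilon> * (C * ((1 + norm A) * norm (ut p)) * \<bar>\<psi>t p\<bar>) + \<epsilon> * (C * ((1 + norm A) * norm (ux p)) * \<bar>\<psi>x p\<bar>)"
        using eps_pos by (intro add_mono mult_left_mono mult_right_mono 1 2) auto
      finally show ?thesis by (simp add: algebra_simps)
    qed
  qed (intro integrable_continuous continuous_intros continuous_on_matrix_vector_mult' continuous_box continuous_b cc)+
  then have I2: "\<bar>integral ?B (\<lambda>p. ?P p * \<psi>t p + ?Q p * \<psi>x p)\<bar> \<le> C * (1 + norm A) * integral ?B (\<lambda>p. \<epsilon> * ?K p)"
    by simp
  show ?thesis unfolding eq using I1 I2 by (simp add: algebra_simps)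
qed

end

section \<open>Choice of parameters\<close>

lemma small_factor:
  assumes "a \<ge> 0" "\<tau> > 0"
  obtains x :: real where "x > 0" "x \<le> 1" "a * x \<le> \<tau>"
proof (rule that[of "min 1 (\<tau> / (a + 1))"])
  have "a * min 1 (\<tau> / (a + 1)) \<le> a * (\<tau> / (a + 1))" using assms by (intro mult_left_mono) auto
  also have "\<dots> \<le> \<tau>" using assms by (simp add: field_simps)
  finally show "a * min 1 (\<tau> / (a + 1)) \<le> \<tau>" .
qed (use assms in auto)

text \<open>The order of the choices: first the weights in Young's inequality and the threshold \<open>\<epsilon>\<^sub>0\<close>, then the
  truncation height \<open>\<delta>\<close>, and last the \<open>L\<^sup>2\<close>-size \<open>\<kappa>\<close> of the test functions.\<close>

lemma modulus_parameters:
  fixes C L Q K1 \<tau> :: real and K2 :: "real \<Rightarrow> real"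
  assumes "C \<ge> 0" "L \<ge> 0" "Q \<ge> 0" "K1 \<ge> 0" "\<And>e. e > 0 \<Longrightarrow> K2 e \<ge> 0" "\<tau> > 0"
  obtains e0 \<kappa> \<delta> \<theta> \<theta>1 \<theta>2 where "e0 > 0" "e0 \<le> 1" "\<kappa> > 0" "\<delta> > 0" "\<theta> > 0" "\<theta>1 > 0" "\<theta>2 > 0"
    "C / \<delta> * (\<kappa> / \<theta> + 2 * \<theta>) + \<delta> * Q + L * (e0 * K1 / (2 * \<theta>1) + 2 * \<theta>1) \<le> \<tau>"
    "L * (\<theta>2 / 2 * K2 e0 + \<kappa> / \<theta>2) \<le> \<tau>"
proof -
  \<comment> \<open>The first inequality has five summands to be made small: those with \<kappa>,
    \<theta>, \<delta>, \<open>e0\<close> and \<open>\<theta>1\<close>. The second has two.\<close>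
  have t5: "\<tau> / 5 > 0" using assms by simp
  obtain \<theta>1 where \<theta>1: "\<theta>1 > 0" "2 * L * \<theta>1 \<le> \<tau> / 5"
    using small_factor[of "2 * L", OF _ t5] assms by auto
  obtain e0 where e0: "e0 > 0" "e0 \<le> 1" "L * K1 / (2 * \<theta>1) * e0 \<le> \<tau> / 5"
    using small_factor[of "L * K1 / (2 * \<theta>1)", OF _ t5] assms \<theta>1 by auto
  obtain \<delta> where \<delta>: "\<delta> > 0" "Q * \<delta> \<le> \<tau> / 5" using small_factor[of Q, OF _ t5] assms by auto
  obtain \<theta> where \<theta>: "\<theta> > 0" "2 * C / \<delta> * \<theta> \<le> \<tau> / 5" using small_factor[of "2 * C / \<delta>", OF _ t5] assms \<delta> by auto
  obtain \<theta>2 where \<theta>2: "\<theta>2 > 0" "L * K2 e0 / 2 * \<theta>2 \<le> \<tau> / 5"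
    using small_factor[of "L * K2 e0 / 2", OF _ t5] assms(2) assms(5)[OF e0(1)] by auto
  obtain \<kappa>1 where k1: "\<kappa>1 > 0" "C / (\<delta> * \<theta>) * \<kappa>1 \<le> \<tau> / 5"
    using small_factor[of "C / (\<delta> * \<theta>)", OF _ t5] assms \<delta> \<theta> by auto
  obtain \<kappa>2 where k2: "\<kappa>2 > 0" "L / \<theta>2 * \<kappa>2 \<le> \<tau> / 5"
    using small_factor[of "L / \<theta>2", OF _ t5] assms \<theta>2 by auto
  define \<kappa> where "\<kappa> = min \<kappa>1 \<kappa>2"
  have "C / (\<delta> * \<theta>) * \<kappa> \<le> C / (\<delta> * \<theta>) * \<kappa>1" using assms(1) \<delta>(1) \<theta>(1) by (intro mult_left_mono) (auto simp: \<kappa>_def)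
  then have k1': "C / (\<delta> * \<theta>) * \<kappa> \<le> \<tau> / 5" using k1 by linarith
  have "L / \<theta>2 * \<kappa> \<le> L / \<theta>2 * \<kappa>2" using assms(2) \<theta>2(1) by (intro mult_left_mono) (auto simp: \<kappa>_def)
  then have k2': "L / \<theta>2 * \<kappa> \<le> \<tau> / 5" using k2 by linarith
  have "C / \<delta> * (\<kappa> / \<theta> + 2 * \<theta>) + \<delta> * Q + L * (e0 * K1 / (2 * \<theta>1) + 2 * \<theta>1)
      = C / (\<delta> * \<theta>) * \<kappa> + 2 * C / \<delta> * \<theta> + Q * \<delta> + (L * K1 / (2 * \<theta>1) * e0 + 2 * L * \<theta>1)"
    by (simp add: distrib_left mult_ac)
  also have "\<dots> \<le> \<tau>" using k1' \<theta>(2) \<delta>(2) e0(3) \<theta>1(2) by linarith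
  finally have 1: "C / \<delta> * (\<kappa> / \<theta> + 2 * \<theta>) + \<delta> * Q + L * (e0 * K1 / (2 * \<theta>1) + 2 * \<theta>1) \<le> \<tau>" .
  have "L * (\<theta>2 / 2 * K2 e0 + \<kappa> / \<theta>2) = L * K2 e0 / 2 * \<theta>2 + L / \<theta>2 * \<kappa>" by (simp add: distrib_left mult_ac)
  also have "\<dots> \<le> \<tau>" using \<theta>2(2) k2' assms(6) by linarith
  finally have 2: "L * (\<theta>2 / 2 * K2 e0 + \<kappa> / \<theta>2) \<le> \<tau>" .
  show ?thesis by (rule that[OF e0(1,2) _ \<delta>(1) \<theta>(1) \<theta>1(1) \<theta>2(1) 1 2]) (use k1 k2 in \<open>simp add: \<kappa>_def\<close>)
qed

lemma integral_le_add:
  fixes f :: "'a::euclidean_space \<Rightarrow> real"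
  assumes "\<And>p. f p \<le> a * g p + b * h p" "continuous_on (cbox x y) f" "continuous_on (cbox x y) g" "continuous_on (cbox x y) h"
  shows "integral (cbox x y) f \<le> a * integral (cbox x y) g + b * integral (cbox x y) h"
proof -
  have i: "g integrable_on cbox x y" "h integrable_on cbox x y" by (intro integrable_continuous assms)+
  have "integral (cbox x y) f \<le> integral (cbox x y) (\<lambda>p. a * g p + b * h p)"
    by (intro integral_le integrable_continuous continuous_intros assms)
  also have "\<dots> = a * integral (cbox x y) g + b * integral (cbox x y) h"
    using Henstock_Kurzweil_Integration.integral_add[OF integrable_on_mult_right[OF i(1)] integrable_on_mult_right[OF i(2)]] by simp
  finally show ?thesis .
qed

section \<open>Estimates of the production on test functions\<close>

context bounded_entropy
begin

lemma admissible_test: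
  assumes "\<phi> \<in> test_functions (strip_box T r)"
  shows "admissible r \<phi> (partial_x \<phi>) (partial_t \<phi>)"
  unfolding admissible_def
  using test_function_partial_x[OF assms] test_function_partial_t[OF assms] test_function_continuous[OF assms]
    test_function_derivative_continuous[OF assms] test_function_outside(1)[OF assms] by blast

text \<open>The sine truncates without kinks, so the classical chain rule applies; because it is 0
  at 0, truncation and remainder vanish wherever \<phi> does, and its derivative 1 at 0 makes the
  gradient of the remainder small where \<phi> is.\<close>

lemma admissible_truncation:
  assumes "\<phi> \<in> test_functions (strip_box T r)" and "\<delta> > 0"
  shows "admissible r (\<lambda>p. \<delta> * sin (\<phi> p / \<delta>)) (\<lambda>p. cos (\<phi> p / \<delta>) * partial_x \<phi> p) (\<lambda>p. cos (\<phi> p / \<delta>) * partial_t \<phi> p)"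
    and "admissible r (\<lambda>p. \<phi> p - \<delta> * sin (\<phi> p / \<delta>)) (\<lambda>p. (1 - cos (\<phi> p / \<delta>)) * partial_x \<phi> p) (\<lambda>p. (1 - cos (\<phi> p / \<delta>)) * partial_t \<phi> p)"
proof -
  have sin: "((\<lambda>y. \<delta> * sin (f y / \<delta>)) has_vector_derivative cos (f x / \<delta>) * f') (at x)"
    if "(f has_vector_derivative f') (at x)" for f f' and x :: real
    using that assms(2) unfolding has_real_derivative_iff_has_vector_derivative[symmetric]
    by (auto intro!: derivative_eq_intros)
  have dif: "((\<lambda>y. f y - \<delta> * sin (f y / \<delta>)) has_vector_derivative (1 - cos (f x / \<delta>)) * f') (at x)"
    if "(f has_vector_derivative f') (at x)" for f f' and x :: real
    using has_vector_derivative_diff[OF that sin[OF that]] by (simp add: algebra_simps)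
  have d: "\<delta> \<noteq> 0" using assms(2) by simp
  note c = test_function_continuous[OF assms(1)] test_function_derivative_continuous[OF assms(1)]
  show "admissible r (\<lambda>p. \<delta> * sin (\<phi> p / \<delta>)) (\<lambda>p. cos (\<phi> p / \<delta>) * partial_x \<phi> p) (\<lambda>p. cos (\<phi> p / \<delta>) * partial_t \<phi> p)"
    unfolding admissible_def
    by (intro conjI allI impI sin test_function_partial_x[OF assms(1)] test_function_partial_t[OF assms(1)]
        continuous_intros c) (simp_all add: d test_function_outside(1)[OF assms(1)])
  show "admissible r (\<lambda>p. \<phi> p - \<delta> * sin (\<phi> p / \<delta>)) (\<lambda>p. (1 - cos (\<phi> p / \<delta>)) * partial_x \<phi> p) (\<lambda>p. (1 - cos (\<phi> p / \<delta>)) * partial_t \<phi> p)"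
    unfolding admissible_def
    by (intro conjI allI impI dif test_function_partial_x[OF assms(1)] test_function_partial_t[OF assms(1)]
        continuous_intros c) (simp_all add: d test_function_outside(1)[OF assms(1)])
qed

lemma test_gradient_le:
  assumes "\<phi> \<in> test_functions (strip_box T r)"
  shows "integral (cbox (-r, 0) (r, T)) (\<lambda>p. (partial_x \<phi> p)\<^sup>2 + (partial_t \<phi> p)\<^sup>2) \<le> (H1_norm \<phi>)\<^sup>2"
proof -
  have sub: "strip_box T r \<subseteq> cbox (-r, 0) (r, T)" by (rule strip_box_subset)
  show ?thesis
    unfolding H1_norm_square[OF assms sub]
    by (intro integral_le integrable_continuous continuous_intros test_function_continuous[OF assms]
        test_function_derivative_continuous[OF assms]) simp
qed

lemma production_linear: "linear_on_tests T (entropy_production T \<eta>b qb w)"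
  unfolding linear_on_tests_def
proof (intro ballI allI)
  fix \<phi> \<psi> a b
  assume \<phi>: "\<phi> \<in> test_functions (UNIV \<times> {0<..<T})" and \<psi>: "\<psi> \<in> test_functions (UNIV \<times> {0<..<T})"
  obtain r1 where r1: "\<phi> \<in> test_functions (strip_box T r1)" by (rule test_function_strip_box[OF \<phi>])
  obtain r2 where r2: "\<psi> \<in> test_functions (strip_box T r2)" by (rule test_function_strip_box[OF \<psi>])
  define r where "r = max r1 r2"
  have "strip_box T r1 \<subseteq> strip_box T r" "strip_box T r2 \<subseteq> strip_box T r" by (auto simp: r_def)
  then have tf: "\<phi> \<in> test_functions (strip_box T r)" "\<psi> \<in> test_functions (strip_box T r)"
    using r1 r2 test_functions_mono by blast+
  let ?B = "cbox (-r, 0) (r, T)"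
  have i: "(\<lambda>p. production p * \<phi> p) integrable_on ?B" "(\<lambda>p. production p * \<psi> p) integrable_on ?B"
    by (intro integrable_continuous continuous_intros continuous_prod test_function_continuous[OF tf(1)]
        test_function_continuous[OF tf(2)])+
  have "entropy_production T \<eta>b qb w (\<lambda>p. a * \<phi> p + b * \<psi> p) = integral ?B (\<lambda>p. a * (production p * \<phi> p) + b * (production p * \<psi> p))"
    unfolding production_eq[OF test_functions_combination[OF tf]] by (simp add: algebra_simps)
  also have "\<dots> = a * integral ?B (\<lambda>p. production p * \<phi> p) + b * integral ?B (\<lambda>p. production p * \<psi> p)"
    using Henstock_Kurzweil_Integration.integral_add[OF integrable_on_mult_right[OF i(1)] integrable_on_mult_right[OF i(2)]] by simp
  finally show "entropy_production T \<eta>b qb w (\<lambda>p. a * \<phi> p + b * \<psi> p) =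
      a * entropy_production T \<eta>b qb w \<phi> + b * entropy_production T \<eta>b qb w \<psi>"
    unfolding production_eq[OF tf(1)] production_eq[OF tf(2)] .
qed

text \<open>Young's inequality with a free weight \<theta> in place of Cauchy-Schwarz. The choice of
  \<theta> as the H^1 norm of \<phi> makes both terms linear in that norm, and nothing in the bound
  depends on \<epsilon>.\<close>

lemma production_bounded:
  assumes tf: "\<phi> \<in> test_functions (strip_box T r)" and r: "r > 0"
  shows "\<bar>entropy_production T \<eta>b qb w \<phi>\<bar> \<le> C * (2 * r * T + 1) * H1_norm \<phi>"
proof -
  let ?B = "cbox (-r, 0) (r, T)"
  let ?E = "\<lambda>p. (partial_x \<phi> p)\<^sup>2 + (partial_t \<phi> p)\<^sup>2"
  note c = test_function_continuous[OF tf] test_function_derivative_continuous[OF tf]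
  have vol: "integral ?B (\<lambda>p. 1 :: real) = 2 * r * T" using r T_pos by (simp add: content_Pair)
  have b: "\<bar>entropy_production T \<eta>b qb w \<phi>\<bar> \<le> C * (\<theta> * (2 * r * T) + (H1_norm \<phi>)\<^sup>2 / \<theta>)" if \<theta>: "\<theta> > 0" for \<theta>
  proof -
    have pt: "\<bar>partial_t \<phi> p\<bar> + \<bar>partial_x \<phi> p\<bar> \<le> \<theta> * 1 + 1 / \<theta> * ?E p" for p
    proof -
      have "\<bar>partial_t \<phi> p\<bar> + \<bar>partial_x \<phi> p\<bar> \<le> \<theta> + ?E p / (2 * \<theta>)"
        using young_abs[OF \<theta>, of 1 "partial_t \<phi> p"] young_abs[OF \<theta>, of 1 "partial_x \<phi> p"]
        by (simp add: add_divide_distrib)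
      also have "\<dots> \<le> \<theta> * 1 + 1 / \<theta> * ?E p"
        using \<theta> by (simp add: divide_right_mono frac_le)
      finally show ?thesis .
    qed
    have "integral ?B (\<lambda>p. \<bar>partial_t \<phi> p\<bar> + \<bar>partial_x \<phi> p\<bar>) \<le> \<theta> * integral ?B (\<lambda>p. 1) + 1 / \<theta> * integral ?B ?E"
      by (rule integral_le_add[OF pt]) (intro continuous_intros c)+
    also have "\<dots> \<le> \<theta> * (2 * r * T) + 1 / \<theta> * (H1_norm \<phi>)\<^sup>2"
      unfolding vol using \<theta> test_gradient_le[OF tf] by (intro add_left_mono mult_left_mono) auto
    finally have "integral ?B (\<lambda>p. \<bar>partial_t \<phi> p\<bar> + \<bar>partial_x \<phi> p\<bar>) \<le> \<theta> * (2 * r * T) + (H1_norm \<phi>)\<^sup>2 / \<theta>" by simp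
    then show ?thesis
      unfolding production_eq[OF tf]
      by (rule order_trans[OF production_negative_order[OF admissible_test[OF tf] r] mult_left_mono[OF _ C_nonneg]])
  qed
  show ?thesis
  proof (cases "H1_norm \<phi> = 0")
    \<comment> \<open>The norm itself is not an allowed weight here, so \<theta> is made arbitrarily
      small instead.\<close>
    case True
    have "\<bar>entropy_production T \<eta>b qb w \<phi>\<bar> \<le> 0 + \<tau>" if \<tau>: "\<tau> > 0" for \<tau>
    proof -
      have "C * (2 * r * T) \<ge> 0" using C_nonneg r T_pos by simp
      then obtain \<theta> where "\<theta> > 0" "C * (2 * r * T) * \<theta> \<le> \<tau>" by (rule small_factor[OF _ \<tau>])
      then show ?thesis using b[of \<theta>] by (simp add: True mult_ac)
    qed
    then have "\<bar>entropy_production T \<eta>b qb w \<phi>\<bar> \<le> 0" by (rule field_le_epsilon)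
    then show ?thesis by (simp add: True)
  next
    case False
    then have "H1_norm \<phi> > 0" using H1_norm_nonneg[of \<phi>] by simp
    with b[OF this] show ?thesis by (simp add: power2_eq_square algebra_simps)
  qed
qed

text \<open>The first summand is the remainder of the truncation against the bounded \<eta>b(w) and
  qb(w), the second the truncation, of height at most \<delta>, against the integrable part, the
  third the viscous fluxes against its gradient. The terms \<open>2 * \<theta>\<close> and
  \<open>2 * \<theta>1\<close> come from the bound 4 on the gradient energy of \<phi>.\<close>

lemma production_small_eps:
  assumes tf: "\<phi> \<in> test_functions (strip_box T r)" and r: "r > 0" and H: "H1_norm \<phi> \<le> 2"
    and \<kappa>: "integral (cbox (-r, 0) (r, T)) (\<lambda>p. (\<phi> p)\<^sup>2) \<le> \<kappa>"
    and pos: "\<delta> > 0" "\<theta> > 0" "\<theta>1 > 0"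
  shows "\<bar>entropy_production T \<eta>b qb w \<phi>\<bar> \<le> C / \<delta> * (\<kappa> / \<theta> + 2 * \<theta>)
    + \<delta> * (C * (\<bar>M\<bar> * (2 * r * T) + absorbed r) + C * (1 + norm A) * (\<epsilon> * dirichlet r))
    + C * (1 + norm A) * (\<epsilon>\<^sup>2 * dirichlet r / (2 * \<theta>1) + 2 * \<theta>1)"
proof -
  let ?B = "cbox (-r, 0) (r, T)"
  let ?E = "\<lambda>p. (partial_x \<phi> p)\<^sup>2 + (partial_t \<phi> p)\<^sup>2"
  let ?s = "\<lambda>p. \<delta> * sin (\<phi> p / \<delta>)"
  note c = test_function_continuous[OF tf] test_function_derivative_continuous[OF tf]
  have d0: "\<forall>p\<in>?B. \<delta> \<noteq> 0" using pos by simp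
  have "(H1_norm \<phi>)\<^sup>2 \<le> 2\<^sup>2" using H H1_norm_nonneg by (intro power_mono)
  then have E: "integral ?B ?E \<le> 4" using test_gradient_le[OF tf] by simp
  have "entropy_production T \<eta>b qb w \<phi> = integral ?B (\<lambda>p. production p * (\<phi> p - ?s p) + production p * ?s p)"
    unfolding production_eq[OF tf] by (simp add: algebra_simps)
  also have "\<dots> = integral ?B (\<lambda>p. production p * (\<phi> p - ?s p)) + integral ?B (\<lambda>p. production p * ?s p)"
    by (intro Henstock_Kurzweil_Integration.integral_add integrable_continuous continuous_intros continuous_prod c d0)
  finally have split: "\<bar>entropy_production T \<eta>b qb w \<phi>\<bar> \<le>
      \<bar>integral ?B (\<lambda>p. production p * (\<phi> p - ?s p))\<bar> + \<bar>integral ?B (\<lambda>p. production p * ?s p)\<bar>" by linarith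
  have cos_le: "\<bar>(1 - cos (\<phi> p / \<delta>)) * z\<bar> \<le> (\<theta> / 2 * z\<^sup>2 + (\<phi> p)\<^sup>2 / (2 * \<theta>)) / \<delta>" for p z
  proof -
    have "\<bar>(1 - cos (\<phi> p / \<delta>)) * z\<bar> \<le> \<bar>\<phi> p / \<delta>\<bar> * \<bar>z\<bar>"
      unfolding abs_mult by (intro mult_right_mono one_minus_cos_le) simp
    also have "\<dots> = \<bar>z * \<phi> p\<bar> / \<delta>" using pos by (simp add: abs_mult mult.commute)
    also have "\<dots> \<le> (\<theta> / 2 * z\<^sup>2 + (\<phi> p)\<^sup>2 / (2 * \<theta>)) / \<delta>" using pos by (intro divide_right_mono young_abs) auto
    finally show ?thesis .
  qed
  have 1: "\<bar>(1 - cos (\<phi> p / \<delta>)) * partial_t \<phi> p\<bar> + \<bar>(1 - cos (\<phi> p / \<delta>)) * partial_x \<phi> p\<bar>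
      \<le> (1 / (\<delta> * \<theta>)) * (\<phi> p)\<^sup>2 + \<theta> / (2 * \<delta>) * ?E p" for p
  proof -
    have "(\<theta> / 2 * (partial_t \<phi> p)\<^sup>2 + (\<phi> p)\<^sup>2 / (2 * \<theta>)) / \<delta> + (\<theta> / 2 * (partial_x \<phi> p)\<^sup>2 + (\<phi> p)\<^sup>2 / (2 * \<theta>)) / \<delta>
        = (1 / (\<delta> * \<theta>)) * (\<phi> p)\<^sup>2 + \<theta> / (2 * \<delta>) * ?E p"
      using pos by (simp add: field_simps)
    then show ?thesis using cos_le[of p "partial_t \<phi> p"] cos_le[of p "partial_x \<phi> p"] by linarith
  qed
  have "integral ?B (\<lambda>p. \<bar>(1 - cos (\<phi> p / \<delta>)) * partial_t \<phi> p\<bar> + \<bar>(1 - cos (\<phi> p / \<delta>)) * partial_x \<phi> p\<bar>)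
      \<le> (1 / (\<delta> * \<theta>)) * integral ?B (\<lambda>p. (\<phi> p)\<^sup>2) + \<theta> / (2 * \<delta>) * integral ?B ?E"
    by (rule integral_le_add[OF 1]) (intro continuous_intros c d0)+
  also have "\<dots> \<le> (1 / (\<delta> * \<theta>)) * \<kappa> + \<theta> / (2 * \<delta>) * 4"
    using pos by (intro add_mono mult_left_mono \<kappa> E) auto
  also have "\<dots> = (\<kappa> / \<theta> + 2 * \<theta>) / \<delta>" using pos by (simp add: add_divide_distrib mult.commute)
  finally have "\<bar>integral ?B (\<lambda>p. production p * (\<phi> p - ?s p))\<bar> \<le> C * ((\<kappa> / \<theta> + 2 * \<theta>) / \<delta>)"
    by (rule order_trans[OF production_negative_order[OF admissible_truncation(2)[OF tf pos(1)] r] mult_left_mono[OF _ C_nonneg]])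
  then have I1: "\<bar>integral ?B (\<lambda>p. production p * (\<phi> p - ?s p))\<bar> \<le> C / \<delta> * (\<kappa> / \<theta> + 2 * \<theta>)" by simp
  have 2: "\<epsilon> * (norm (ut p) * \<bar>cos (\<phi> p / \<delta>) * partial_t \<phi> p\<bar> + norm (ux p) * \<bar>cos (\<phi> p / \<delta>) * partial_x \<phi> p\<bar>)
      \<le> \<theta>1 / 2 * ?E p + \<epsilon>\<^sup>2 / (2 * \<theta>1) * ((norm (ux p))\<^sup>2 + (norm (ut p))\<^sup>2)" for p
  proof -
    have cz: "n * \<bar>cos (\<phi> p / \<delta>) * z\<bar> \<le> n * \<bar>z\<bar>" if "n \<ge> 0" for n z :: real
    proof (rule mult_left_mono[OF _ that])
      show "\<bar>cos (\<phi> p / \<delta>) * z\<bar> \<le> \<bar>z\<bar>"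
        unfolding abs_mult by (rule order_trans[OF mult_right_mono[OF abs_cos_le_one]]) auto
    qed
    have "\<epsilon> * (norm (ut p) * \<bar>cos (\<phi> p / \<delta>) * partial_t \<phi> p\<bar> + norm (ux p) * \<bar>cos (\<phi> p / \<delta>) * partial_x \<phi> p\<bar>)
        \<le> \<epsilon> * (norm (ut p) * \<bar>partial_t \<phi> p\<bar> + norm (ux p) * \<bar>partial_x \<phi> p\<bar>)"
      using eps_pos by (intro mult_left_mono add_mono cz) auto
    also have "\<dots> = \<bar>partial_t \<phi> p * (\<epsilon> * norm (ut p))\<bar> + \<bar>partial_x \<phi> p * (\<epsilon> * norm (ux p))\<bar>"
      using eps_pos by (simp add: abs_mult algebra_simps)
    also have "\<dots> \<le> (\<theta>1 / 2 * (partial_t \<phi> p)\<^sup>2 + (\<epsilon> * norm (ut p))\<^sup>2 / (2 * \<theta>1)) + (\<theta>1 / 2 * (partial_x \<phi> p)\<^sup>2 + (\<epsilon> * norm (ux p))\<^sup>2 / (2 * \<theta>1))"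
      by (intro add_mono young_abs pos)
    also have "\<dots> = \<theta>1 / 2 * ?E p + \<epsilon>\<^sup>2 / (2 * \<theta>1) * ((norm (ux p))\<^sup>2 + (norm (ut p))\<^sup>2)"
      by (simp add: power_mult_distrib add_divide_distrib distrib_left)
    finally show ?thesis .
  qed
  have "integral ?B (\<lambda>p. \<epsilon> * (norm (ut p) * \<bar>cos (\<phi> p / \<delta>) * partial_t \<phi> p\<bar> + norm (ux p) * \<bar>cos (\<phi> p / \<delta>) * partial_x \<phi> p\<bar>))
      \<le> \<theta>1 / 2 * integral ?B ?E + \<epsilon>\<^sup>2 / (2 * \<theta>1) * dirichlet r"
    unfolding dirichlet_def by (rule integral_le_add[OF 2]) (intro continuous_intros c d0 continuous_box)+
  also have "\<dots> \<le> \<theta>1 / 2 * 4 + \<epsilon>\<^sup>2 / (2 * \<theta>1) * dirichlet r" using pos E by (intro add_right_mono mult_left_mono) auto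
  also have "\<dots> = \<epsilon>\<^sup>2 * dirichlet r / (2 * \<theta>1) + 2 * \<theta>1" by simp
  finally have I2: "C * (1 + norm A) * integral ?B (\<lambda>p. \<epsilon> * (norm (ut p) * \<bar>cos (\<phi> p / \<delta>) * partial_t \<phi> p\<bar> + norm (ux p) * \<bar>cos (\<phi> p / \<delta>) * partial_x \<phi> p\<bar>))
      \<le> C * (1 + norm A) * (\<epsilon>\<^sup>2 * dirichlet r / (2 * \<theta>1) + 2 * \<theta>1)"
    using C_nonneg by (intro mult_left_mono) auto
  have sb: "\<bar>?s p\<bar> \<le> \<delta>" for p using pos(1) by (simp add: abs_mult mult_le_cancel_left1)
  show ?thesis
    using split I1 I2 production_measure_bound[OF admissible_truncation(1)[OF tf pos(1)] r less_imp_le[OF pos(1)] sb] by linarith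
qed

text \<open>The production is square integrable with norm controlled by \<open>dirichlet\<close>, so
  it can be paired with \<phi> in L^2, and smallness of \<phi> there suffices.\<close>

lemma production_large_eps:
  assumes tf: "\<phi> \<in> test_functions (strip_box T r)"
    and \<kappa>: "integral (cbox (-r, 0) (r, T)) (\<lambda>p. (\<phi> p)\<^sup>2) \<le> \<kappa>" and pos: "\<theta> > 0"
  shows "\<bar>entropy_production T \<eta>b qb w \<phi>\<bar> \<le> C * (1 + norm A) * (\<theta> / 2 * dirichlet r + \<kappa> / \<theta>)"
proof -
  let ?B = "cbox (-r, 0) (r, T)"
  note c = test_function_continuous[OF tf]
  have 1: "(norm (ut p) + norm (ux p)) * \<bar>\<phi> p\<bar> \<le> \<theta> / 2 * ((norm (ux p))\<^sup>2 + (norm (ut p))\<^sup>2) + 1 / \<theta> * (\<phi> p)\<^sup>2" for p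
    using young_abs[OF pos, of "norm (ut p)" "\<phi> p"] young_abs[OF pos, of "norm (ux p)" "\<phi> p"]
    by (simp add: abs_mult algebra_simps)
  have "integral ?B (\<lambda>p. (norm (ut p) + norm (ux p)) * \<bar>\<phi> p\<bar>) \<le> \<theta> / 2 * dirichlet r + 1 / \<theta> * integral ?B (\<lambda>p. (\<phi> p)\<^sup>2)"
    unfolding dirichlet_def by (rule integral_le_add[OF 1]) (intro continuous_intros c continuous_box)+
  also have "\<dots> \<le> \<theta> / 2 * dirichlet r + 1 / \<theta> * \<kappa>" using pos by (intro add_left_mono mult_left_mono \<kappa>) auto
  finally have "integral ?B (\<lambda>p. (norm (ut p) + norm (ux p)) * \<bar>\<phi> p\<bar>) \<le> \<theta> / 2 * dirichlet r + \<kappa> / \<theta>" by simp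
  then show ?thesis
    unfolding production_eq[OF tf]
    by (rule order_trans[OF production_square_integrable[OF c] mult_left_mono]) (use C_nonneg in simp)
qed

end

text \<open>The constant is chosen before all data other than \<open>A\<close>, \<alpha> and
  \<beta>. The bound on the initial energy makes the stability estimate uniform over the family; its
  growth 1 + \<epsilon>^2 reflects the weights in the energy, and data independent of \<epsilon>
  with finite integrals satisfy it because \<epsilon> \<le> 1 + \<epsilon>^2.\<close>

theorem theorem4p1p2:
  fixes A :: "real^'n^'n" and \<alpha> \<beta> :: real
  assumes "sym_pos_def A" and "\<alpha> > 0" and "\<beta> > 0"
  shows "\<exists>C\<^sub>1>0. \<forall>(F :: real^'n \<Rightarrow> real^'n) (G :: real^'n \<Rightarrow> real^'n)
             (\<eta> :: real^'n \<Rightarrow> real) (q :: real^'n \<Rightarrow> real) (R :: real^'n \<Rightarrow> real)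
             (T :: real) (u :: real \<Rightarrow> real \<times> real \<Rightarrow> real^'n).
           Ck_on 1 UNIV F \<and> continuous_on UNIV G \<and> G 0 = 0 \<and> T > 0 \<and>
           (\<forall>\<epsilon>>0. smooth_solution A F G T \<epsilon> (u \<epsilon>) \<and> fast_decay T (u \<epsilon>)) \<and>
           entropy_condition F \<eta> q \<alpha> \<beta> \<and>
           subcharacteristic A F \<eta> \<alpha> \<and>
           weak_dissipation \<eta> G \<and>
           source_potential G R
           \<longrightarrow>
           (\<forall>\<epsilon>>0. stability_estimate C\<^sub>1 G \<eta> R T \<epsilon> (u \<epsilon>)) \<and>
           ((\<exists>K. \<forall>\<epsilon>>0. energy T \<epsilon> (u \<epsilon>) 0 + \<epsilon> * potential_energy R (u \<epsilon>) 0 \<le> K * (1 + \<epsilon>\<^sup>2))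
            \<longrightarrow>
            (\<forall>\<eta>b qb C M.
               entropy_pair F \<eta>b qb \<and>
               (\<forall>v. \<bar>\<eta>b v\<bar> \<le> C \<and> \<bar>qb v\<bar> \<le> C \<and> norm (grad \<eta>b v) \<le> C \<and> norm (hessian \<eta>b v) \<le> C) \<and>
               (\<forall>v. \<bar>grad \<eta>b v \<bullet> G v\<bar> \<le> C * (M - grad \<eta> v \<bullet> G v))
               \<longrightarrow>
               (\<exists>\<K>. compactin (Hm1_loc_topology T) \<K> \<and>
                     {entropy_production T \<eta>b qb (u \<epsilon>) | \<epsilon>. \<epsilon> > 0} \<subseteq> \<K>)))"
proof -
  have At: "transpose A = A" using assms(1) by (simp add: sym_pos_def_def)
  obtain \<mu> where \<mu>: "\<mu> > 0" "\<And>\<xi>. \<mu> * (norm \<xi>)\<^sup>2 \<le> \<xi> \<bullet> (A *v \<xi>)" using pos_def_lower_bound[OF assms(1)] by blast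
  \<comment> \<open>The largest \<open>c\<close> below the three ceilings for comparing
    \<open>e\<close> with \<open>m\<close> and below 1, as the stability estimate asks.\<close>
  define c where "c = min (min 1 (\<beta> / 6)) (min (\<alpha> / 8) (\<alpha> * \<mu> / 2))"
  have c: "c > 0" "c \<le> 1" "c \<le> \<beta> / 6" "c \<le> \<alpha> / 8" "c \<le> \<alpha> * \<mu> / 2"
    using assms(2,3) \<mu>(1) by (auto simp: c_def)
  define C0 where "C0 = \<alpha> * (1 + norm A)"
  have C0: "C0 > 0" using assms(2) by (simp add: C0_def add_pos_nonneg)
  show ?thesis
  proof (intro exI[of _ "C0 / c"] conjI allI impI)
    show "C0 / c > 0" using C0 c by simp
    fix F G :: "real^'n \<Rightarrow> real^'n" and \<eta> q R :: "real^'n \<Rightarrow> real" and T and u :: "real \<Rightarrow> real \<times> real \<Rightarrow> real^'n"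
    assume H: "Ck_on 1 UNIV F \<and> continuous_on UNIV G \<and> G 0 = 0 \<and> T > 0 \<and>
           (\<forall>\<epsilon>>0. smooth_solution A F G T \<epsilon> (u \<epsilon>) \<and> fast_decay T (u \<epsilon>)) \<and>
           entropy_condition F \<eta> q \<alpha> \<beta> \<and>
           subcharacteristic A F \<eta> \<alpha> \<and>
           weak_dissipation \<eta> G \<and>
           source_potential G R"
    have T: "T > 0" using H by blast
    have eta_C2: "Ck_on 2 UNIV \<eta>" using H by (simp add: entropy_condition_def entropy_pair_def)
    have "subcharacteristic A F \<eta> \<alpha>" using H by blast
    from subcharacteristic_lower_bound[OF At eta_C2 this] obtain \<nu> where \<nu>: "\<nu> > 0"
      "\<And>u \<xi>. \<nu> * (norm \<xi>)\<^sup>2 + \<alpha> * (norm (jacobian F (at u) *v \<xi>))\<^sup>2 \<le> (hessian \<eta> u *v \<xi>) \<bullet> (A *v \<xi>)"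
      by blast
    have loc: "relaxation_entropy T (u \<epsilon>) A F G \<epsilon> \<eta> q R \<alpha> \<beta> \<mu> \<nu>" if "\<epsilon> > 0" for \<epsilon>
    proof -
      have "smooth_solution A F G T \<epsilon> (u \<epsilon>)" "fast_decay T (u \<epsilon>)" using H that by blast+
      then show ?thesis
        by unfold_locales (use H that assms \<mu> \<nu> At in \<open>simp_all add: smooth_solution_def\<close>)
    qed
    {
      fix \<epsilon> :: real assume "\<epsilon> > 0"
      from relaxation_entropy.stability[OF loc[OF this] c]
      show "stability_estimate (C0 / c) G \<eta> R T \<epsilon> (u \<epsilon>)" by (simp add: C0_def)
    }
    assume "\<exists>K. \<forall>\<epsilon>>0. energy T \<epsilon> (u \<epsilon>) 0 + \<epsilon> * potential_energy R (u \<epsilon>) 0 \<le> K * (1 + \<epsilon>\<^sup>2)"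
    then obtain K' where K': "\<And>\<epsilon>. \<epsilon> > 0 \<Longrightarrow> energy T \<epsilon> (u \<epsilon>) 0 + \<epsilon> * potential_energy R (u \<epsilon>) 0 \<le> K' * (1 + \<epsilon>\<^sup>2)"
      by blast
    define K where "K = \<bar>K'\<bar>"
    have K0: "K \<ge> 0" by (simp add: K_def)
    have K: "energy T \<epsilon> (u \<epsilon>) 0 + \<epsilon> * potential_energy R (u \<epsilon>) 0 \<le> K * (1 + \<epsilon>\<^sup>2)" if "\<epsilon> > 0" for \<epsilon>
      by (rule order_trans[OF K'[OF that]]) (auto simp: K_def intro!: mult_right_mono)
    fix \<eta>b qb :: "real^'n \<Rightarrow> real" and C M
    assume E: "entropy_pair F \<eta>b qb \<and>
               (\<forall>v. \<bar>\<eta>b v\<bar> \<le> C \<and> \<bar>qb v\<bar> \<le> C \<and> norm (grad \<eta>b v) \<le> C \<and> norm (hessian \<eta>b v) \<le> C) \<and>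
               (\<forall>v. \<bar>grad \<eta>b v \<bullet> G v\<bar> \<le> C * (M - grad \<eta> v \<bullet> G v))"
    have locb: "bounded_entropy T (u \<epsilon>) A F G \<epsilon> \<eta> q R \<alpha> \<beta> \<mu> \<nu> \<eta>b qb C M" if "\<epsilon> > 0" for \<epsilon>
      unfolding bounded_entropy_def bounded_entropy_axioms_def using loc[OF that] E by simp
    have C: "C \<ge> 0" using bounded_entropy.C_nonneg[OF locb[of 1]] by simp
    have n0: "min \<nu> (\<alpha> / 4) > 0" using \<nu>(1) assms(2) by simp
    let ?N = "\<lambda>\<epsilon> r. relaxation_entropy.dirichlet T (u \<epsilon>) r"
    let ?I = "\<lambda>\<epsilon> r. relaxation_entropy.absorbed T (u \<epsilon>) G \<eta> r"
    \<comment> \<open>For \<epsilon> \<le> 1 the data energy is at most \<open>2 * K\<close>; the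
      divisor is the smaller of the coefficients of |ux|^2 and |ut|^2 in the dissipation.\<close>
    define K1 where "K1 = C0 * (2 * K) / min \<nu> (\<alpha> / 4)"
    \<comment> \<open>Dividing the energy bound, of size 1 + \<epsilon>^2, by \<epsilon>^2 leaves
      1/\<epsilon>^2 + 1. This decreases in \<epsilon>, so its value at a threshold bounds all
      larger \<epsilon>.\<close>
    define K2 where "K2 = (\<lambda>e :: real. T * C0 * K * (1 / e\<^sup>2 + 1) / c)"
    have K1: "K1 \<ge> 0" using C0 K0 n0 by (simp add: K1_def)
    have K2: "K2 e \<ge> 0" for e using C0 K0 T c by (simp add: K2_def)
    have small: "\<epsilon> * ?N \<epsilon> r \<le> K1" "?I \<epsilon> r \<le> C0 * (2 * K)" if \<epsilon>: "\<epsilon> > 0" "\<epsilon> \<le> 1" for \<epsilon> r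
    proof -
      have "K * (1 + \<epsilon>\<^sup>2) \<le> K * 2" using \<epsilon> K0 by (intro mult_left_mono) (auto simp: power_le_one)
      then have KK: "energy T \<epsilon> (u \<epsilon>) 0 + \<epsilon> * potential_energy R (u \<epsilon>) 0 \<le> 2 * K" using K[OF \<epsilon>(1)] by linarith
      note d = relaxation_entropy.dirichlet_le[OF loc[OF \<epsilon>(1)] c(1,3-5) KK, of r, folded C0_def]
      show "\<epsilon> * ?N \<epsilon> r \<le> K1" using d(1) n0 by (simp add: K1_def pos_le_divide_eq mult_ac)
      show "?I \<epsilon> r \<le> C0 * (2 * K)" by (rule d(3))
    qed
    have large: "?N \<epsilon> r \<le> K2 e" if e: "0 < e" "e \<le> \<epsilon>" for \<epsilon> e r
    proof -
      have \<epsilon>: "\<epsilon> > 0" using e by linarith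
      have "c * (\<epsilon>\<^sup>2 * ?N \<epsilon> r) \<le> T * (C0 * (K * (1 + \<epsilon>\<^sup>2)))"
        by (rule relaxation_entropy.dirichlet_le(2)[OF loc[OF \<epsilon>] c(1,3-5) K[OF \<epsilon>], of r, folded C0_def])
      then have "?N \<epsilon> r * (c * \<epsilon>\<^sup>2) \<le> T * C0 * K * (1 + \<epsilon>\<^sup>2)" by (simp add: mult_ac)
      then have "?N \<epsilon> r \<le> T * C0 * K * (1 + \<epsilon>\<^sup>2) / (c * \<epsilon>\<^sup>2)" using c(1) \<epsilon> by (subst pos_le_divide_eq) auto
      also have "\<dots> = T * C0 * K * (1 / \<epsilon>\<^sup>2 + 1) / c" using c(1) \<epsilon> by (simp add: field_simps)
      also have "\<dots> \<le> K2 e"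
        unfolding K2_def using c(1) C0 K0 T e
        by (intro divide_right_mono mult_left_mono add_right_mono divide_left_mono power_mono) auto
      finally show ?thesis .
    qed
    show "\<exists>\<K>. compactin (Hm1_loc_topology T) \<K> \<and> {entropy_production T \<eta>b qb (u \<epsilon>) | \<epsilon>. \<epsilon> > 0} \<subseteq> \<K>"
    proof (rule Hm1_loc_compactness)
      show "{entropy_production T \<eta>b qb (u \<epsilon>) | \<epsilon>. \<epsilon> > 0} \<subseteq> extensional (test_functions (UNIV \<times> {0<..<T}))"
        by (auto simp: entropy_production_def regular_distribution_def)
      show "linear_on_tests T L" if "L \<in> {entropy_production T \<eta>b qb (u \<epsilon>) | \<epsilon>. \<epsilon> > 0}" for L
        using that bounded_entropy.production_linear[OF locb] by blast
      show "\<exists>B. \<forall>L\<in>{entropy_production T \<eta>b qb (u \<epsilon>) | \<epsilon>. \<epsilon> > 0}. \<forall>\<phi>\<in>test_functions (strip_box T r). \<bar>L \<phi>\<bar> \<le> B * H1_norm \<phi>"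
        if "r > 0" for r
        using bounded_entropy.production_bounded[OF locb _ that] by blast
      fix r \<tau> :: real assume r: "r > 0" and \<tau>: "\<tau> > 0"
      \<comment> \<open>The factor of \<delta> in the small-\<epsilon> estimate, with the absorbed
        source and the weighted Dirichlet integral replaced by their uniform bounds.\<close>
      define Q where "Q = C * (\<bar>M\<bar> * (2 * r * T) + C0 * (2 * K)) + C * (1 + norm A) * K1"
      have Q: "Q \<ge> 0" using C C0 K0 K1 r T by (simp add: Q_def)
      have L: "C * (1 + norm A) \<ge> 0" using C by simp
      obtain e0 \<kappa> \<delta> \<theta> \<theta>1 \<theta>2 where p: "e0 > 0" "e0 \<le> 1" "\<kappa> > 0" "\<delta> > 0" "\<theta> > 0" "\<theta>1 > 0" "\<theta>2 > 0"
        and le1: "C / \<delta> * (\<kappa> / \<theta> + 2 * \<theta>) + \<delta> * Q + C * (1 + norm A) * (e0 * K1 / (2 * \<theta>1) + 2 * \<theta>1) \<le> \<tau>"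
        and le2: "C * (1 + norm A) * (\<theta>2 / 2 * K2 e0 + \<kappa> / \<theta>2) \<le> \<tau>"
        by (rule modulus_parameters[OF C L Q K1 K2 \<tau>]) blast
      have "\<bar>entropy_production T \<eta>b qb (u \<epsilon>) \<phi>\<bar> \<le> \<tau>"
        if \<epsilon>: "\<epsilon> > 0" and \<phi>: "\<phi> \<in> test_functions (strip_box T r)" "H1_norm \<phi> \<le> 2"
          "integral (cbox (-r, 0) (r, T)) (\<lambda>p. (\<phi> p)\<^sup>2) \<le> \<kappa>" for \<epsilon> \<phi>
      proof (cases "\<epsilon> \<le> e0")
        case True
        then have "\<epsilon> \<le> 1" using p by linarith
        note s = small[OF \<epsilon> this, of r]
        have "\<bar>entropy_production T \<eta>b qb (u \<epsilon>) \<phi>\<bar> \<le> C / \<delta> * (\<kappa> / \<theta> + 2 * \<theta>)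
          + \<delta> * (C * (\<bar>M\<bar> * (2 * r * T) + ?I \<epsilon> r) + C * (1 + norm A) * (\<epsilon> * ?N \<epsilon> r))
          + C * (1 + norm A) * (\<epsilon>\<^sup>2 * ?N \<epsilon> r / (2 * \<theta>1) + 2 * \<theta>1)"
          by (rule bounded_entropy.production_small_eps[OF locb[OF \<epsilon>] \<phi>(1) r \<phi>(2,3) p(4-6)])
        also have "\<dots> \<le> C / \<delta> * (\<kappa> / \<theta> + 2 * \<theta>) + \<delta> * Q + C * (1 + norm A) * (e0 * K1 / (2 * \<theta>1) + 2 * \<theta>1)"
        proof (intro add_mono order_refl)
          show "\<delta> * (C * (\<bar>M\<bar> * (2 * r * T) + ?I \<epsilon> r) + C * (1 + norm A) * (\<epsilon> * ?N \<epsilon> r)) \<le> \<delta> * Q"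
            unfolding Q_def using p(4) by (intro mult_left_mono add_mono s L C order_refl) auto
          \<comment> \<open>One factor \<epsilon> is spent on the dissipation bound; the other is at
            most \<open>e0\<close> and makes the viscous fluxes small.\<close>
          have "\<epsilon>\<^sup>2 * ?N \<epsilon> r = \<epsilon> * (\<epsilon> * ?N \<epsilon> r)" by (simp add: power2_eq_square)
          also have "\<dots> \<le> \<epsilon> * K1" using \<epsilon> s(1) by (intro mult_left_mono) auto
          also have "\<dots> \<le> e0 * K1" using True K1 by (rule mult_right_mono)
          finally have "\<epsilon>\<^sup>2 * ?N \<epsilon> r / (2 * \<theta>1) \<le> e0 * K1 / (2 * \<theta>1)" using p(6) by (intro divide_right_mono) auto
          then show "C * (1 + norm A) * (\<epsilon>\<^sup>2 * ?N \<epsilon> r / (2 * \<theta>1) + 2 * \<theta>1) \<le> C * (1 + norm A) * (e0 * K1 / (2 * \<theta>1) + 2 * \<theta>1)"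
            by (intro mult_left_mono add_right_mono L)
        qed
        finally show ?thesis using le1 by linarith
      next
        case False
        then have e: "e0 \<le> \<epsilon>" by simp
        have "\<bar>entropy_production T \<eta>b qb (u \<epsilon>) \<phi>\<bar> \<le> C * (1 + norm A) * (\<theta>2 / 2 * ?N \<epsilon> r + \<kappa> / \<theta>2)"
          by (rule bounded_entropy.production_large_eps[OF locb[OF \<epsilon>] \<phi>(1,3) p(7)])
        also have "\<dots> \<le> C * (1 + norm A) * (\<theta>2 / 2 * K2 e0 + \<kappa> / \<theta>2)"
          using p(7) by (intro mult_left_mono add_right_mono L large[OF p(1) e]) auto
        finally show ?thesis using le2 by linarith
      qed
      then show "\<exists>\<kappa>>0. \<forall>L\<in>{entropy_production T \<eta>b qb (u \<epsilon>) | \<epsilon>. \<epsilon> > 0}. \<forall>\<phi>\<in>test_functions (strip_box T r).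
          H1_norm \<phi> \<le> 2 \<and> integral (cbox (-r, 0) (r, T)) (\<lambda>p. (\<phi> p)\<^sup>2) \<le> \<kappa> \<longrightarrow> \<bar>L \<phi>\<bar> \<le> \<tau>"
        using p(3) by (intro exI[of _ \<kappa>] conjI) auto
    qed
  qed
qed

end
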